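(* Let $\ell>0$, $\sigma\in[0,1)$, $\Omega=(0,\pi)\times(-\ell,\ell)$, and let $G(x,y,\rho,w)$, $(x,y),(\rho,w)\in\overline\Omega$, be the Green function of the biharmonic operator on $\Omega$ with partially hinged boundary conditions. Then the derivative $G_x$ of $G$ in the $x$-direction exists in the classical sense, $G_x\in C^0(\overline\Omega\times\overline\Omega)$, and for all $y,w\in[-\ell,\ell]$: \begin{itemize} \item $G_x(0,y,\rho,w)>0$ and $G_x(\pi,y,\rho,w)<0$ for all $\rho\in(0,\pi)$; \item $G_x\big(\frac{\pi}{2},y,\rho,w\big)<0$ for all $\rho\in\big(0,\frac{\pi}{2}\big)$; $G_x\big(\frac{\pi}{2},y,\frac{\pi}{2},w\big)=0$; $G_x\big(\frac{\pi}{2},y,\rho,w\big)>0$ for all $\rho\in\big(\frac{\pi}{2},\pi\big)$. \end{itemize} Furthermore, since $G(x,y,\rho,w)=G(\rho,y,x,w)$, the same results hold with the roles of $x$ and $\rho$ interchanged, i.e. $G_\rho\in C^0(\overline\Omega\times\overline\Omega)$ (classical derivative) and for all $y,w\in[-\ell,\ell]$: $G_\rho(x,y,0,w)>0$ and $G_\rho(x,y,\pi,w)<0$ for all $x\in(0,\pi)$; $G_\rho\big(x,y,\frac{\pi}{2},w\big)<0$ for all $x\in\big(0,\frac{\pi}{2}\big)$; $G_\rho\big(\frac{\pi}{2},y,\frac{\pi}{2},w\big)=0$; $G_\rho\big(x,y,\frac{\pi}{2},w\big)>0$ for all $x\in\big(\frac{\pi}{2},\pi\big)$.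
   Context: $H^2_*(\Omega)=\{u\in H^2(\Omega): u=0 \text{ on } \{0,\pi\}\times(-\ell,\ell)\}$ (it embeds into continuous functions on $\overline\Omega$), a Hilbert space with the scalar product $$(u,v)_{H^2_*(\Omega)}=\int_\Omega\left[\Delta u\,\Delta v+(1-\sigma)(2u_{xy}v_{xy}-u_{xx}v_{yy}-u_{yy}v_{xx})\right]dx\,dy,$$ whose norm is equivalent to the usual $H^2(\Omega)$ norm. This is the weak form of $\Delta^2$ in $\Omega$ with the partially hinged boundary conditions $u=u_{xx}=0$ at $x=0,\pi$ and $u_{yy}+\sigma u_{xx}=u_{yyy}+(2-\sigma)u_{xxy}=0$ at $y=\pm\ell$. For $p=(\rho,w)\in\overline\Omega$, the Green function $G(\cdot,p)=G(\cdot,\cdot,\rho,w)$ is the unique element of $H^2_*(\Omega)$ with $(G(\cdot,p),\varphi)_{H^2_*(\Omega)}=\varphi(p)$ for all $\varphi\in H^2_*(\Omega)$. *)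

theory Defs
  imports "HOL-Analysis.Analysis"
begin

section \<open>Test functions and weak derivatives in the plane\<close>

definition pderiv_dir :: "real \<times> real \<Rightarrow> (real \<times> real \<Rightarrow> real) \<Rightarrow> real \<times> real \<Rightarrow> real"
  where "pderiv_dir v f = (\<lambda>p. frechet_derivative f (at p) v)"

definition partial :: "nat \<Rightarrow> nat \<Rightarrow> (real \<times> real \<Rightarrow> real) \<Rightarrow> real \<times> real \<Rightarrow> real"
  where "partial i j f = (pderiv_dir (1, 0) ^^ i) ((pderiv_dir (0, 1) ^^ j) f)"

primrec C_k :: "nat \<Rightarrow> (real \<times> real \<Rightarrow> real) \<Rightarrow> bool"
  where
    "C_k 0 f \<longleftrightarrow> continuous_on UNIV f"
  | "C_k (Suc k) f \<longleftrightarrow>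
       (\<forall>p. f differentiable (at p)) \<and> C_k k (pderiv_dir (1, 0) f) \<and> C_k k (pderiv_dir (0, 1) f)"

text \<open>Test functions on an open set are taken to be extended by zero to the whole plane.\<close>

definition test_fun :: "(real \<times> real) set \<Rightarrow> (real \<times> real \<Rightarrow> real) set"
  where "test_fun \<Omega> =
    {\<phi>. (\<forall>k. C_k k \<phi>) \<and> compact (closure {p. \<phi> p \<noteq> 0}) \<and> closure {p. \<phi> p \<noteq> 0} \<subseteq> \<Omega>}"

definition L2 :: "(real \<times> real) set \<Rightarrow> (real \<times> real \<Rightarrow> real) set"
  where "L2 \<Omega> =
    {u. set_borel_measurable lborel \<Omega> u \<and> set_integrable lborel \<Omega> (\<lambda>p. (u p)\<^sup>2)}"

text \<open>\<open>v\<close> is an \<open>L\<^sup>2\<close> weak derivative of \<open>u\<close> of order \<open>i\<close> in \<open>x\<close> and \<open>j\<close> in \<open>y\<close>.\<close>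

definition weak_partial ::
    "(real \<times> real) set \<Rightarrow> nat \<Rightarrow> nat \<Rightarrow> (real \<times> real \<Rightarrow> real) \<Rightarrow> (real \<times> real \<Rightarrow> real) \<Rightarrow> bool"
  where "weak_partial \<Omega> i j u v \<longleftrightarrow> v \<in> L2 \<Omega> \<and>
    (\<forall>\<phi>\<in>test_fun \<Omega>.
       (LINT p:\<Omega>|lborel. u p * partial i j \<phi> p) = (-1) ^ (i + j) * (LINT p:\<Omega>|lborel. v p * \<phi> p))"

definition H2 :: "(real \<times> real) set \<Rightarrow> (real \<times> real \<Rightarrow> real) set"
  where "H2 \<Omega> = {u \<in> L2 \<Omega>. \<forall>i j. i + j \<le> 2 \<longrightarrow> (\<exists>v. weak_partial \<Omega> i j u v)}"

text \<open>A choice of weak derivative. It is determined only up to a null set (and is arbitrary if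
  there is none), so it is to be used under integrals, for functions in \<^const>\<open>H2\<close>.\<close>

definition wD :: "(real \<times> real) set \<Rightarrow> nat \<Rightarrow> nat \<Rightarrow> (real \<times> real \<Rightarrow> real) \<Rightarrow> real \<times> real \<Rightarrow> real"
  where "wD \<Omega> i j u = (SOME v. weak_partial \<Omega> i j u v)"

section \<open>The partially hinged plate\<close>

definition plate :: "real \<Rightarrow> (real \<times> real) set"
  where "plate l = {0<..<pi} \<times> {-l<..<l}"

text \<open>By the embedding of \<open>H\<^sup>2\<close> of the rectangle into the continuous functions on its closure,
  every class in that space has a representative continuous on the closure, unique there.
  Elements are given by this representative, so that the boundary condition and point values
  are meant pointwise. Values outside the closed rectangle are irrelevant.\<close>

definition H2_star :: "real \<Rightarrow> (real \<times> real \<Rightarrow> real) set"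
  where "H2_star l = {u \<in> H2 (plate l). continuous_on (closure (plate l)) u \<and>
    (\<forall>q \<in> {0, pi} \<times> {-l<..<l}. u q = 0)}"

definition H2_star_inner ::
    "real \<Rightarrow> real \<Rightarrow> (real \<times> real \<Rightarrow> real) \<Rightarrow> (real \<times> real \<Rightarrow> real) \<Rightarrow> real"
  where "H2_star_inner l \<sigma> u v =
    (let D = wD (plate l) in
     LINT p:plate l|lborel.
       (D 2 0 u p + D 0 2 u p) * (D 2 0 v p + D 0 2 v p)
       + (1 - \<sigma>) * (2 * D 1 1 u p * D 1 1 v p - D 2 0 u p * D 0 2 v p - D 0 2 u p * D 2 0 v p))"

text \<open>\<open>G x y \<rho> w\<close> is the value at \<open>(x, y)\<close> of the Green function with pole \<open>(\<rho>, w)\<close>; the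
  condition determines \<open>G\<close> uniquely for \<open>(x, y)\<close> and \<open>(\<rho>, w)\<close> in the closed rectangle.\<close>

definition is_green_function ::
    "real \<Rightarrow> real \<Rightarrow> (real \<Rightarrow> real \<Rightarrow> real \<Rightarrow> real \<Rightarrow> real) \<Rightarrow> bool"
  where "is_green_function l \<sigma> G \<longleftrightarrow>
    (\<forall>(\<rho>, w) \<in> closure (plate l).
       (\<lambda>(x, y). G x y \<rho> w) \<in> H2_star l \<and>
       (\<forall>\<phi> \<in> H2_star l. H2_star_inner l \<sigma> (\<lambda>(x, y). G x y \<rho> w) \<phi> = \<phi> (\<rho>, w)))"

end

(*
  The sine coefficients of x |-> G(x, y, rho, w) are (2/pi) sin(m rho) K_m(w, y), where K_m is the
  Green function of the form
    B_m(g, h) = int g'' h'' - sigma m^2 (g h'' + g'' h) + m^4 g h + 2 (1 - sigma) m^2 g' h'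
  on (-l, l). This is seen by testing with sin(m x) h(y), h smooth with the natural boundary
  conditions: no trace of the derivatives of G is needed, since all boundary terms vanish in the limit
  of cutoffs. As K_m = O(m^-3), the series for G_x converges uniformly.

  All signs follow from a single fact: m^2 K_m(w, y) is positive and strictly decreasing in m, because
  then the partial sums of sin(m x) / m, which are nonnegative (Fejer and Jackson), can be combined by
  Abel summation. The monotonicity comes from the identity
    m^2 K_m(w, y) - n^2 K_n(w, y)
      = (n^2 - m^2) int (m^2 K_m(w, .) n^2 K_n(y, .) - K_m(w, .)'' K_n(y, .)'')
  and from |K_m(w, .)''| <= m^2 K_m(w, .). The latter is the minimum principle for g - g'' and g + g''
  (in units where m = 1), once g + g'' is known to be positive at the pole w and g at the ends.
*)

theory Submission
  imports Defs
begin

section \<open>The Green function of a single mode\<close>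

text \<open>All that is known of \<open>G\<close> is continuity up to the closed plate, the zero
  values on the hinged sides and the reproducing identity; its weak derivatives are an arbitrary
  choice up to null sets. So every derivative has to be moved off \<open>G\<close>. Profiles h are
  needed only for the right-hand sides exp(k y), k > m: after splitting off exp((m + 1) y) these are
  the powers of exp y, enough by Stone-Weierstrass to identify a continuous function of y. For them
  h is elementary, as is K_m itself, so that no existence theorem for boundary value problems
  enters.

  One inequality serves all the signs. At x = 0 the series is the sum of (2/pi) m^2 K_m sin(m rho) /
  m. At x = pi there is a further factor (-1)^m, absorbed by reflecting rho to pi - rho. At x = pi/2
  only even m survive, and the sum has the same form in the variable 2 rho, again with alternating
  signs.

  The condition sigma < 1 makes the form coercive. It also makes |K_m''| < m^2 K_m strict at y = l,
  where K_m'' = sigma m^2 K_m, whence the strict decrease.\<close>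

text \<open>Units are such that \<open>m = 1\<close>; so \<open>L\<close> stands for \<open>m l\<close>, and \<open>\<theta>\<close> for \<open>1 - \<sigma>\<close>. Up to factors,
  \<open>det_even\<close> and \<open>det_odd\<close> are the determinants of the natural boundary conditions at \<open>L\<close> on the
  even solutions \<open>cosh y\<close>, \<open>y sinh y\<close> and on the odd solutions \<open>sinh y\<close>, \<open>y cosh y\<close> of
  \<open>(D\<^sup>2 - 1)\<^sup>2 g = 0\<close>. The functions \<open>kern0\<close> to \<open>kern3\<close> are the Green function with pole \<open>w\<close> and its
  derivatives in \<open>y\<close>, where \<open>e = 1\<close> for \<open>w \<le> y\<close> and \<open>e = -1\<close> for \<open>y \<le> w\<close>.\<close>

definition det_even :: "real \<Rightarrow> real \<Rightarrow> real"
  where "det_even \<theta> L = (4 - \<theta>) * sinh L * cosh L - \<theta> * L"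

definition det_odd :: "real \<Rightarrow> real \<Rightarrow> real"
  where "det_odd \<theta> L = (4 - \<theta>) * sinh L * cosh L + \<theta> * L"

text \<open>The free kernel e (z cosh z - sinh z) / 4, z = y - w, is the even fundamental solution
  of (D^2 - 1)^2: its third derivative jumps from -1/2 to 1/2. The correction splits by parity:
  \<open>cf_cosh\<close>, \<open>cf_ysinh\<close> multiply the even solutions,
  \<open>cf_sinh\<close>, \<open>cf_ycosh\<close> the odd ones, and each pair solves the 2 x 2
  system of the natural conditions at \<open>L\<close>. The matrix of each pair with respect to
  (cosh w, w sinh w), respectively (sinh w, w cosh w), is symmetric; hence
  \<open>kern_sym\<close>.\<close>

definition cf_cosh :: "real \<Rightarrow> real \<Rightarrow> real \<Rightarrow> real"
  where "cf_cosh \<theta> L w = ((4 / \<theta> + (4 - \<theta>) * (sinh L)\<^sup>2 + \<theta> * L\<^sup>2) * cosh w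
    - ((4 - \<theta>) * (sinh L)\<^sup>2 + 2) * (w * sinh w)) / (4 * det_even \<theta> L)"

definition cf_ysinh :: "real \<Rightarrow> real \<Rightarrow> real \<Rightarrow> real"
  where "cf_ysinh \<theta> L w = (\<theta> * (w * sinh w) - ((4 - \<theta>) * (sinh L)\<^sup>2 + 2) * cosh w)
    / (4 * det_even \<theta> L)"

definition cf_sinh :: "real \<Rightarrow> real \<Rightarrow> real \<Rightarrow> real"
  where "cf_sinh \<theta> L w = ((4 / \<theta> - (4 - \<theta>) * (cosh L)\<^sup>2 + \<theta> * L\<^sup>2) * sinh w
    + ((4 - \<theta>) * (cosh L)\<^sup>2 - 2) * (w * cosh w)) / (4 * det_odd \<theta> L)"

definition cf_ycosh :: "real \<Rightarrow> real \<Rightarrow> real \<Rightarrow> real"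
  where "cf_ycosh \<theta> L w = (\<theta> * (w * cosh w) + ((4 - \<theta>) * (cosh L)\<^sup>2 - 2) * sinh w)
    / (4 * det_odd \<theta> L)"

definition kern0 :: "real \<Rightarrow> real \<Rightarrow> real \<Rightarrow> real \<Rightarrow> real \<Rightarrow> real"
  where "kern0 \<theta> L e w y = e * ((y - w) * cosh (y - w) - sinh (y - w)) / 4
    + cf_cosh \<theta> L w * cosh y + cf_ysinh \<theta> L w * (y * sinh y)
    + cf_sinh \<theta> L w * sinh y + cf_ycosh \<theta> L w * (y * cosh y)"

definition kern1 :: "real \<Rightarrow> real \<Rightarrow> real \<Rightarrow> real \<Rightarrow> real \<Rightarrow> real"
  where "kern1 \<theta> L e w y = e * ((y - w) * sinh (y - w)) / 4
    + cf_cosh \<theta> L w * sinh y + cf_ysinh \<theta> L w * (sinh y + y * cosh y)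
    + cf_sinh \<theta> L w * cosh y + cf_ycosh \<theta> L w * (cosh y + y * sinh y)"

definition kern2 :: "real \<Rightarrow> real \<Rightarrow> real \<Rightarrow> real \<Rightarrow> real \<Rightarrow> real"
  where "kern2 \<theta> L e w y = e * (sinh (y - w) + (y - w) * cosh (y - w)) / 4
    + cf_cosh \<theta> L w * cosh y + cf_ysinh \<theta> L w * (2 * cosh y + y * sinh y)
    + cf_sinh \<theta> L w * sinh y + cf_ycosh \<theta> L w * (2 * sinh y + y * cosh y)"

definition kern3 :: "real \<Rightarrow> real \<Rightarrow> real \<Rightarrow> real \<Rightarrow> real \<Rightarrow> real"
  where "kern3 \<theta> L e w y = e * (2 * cosh (y - w) + (y - w) * sinh (y - w)) / 4
    + cf_cosh \<theta> L w * sinh y + cf_ysinh \<theta> L w * (3 * sinh y + y * cosh y)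
    + cf_sinh \<theta> L w * cosh y + cf_ycosh \<theta> L w * (3 * cosh y + y * sinh y)"

section \<open>The kernel in units m = 1: derivatives, reflection, boundary conditions,
  positivity\<close>

lemma kern_deriv:
  "(kern0 \<theta> L e w has_real_derivative kern1 \<theta> L e w y) (at y within X)"
  "(kern1 \<theta> L e w has_real_derivative kern2 \<theta> L e w y) (at y within X)"
  "(kern2 \<theta> L e w has_real_derivative kern3 \<theta> L e w y) (at y within X)"
  "(kern3 \<theta> L e w has_real_derivative 2 * kern2 \<theta> L e w y - kern0 \<theta> L e w y) (at y within X)"
  unfolding kern0_def kern1_def kern2_def kern3_def
  by (auto intro!: derivative_eq_intros simp: field_simps)

lemma cf_minus:
  "cf_cosh \<theta> L (- w) = cf_cosh \<theta> L w" "cf_ysinh \<theta> L (- w) = cf_ysinh \<theta> L w"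
  "cf_sinh \<theta> L (- w) = - cf_sinh \<theta> L w" "cf_ycosh \<theta> L (- w) = - cf_ycosh \<theta> L w"
  unfolding cf_cosh_def cf_ysinh_def cf_sinh_def cf_ycosh_def minus_divide_left
  by (simp_all add: cosh_minus sinh_minus)

lemma kern_minus:
  "kern0 \<theta> L (- e) (- w) (- y) = kern0 \<theta> L e w y"
  "kern1 \<theta> L (- e) (- w) (- y) = - kern1 \<theta> L e w y"
  "kern2 \<theta> L (- e) (- w) (- y) = kern2 \<theta> L e w y"
  "kern3 \<theta> L (- e) (- w) (- y) = - kern3 \<theta> L e w y"
proof -
  have *: "- y - - w = - (y - w)" by simp
  show
    "kern0 \<theta> L (- e) (- w) (- y) = kern0 \<theta> L e w y"
    "kern1 \<theta> L (- e) (- w) (- y) = - kern1 \<theta> L e w y"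
    "kern2 \<theta> L (- e) (- w) (- y) = kern2 \<theta> L e w y"
    "kern3 \<theta> L (- e) (- w) (- y) = - kern3 \<theta> L e w y"
    unfolding kern0_def kern1_def kern2_def kern3_def cf_minus * cosh_minus sinh_minus
    by (simp_all add: field_simps)
qed

lemma det_even_pos:
  assumes "0 < L" "0 < \<theta>" "\<theta> \<le> 1"
  shows "0 < det_even \<theta> L"
proof -
  have s: "L \<le> sinh L"
    using real_le_x_sinh[of L] assms by (simp add: sinh_field_def exp_minus)
  have "L * 1 \<le> sinh L * cosh L"
    using s assms by (intro mult_mono cosh_real_ge_1) auto
  moreover have "3 * (sinh L * cosh L) \<le> (4 - \<theta>) * (sinh L * cosh L)"
    using assms by (intro mult_right_mono mult_nonneg_nonneg) auto
  moreover have "\<theta> * L \<le> 1 * L"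
    using assms by (intro mult_right_mono) auto
  ultimately show ?thesis using assms unfolding det_even_def mult.assoc by linarith
qed

lemma det_odd_pos:
  assumes "0 < L" "0 < \<theta>" "\<theta> \<le> 1"
  shows "0 < det_odd \<theta> L"
  using assms unfolding det_odd_def by (intro add_pos_pos mult_pos_pos) auto

text \<open>Clears the denominators, so that claims about the kernel at \<open>L\<close> become
  polynomial identities modulo c^2 = s^2 + 1 and theta k = 1. \<open>X / 4\<close> is the
  contribution of the free kernel, \<open>p\<close> and \<open>r\<close> are the numerators of a
  pair of coefficients.\<close>

lemma divide_out_determinant:
  fixes D :: real
  assumes "X * D + (p * q + r * t) = 2 * Y" "4 * D * i = 1"
  shows "X / 4 + (p * i * q + r * i * t) = 2 * i * Y"
proof -
  have "X = 4 * (X * D) * i" using assms(2) by algebra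
  also have "X * D = 2 * Y - (p * q + r * t)" using assms(1) by simp
  finally show ?thesis by (simp add: algebra_simps)
qed

context
  fixes \<theta> L w s c S C i j k a b a' b' :: real
  assumes L: "0 < L" and \<theta>: "0 < \<theta>" "\<theta> \<le> 1"
  defines "s \<equiv> sinh L" and "c \<equiv> cosh L" and "S \<equiv> sinh w" and "C \<equiv> cosh w"
    and "i \<equiv> 1 / (4 * det_even \<theta> L)" and "j \<equiv> 1 / (4 * det_odd \<theta> L)" and "k \<equiv> 1 / \<theta>"
    and "a \<equiv> (4 * k + (4 - \<theta>) * s\<^sup>2 + \<theta> * L\<^sup>2) * C - ((4 - \<theta>) * s\<^sup>2 + 2) * (w * S)"
    and "b \<equiv> \<theta> * (w * S) - ((4 - \<theta>) * s\<^sup>2 + 2) * C"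
    and "a' \<equiv> (4 * k - (4 - \<theta>) * c\<^sup>2 + \<theta> * L\<^sup>2) * S + ((4 - \<theta>) * c\<^sup>2 - 2) * (w * C)"
    and "b' \<equiv> \<theta> * (w * C) + ((4 - \<theta>) * c\<^sup>2 - 2) * S"
begin

lemma det_inverse:
  "4 * ((4 - \<theta>) * s * c - \<theta> * L) * i = 1" "4 * ((4 - \<theta>) * s * c + \<theta> * L) * j = 1"
  using det_even_pos[OF L \<theta>] det_odd_pos[OF L \<theta>]
  by (simp_all add: s_def c_def i_def j_def det_even_def det_odd_def)

lemma det_inverse_pos: "0 < j" "j \<le> i"
  using det_even_pos[OF L \<theta>] det_odd_pos[OF L \<theta>] L \<theta>
  by (auto simp: i_def j_def det_even_def det_odd_def intro!: divide_left_mono mult_pos_pos)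

lemma theta_inverse: "\<theta> * (k * x) = x" "1 \<le> k"
  using \<theta> by (simp_all add: k_def)

lemma cosh_sq: "c * c = s * s + 1" "c * (c * x) = s * (s * x) + x"
proof -
  show *: "c * c = s * s + 1"
    by (simp add: s_def c_def cosh_square_eq flip: power2_eq_square)
  show "c * (c * x) = s * (s * x) + x"
    unfolding mult.assoc[symmetric] * by (simp add: distrib_right)
qed

lemma cf_eq:
  "cf_cosh \<theta> L w = a * i" "cf_ysinh \<theta> L w = b * i" "cf_sinh \<theta> L w = a' * j" "cf_ycosh \<theta> L w = b' * j"
  by (simp_all add: a_def b_def a'_def b'_def cf_cosh_def cf_ysinh_def cf_sinh_def cf_ycosh_def
      s_def c_def S_def C_def i_def j_def k_def)

lemmas kern_abbrevs = cf_eq s_def[symmetric] c_def[symmetric] S_def[symmetric] C_def[symmetric]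

text \<open>The natural conditions g'' = sigma g and g''' = (2 - sigma) g' with sigma = 1 - theta.
  After expansion by the addition formulas the parts even in w (\<open>e1\<close>,
  \<open>e2\<close>) and odd in w (\<open>o1\<close>, \<open>o2\<close>) vanish separately.\<close>

lemma kern_bc_top:
  "kern2 \<theta> L 1 w L = (1 - \<theta>) * kern0 \<theta> L 1 w L" "kern3 \<theta> L 1 w L = (1 + \<theta>) * kern1 \<theta> L 1 w L"
proof -
  note simps = algebra_simps power2_eq_square cosh_sq theta_inverse(1)
  have e1: "((2 - \<theta>) * s * C + \<theta> * (L * c * C + s * w * S)) / 4
      + (a * i * (\<theta> * c) + b * i * (2 * c + \<theta> * L * s)) = 2 * i * 0"
    by (rule divide_out_determinant[OF _ det_inverse(1)], unfold a_def b_def) (simp add: simps)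
  have e2: "(2 * c * C - \<theta> * (L * s * C + c * w * S)) / 4
      + (a * i * (\<theta> * (- s)) + b * i * ((2 - \<theta>) * s - \<theta> * L * c)) = 2 * i * 0"
    by (rule divide_out_determinant[OF _ det_inverse(1)], unfold a_def b_def) (simp add: simps)
  have o1: "(- ((2 - \<theta>) * c * S + \<theta> * (L * s * S + c * w * C))) / 4
      + (a' * j * (\<theta> * s) + b' * j * (2 * s + \<theta> * L * c)) = 2 * j * 0"
    by (rule divide_out_determinant[OF _ det_inverse(2)], unfold a'_def b'_def) (simp add: simps)
  have o2: "(- (2 * s * S - \<theta> * (L * c * S + s * w * C))) / 4
      + (a' * j * (\<theta> * (- c)) + b' * j * ((2 - \<theta>) * c - \<theta> * L * s)) = 2 * j * 0"
    by (rule divide_out_determinant[OF _ det_inverse(2)], unfold a'_def b'_def) (simp add: simps)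
  show "kern2 \<theta> L 1 w L = (1 - \<theta>) * kern0 \<theta> L 1 w L"
    unfolding kern0_def kern2_def sinh_diff cosh_diff kern_abbrevs
    using e1 o1 by (simp add: field_simps)
  show "kern3 \<theta> L 1 w L = (1 + \<theta>) * kern1 \<theta> L 1 w L"
    unfolding kern1_def kern3_def sinh_diff cosh_diff kern_abbrevs
    using e2 o2 by (simp add: field_simps)
qed

text \<open>The parts \<open>e0\<close> and \<open>o0\<close>, even and odd in w, combine by the
  addition formulas: \<open>e0 + o0\<close> and \<open>e0 - o0\<close> are visibly positive for |w|
  \<le> L, so |o0| < e0. The even determinant is the smaller one, that is \<open>j \<le> i\<close>,
  and therefore the even part dominates.\<close>

lemma kern_top_pos:
  assumes "\<bar>w\<bar> \<le> L"
  shows "0 < kern0 \<theta> L 1 w L"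
proof -
  define e0 o0 where e0: "e0 = (2 * c * k + L * s) * C - c * w * S"
    and o0: "o0 = (2 * s * k + L * c) * S - s * w * C"
  have e1: "(L * c * C + s * w * S - s * C) / 4 + (a * i * c + b * i * (L * s)) = 2 * i * e0"
    by (rule divide_out_determinant[OF _ det_inverse(1)], unfold a_def b_def e0)
      (simp add: algebra_simps power2_eq_square cosh_sq theta_inverse(1))
  have o1: "(- (L * s * S + c * w * C - c * S)) / 4 + (a' * j * s + b' * j * (L * c)) = 2 * j * o0"
    by (rule divide_out_determinant[OF _ det_inverse(2)], unfold a'_def b'_def o0)
      (simp add: algebra_simps power2_eq_square cosh_sq theta_inverse(1))
  have "kern0 \<theta> L 1 w L = 2 * (i * e0 + j * o0)"
    using e1 o1 unfolding kern0_def sinh_diff cosh_diff kern_abbrevs by (simp add: field_simps)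
  moreover have "0 < i * e0 + j * o0"
  proof -
    have "e0 + o0 = 2 * k * cosh (L + w) + (L - w) * sinh (L + w)"
      unfolding e0 o0 sinh_add cosh_add s_def c_def S_def C_def by (simp add: algebra_simps)
    moreover have "e0 - o0 = 2 * k * cosh (L - w) + (L + w) * sinh (L - w)"
      unfolding e0 o0 sinh_diff cosh_diff s_def c_def S_def C_def by (simp add: algebra_simps)
    moreover have "0 \<le> (L - w) * sinh (L + w)" "0 \<le> (L + w) * sinh (L - w)"
      using assms by (auto intro!: mult_nonneg_nonneg)
    moreover have "0 < 2 * k * cosh (L + w)" "0 < 2 * k * cosh (L - w)"
      using theta_inverse(2) by simp_all
    ultimately have "\<bar>o0\<bar> < e0" by linarith
    then have "j * \<bar>o0\<bar> < j * e0" using det_inverse_pos by simp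
    also have "j * e0 \<le> i * e0" using det_inverse_pos \<open>\<bar>o0\<bar> < e0\<close> by (intro mult_right_mono) auto
    finally have "j * \<bar>o0\<bar> < i * e0" .
    moreover have "- (j * o0) \<le> j * \<bar>o0\<bar>"
      using det_inverse_pos by (metis abs_ge_minus_self abs_mult abs_of_pos)
    ultimately show ?thesis by linarith
  qed
  ultimately show ?thesis by simp
qed

text \<open>The value of g + g'' at the pole, needed as a boundary value in the minimum principle.
  With both determinants cleared it is \<open>8 * i * j * T\<close>. The product subtracted inside
  \<open>T\<close> is controlled by (L - w)^2 \<ge> 0 and by sinh (L - w) cosh (L - w) \<ge> 0; the
  last summand of \<open>T\<close> makes the result strict.\<close>

lemma kern_diag_pos_right:
  assumes w: "0 \<le> w" "w \<le> L"
  shows "0 < kern0 \<theta> L e w w + kern2 \<theta> L e w w"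
proof -
  define D E where DE: "D = (4 - \<theta>) * s * c - \<theta> * L" "E = (4 - \<theta>) * s * c + \<theta> * L"
  have c2: "c\<^sup>2 = s\<^sup>2 + 1" "C\<^sup>2 = S\<^sup>2 + 1"
    by (simp_all add: s_def c_def S_def C_def cosh_square_eq)
  define K M where KM: "K = 4 * k - 2 + \<theta> * L\<^sup>2" "M = (4 - \<theta>) * (2 * s\<^sup>2 + 1)"
  have P: "kern0 \<theta> L e w w + kern2 \<theta> L e w w = 2 * (a * i * C + b * i * (w * S + C) + a' * j * S + b' * j * (w * C + S))"
    unfolding kern0_def kern2_def kern_abbrevs by (simp add: algebra_simps)
  have ev: "a * i * C + b * i * (w * S + C) = (K * C\<^sup>2 + \<theta> * w\<^sup>2 * S\<^sup>2 - M * w * C * S) * i"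
    unfolding a_def b_def KM by algebra
  have od: "a' * j * S + b' * j * (w * C + S) = (K * S\<^sup>2 + \<theta> * w\<^sup>2 * C\<^sup>2 + M * w * C * S) * j"
    unfolding a'_def b'_def KM using c2 by algebra
  define T where "T = (4 - \<theta>) * (s * c * (C\<^sup>2 + S\<^sup>2) * (K + \<theta> * w\<^sup>2) - (2 * s\<^sup>2 + 1) * w * (2 * S * C) * \<theta> * L)
      + \<theta> * L * (K - \<theta> * w\<^sup>2)"
  have "kern0 \<theta> L e w w + kern2 \<theta> L e w w = 8 * i * j * T"
  proof -
    define X Y where XY: "X = K * C\<^sup>2 + \<theta> * w\<^sup>2 * S\<^sup>2 - M * w * C * S"
      "Y = K * S\<^sup>2 + \<theta> * w\<^sup>2 * C\<^sup>2 + M * w * C * S"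
    have "T = X * E + Y * D"
      unfolding T_def XY DE KM(2) using c2 by algebra
    moreover have "kern0 \<theta> L e w w + kern2 \<theta> L e w w = 2 * (X * i + Y * j)"
      unfolding P using ev od XY by simp
    ultimately show ?thesis using det_inverse[folded DE] by algebra
  qed
  moreover have "0 < T"
  proof -
    have K: "2 + \<theta> * L\<^sup>2 \<le> K" using theta_inverse(2) by (simp add: KM)
    have w2: "\<theta> * w\<^sup>2 \<le> \<theta> * L\<^sup>2" using L \<theta> assms w by (intro mult_left_mono power_mono) auto
    have nn: "0 \<le> s" "1 \<le> c" "1 \<le> C" "0 \<le> S" using L \<theta> assms w by (auto simp: s_def c_def S_def C_def cosh_real_ge_1)
    have "0 \<le> \<theta> * (L - w)\<^sup>2" using L \<theta> assms by auto
    then have "2 * \<theta> * L * w \<le> K + \<theta> * w\<^sup>2" using K by (simp add: power2_eq_square algebra_simps)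
    then have "s * c * (C\<^sup>2 + S\<^sup>2) * (2 * \<theta> * L * w) \<le> s * c * (C\<^sup>2 + S\<^sup>2) * (K + \<theta> * w\<^sup>2)"
      using nn by (intro mult_left_mono) auto
    \<comment> \<open>As \<open>2 * s\<^sup>2 + 1\<close> is cosh (2 L) and
      \<open>C\<^sup>2 + S\<^sup>2\<close> is cosh (2 w), this is half the addition formula for sinh
      (2 L - 2 w).\<close>
    moreover have "sinh (L - w) * cosh (L - w) = s * c * (C\<^sup>2 + S\<^sup>2) - (2 * s\<^sup>2 + 1) * (S * C)"
      unfolding sinh_diff cosh_diff kern_abbrevs using c2 by algebra
    then have "(2 * s\<^sup>2 + 1) * (S * C) \<le> s * c * (C\<^sup>2 + S\<^sup>2)"
      using assms by (metis cosh_real_nonneg diff_ge_0_iff_ge mult_nonneg_nonneg sinh_real_nonneg_iff)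
    then have "(2 * s\<^sup>2 + 1) * (S * C) * (2 * \<theta> * L * w) \<le> s * c * (C\<^sup>2 + S\<^sup>2) * (2 * \<theta> * L * w)"
      using L \<theta> assms w by (intro mult_right_mono) auto
    ultimately have "s * c * (C\<^sup>2 + S\<^sup>2) * (K + \<theta> * w\<^sup>2) \<ge> (2 * s\<^sup>2 + 1) * (S * C) * (2 * \<theta> * L * w)"
      by (rule order_trans[rotated])
    then have "0 \<le> s * c * (C\<^sup>2 + S\<^sup>2) * (K + \<theta> * w\<^sup>2) - (2 * s\<^sup>2 + 1) * w * (2 * S * C) * \<theta> * L"
      by (simp add: mult_ac)
    then have "0 \<le> (4 - \<theta>) * (s * c * (C\<^sup>2 + S\<^sup>2) * (K + \<theta> * w\<^sup>2) - (2 * s\<^sup>2 + 1) * w * (2 * S * C) * \<theta> * L)"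
      using L \<theta> assms by (intro mult_nonneg_nonneg) simp_all
    moreover have "0 < \<theta> * L * (K - \<theta> * w\<^sup>2)"
      proof -
      have "0 < K - \<theta> * w\<^sup>2" using K w2 by linarith
      then show ?thesis using L \<theta> assms by simp
    qed
    ultimately show ?thesis
      unfolding T_def by (rule add_nonneg_pos)
  qed
  moreover have "0 < i" "0 < j"
    using det_inverse_pos by simp_all
  ultimately show ?thesis by simp
qed

end

lemma kern_diag_pos:
  assumes "0 < L" "0 < \<theta>" "\<theta> \<le> 1" "\<bar>w\<bar> \<le> L"
  shows "0 < kern0 \<theta> L e w w + kern2 \<theta> L e w w"
proof (cases "0 \<le> w")
  case True
  then show ?thesis using kern_diag_pos_right[OF assms(1-3), of w] assms(4) by simp
next
  case False
  then show ?thesis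
    using kern_diag_pos_right[OF assms(1-3), of "- w" "- e"] assms(4) kern_minus[of \<theta> L e w w] by simp
qed

lemma kern_bc_bot:
  assumes "0 < L" "0 < \<theta>" "\<theta> \<le> 1"
  shows "kern2 \<theta> L (-1) w (-L) = (1 - \<theta>) * kern0 \<theta> L (-1) w (-L)"
    and "kern3 \<theta> L (-1) w (-L) = (1 + \<theta>) * kern1 \<theta> L (-1) w (-L)"
  using kern_bc_top[OF assms, of "- w"] kern_minus[of \<theta> L 1 "- w" L] by simp_all

lemma kern_sym: "kern0 \<theta> L (- e) y w = kern0 \<theta> L e w y"
proof -
  have *: "w - y = - (y - w)" by simp
  have 1: "cf_cosh \<theta> L y * cosh w + cf_ysinh \<theta> L y * (w * sinh w)
      = cf_cosh \<theta> L w * cosh y + cf_ysinh \<theta> L w * (y * sinh y)"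
    unfolding cf_cosh_def cf_ysinh_def times_divide_eq_left add_divide_distrib[symmetric]
    by (rule arg_cong[where f = "\<lambda>t. t / _"]) algebra
  have 2: "cf_sinh \<theta> L y * sinh w + cf_ycosh \<theta> L y * (w * cosh w)
      = cf_sinh \<theta> L w * sinh y + cf_ycosh \<theta> L w * (y * cosh y)"
    unfolding cf_sinh_def cf_ycosh_def times_divide_eq_left add_divide_distrib[symmetric]
    by (rule arg_cong[where f = "\<lambda>t. t / _"]) algebra
  have 3: "- e * ((w - y) * cosh (w - y) - sinh (w - y)) = e * ((y - w) * cosh (y - w) - sinh (y - w))"
    unfolding * cosh_minus sinh_minus by algebra
  show ?thesis
    unfolding kern0_def 3 using 1 2 by simp
qed

section \<open>The minimum principle and the bound of |g''| by g\<close>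

lemma minimum_principle:
  fixes v v1 v2 :: "real \<Rightarrow> real"
  assumes v1: "\<And>x. (v has_real_derivative v1 x) (at x)"
    and v2: "\<And>x. (v1 has_real_derivative v2 x) (at x)"
    and le: "\<And>x. a < x \<Longrightarrow> x < b \<Longrightarrow> v2 x \<le> v x"
    and ab: "0 \<le> v a" "0 \<le> v b" and x: "a \<le> x" "x \<le> b"
  shows "0 \<le> v x"
proof (rule ccontr)
  assume neg: "\<not> 0 \<le> v x"
  have "continuous_on {a..b} v"
    using v1 by (intro DERIV_continuous_on) (blast intro: has_field_derivative_at_within)
  then obtain z where z: "z \<in> {a..b}" "\<forall>y\<in>{a..b}. v z \<le> v y"
    using continuous_attains_inf[of "{a..b}" v] x by auto
  have "v z \<le> v x" using z x by auto
  then have vz: "v z < 0" using neg by linarith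
  then have int: "a < z" "z < b"
    using z(1) ab by (auto simp: less_le)
  have v1z: "v1 z = 0"
  proof (rule DERIV_local_min[OF v1[of z], of "min (z - a) (b - z)"])
    show "\<forall>y. \<bar>z - y\<bar> < min (z - a) (b - z) \<longrightarrow> v z \<le> v y"
    proof (intro allI impI)
      fix y assume "\<bar>z - y\<bar> < min (z - a) (b - z)"
      then have "y \<in> {a..b}" by (auto simp: abs_less_iff)
      then show "v z \<le> v y" using z(2) by blast
    qed
  qed (use int in auto)
  have "v2 z < 0" using le[OF int] vz by linarith
  \<comment> \<open>Only pointwise second derivatives are at hand, so the sign of
    \<open>v2 z\<close> is used through the decrease of \<open>v1\<close> just after the critical
    point; the mean value theorem then contradicts minimality.\<close>
  from DERIV_neg_dec_right[OF v2 this] obtain d where d: "d > 0"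
    "\<And>h. 0 < h \<Longrightarrow> h < d \<Longrightarrow> v1 (z + h) < 0" using v1z by auto
  define h where "h = min (d / 2) (b - z)"
  have h: "0 < h" "h < d" "z + h \<le> b" using d(1) int by (auto simp: h_def min_def)
  obtain y where y: "z < y" "y < z + h" "v (z + h) - v z = (z + h - z) * v1 y"
    using MVT2[of z "z + h" v v1] h(1) v1 by auto
  have "v1 y < 0" using d(2)[of "y - z"] y h by auto
  then have "v (z + h) < v z"
    using y(3) h(1) by (metis add_diff_cancel_left' diff_less_0_iff_less mult_pos_neg)
  moreover have "z + h \<in> {a..b}" using h int by auto
  ultimately show False using z(2) by fastforce
qed

text \<open>For f = g - g'' and p = g + g'' the equation of the kernel gives f'' = f and p'' = p - 2
  f. So p'' \<le> p as soon as f \<ge> 0, and the minimum principle on [w, L] applies to f first and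
  to p afterwards. At the end L the natural condition gives f = theta g and p = (2 - theta)
  g.\<close>

lemma kern_bounds_right:
  assumes "0 < L" "0 < \<theta>" "\<theta> \<le> 1" "- L \<le> w" "w \<le> y" "y \<le> L"
  shows "\<bar>kern2 \<theta> L 1 w y\<bar> \<le> kern0 \<theta> L 1 w y"
proof -
  have wL: "\<bar>w\<bar> \<le> L" using assms by auto
  define f where "f = (\<lambda>e y. kern0 \<theta> L e w y - kern2 \<theta> L e w y)"
  define f1 where "f1 = (\<lambda>e y. kern1 \<theta> L e w y - kern3 \<theta> L e w y)"
  define p where "p = (\<lambda>y. kern0 \<theta> L 1 w y + kern2 \<theta> L 1 w y)"
  define p1 where "p1 = (\<lambda>y. kern1 \<theta> L 1 w y + kern3 \<theta> L 1 w y)"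
  have df: "(f e has_real_derivative f1 e y) (at y)" "(f1 e has_real_derivative f e y) (at y)" for e y
    unfolding f_def f1_def by (auto intro!: derivative_eq_intros kern_deriv)
  have dp: "(p has_real_derivative p1 y) (at y)" "(p1 has_real_derivative p y - 2 * f 1 y) (at y)" for y
    unfolding p_def p1_def f_def by (auto intro!: derivative_eq_intros kern_deriv)
  have top: "kern0 \<theta> L 1 w L > 0" by (rule kern_top_pos) (use assms wL in auto)
  have bot: "kern0 \<theta> L (-1) w (-L) > 0"
    using kern_top_pos[of L \<theta> "- w"] kern_minus(1)[of \<theta> L "-1" w "-L"] assms wL by simp
  have fL: "f 1 L > 0" "f (-1) (-L) > 0"
    using top bot assms(2) unfolding f_def kern_bc_top[OF assms(1-3)] kern_bc_bot[OF assms(1-3)]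
    by (simp_all add: algebra_simps)
  \<comment> \<open>The sign at the pole comes from the kink: f' drops by 1 there, because g'''
    rises by 1. If f were negative at w, its positivity at both ends would force f' > 0 to the right
    of w and f' < 0 to the left, which is a rise.\<close>
  have fw: "0 \<le> f 1 w"
  proof (rule ccontr)
    assume "\<not> 0 \<le> f 1 w"
    then have neg: "f 1 w < 0" by simp
    have expl: "f e y = f 1 w * cosh (y - w) + f1 e w * sinh (y - w)" for e y
    proof -
      have "cosh y = cosh w * cosh (y - w) + sinh w * sinh (y - w)"
        "sinh y = sinh w * cosh (y - w) + cosh w * sinh (y - w)"
        using cosh_add[of w "y - w"] sinh_add[of w "y - w"] by simp_all
      then show ?thesis
        unfolding f_def f1_def kern0_def kern1_def kern2_def kern3_def by (simp add: field_simps)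
    qed
    have "0 < f1 1 w"
    proof (rule ccontr)
      assume "\<not> 0 < f1 1 w"
      then have "f 1 w * cosh (L - w) < 0" "f1 1 w * sinh (L - w) \<le> 0"
        using neg assms by (auto intro!: mult_neg_pos mult_nonpos_nonneg)
      then show False using expl[of 1 L] fL by linarith
    qed
    moreover have "f1 (-1) w < 0"
    proof (rule ccontr)
      assume "\<not> f1 (-1) w < 0"
      then have "f 1 w * cosh (- L - w) < 0" "f1 (-1) w * sinh (- L - w) \<le> 0"
        using neg assms by (auto intro!: mult_neg_pos mult_nonneg_nonpos)
      then show False using expl[of "-1" "- L"] fL by linarith
    qed
    moreover have "f1 1 w - f1 (-1) w = -1"
      unfolding f1_def kern1_def kern3_def by simp
    ultimately show False by linarith
  qed
  have f: "0 \<le> f 1 y" if "w \<le> y" "y \<le> L" for y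
    by (rule minimum_principle[where v = "f 1" and ?v1.0 = "f1 1" and ?v2.0 = "f 1" and a = w and b = L])
      (use df fw fL that in auto)
  have "0 \<le> p y"
  proof (rule minimum_principle[where v = p and ?v1.0 = p1 and ?v2.0 = "\<lambda>y. p y - 2 * f 1 y" and a = w and b = L])
    show "0 \<le> p w" unfolding p_def using kern_diag_pos[OF assms(1-3) wL, of 1] by simp
    show "0 \<le> p L" unfolding p_def kern_bc_top[OF assms(1-3)] using top assms(3) by simp
  qed (use dp f assms in auto)
  then show ?thesis using f[OF assms(5,6)] unfolding p_def f_def by linarith
qed

lemma kern_bounds_left:
  assumes "0 < L" "0 < \<theta>" "\<theta> \<le> 1" "- L \<le> y" "y \<le> w" "w \<le> L"
  shows "\<bar>kern2 \<theta> L (-1) w y\<bar> \<le> kern0 \<theta> L (-1) w y"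
  using kern_bounds_right[of L \<theta> "- w" "- y"] kern_minus[of \<theta> L "-1" w y] assms by simp

section \<open>The kernel of wave number m: scaling and reproducing property\<close>

lemma has_real_derivative_glue:
  fixes f g :: "real \<Rightarrow> real"
  assumes f: "\<And>y. (f has_real_derivative f' y) (at y)" and g: "\<And>y. (g has_real_derivative g' y) (at y)"
    and "f w = g w" "f' w = g' w"
  shows "((\<lambda>y. if w \<le> y then f y else g y) has_real_derivative (if w \<le> y then f' y else g' y)) (at y)"
proof -
  let ?h = "\<lambda>y. if w \<le> y then f y else g y"
  consider "w < y" | "y < w" | "y = w" by linarith
  then show ?thesis
  proof cases
    case 1
    have "(?h has_real_derivative f' y) (at y)"
      by (rule has_field_derivative_transform_within_open[OF f, where S = "{w<..}"]) (use 1 in auto)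
    then show ?thesis using 1 by simp
  next
    case 2
    have "(?h has_real_derivative g' y) (at y)"
      by (rule has_field_derivative_transform_within_open[OF g, where S = "{..<w}"]) (use 2 in auto)
    then show ?thesis using 2 by simp
  next
    case 3
    have "(?h has_real_derivative f' w) (at w within {w..})"
      by (rule has_field_derivative_transform_within[OF has_field_derivative_at_within[OF f], where d = 1]) auto
    moreover have "(?h has_real_derivative g' w) (at w within {..w})"
      by (rule has_field_derivative_transform_within[OF has_field_derivative_at_within[OF g], where d = 1])
        (use assms in auto)
    ultimately have "(?h has_real_derivative f' w) (at w within {w..} \<union> {..w})"
      unfolding assms(4) has_field_derivative_iff by (subst at_within_union) (intro filterlim_sup)
    moreover have "{w..} \<union> {..w} = (UNIV :: real set)" by auto
    ultimately show ?thesis using 3 by simp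
  qed
qed

text \<open>Scaling by m multiplies a fourth derivative by m^4 and a unit point mass by m; the
  factor m^-3 therefore keeps the jump of the third derivative at the pole equal to 1.\<close>

definition green0 :: "real \<Rightarrow> real \<Rightarrow> real \<Rightarrow> real \<Rightarrow> real \<Rightarrow> real"
  where "green0 \<theta> l m w y = kern0 \<theta> (m * l) (if w \<le> y then 1 else -1) (m * w) (m * y) / m ^ 3"

definition green1 :: "real \<Rightarrow> real \<Rightarrow> real \<Rightarrow> real \<Rightarrow> real \<Rightarrow> real"
  where "green1 \<theta> l m w y = kern1 \<theta> (m * l) (if w \<le> y then 1 else -1) (m * w) (m * y) / m\<^sup>2"

definition green2 :: "real \<Rightarrow> real \<Rightarrow> real \<Rightarrow> real \<Rightarrow> real \<Rightarrow> real"
  where "green2 \<theta> l m w y = kern2 \<theta> (m * l) (if w \<le> y then 1 else -1) (m * w) (m * y) / m"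

lemma kern_scaled_deriv:
  assumes "m \<noteq> 0"
  shows "((\<lambda>y. kern0 \<theta> L e (m * w) (m * y) / m ^ 3) has_real_derivative kern1 \<theta> L e (m * w) (m * y) / m\<^sup>2) (at y)"
    and "((\<lambda>y. kern1 \<theta> L e (m * w) (m * y) / m\<^sup>2) has_real_derivative kern2 \<theta> L e (m * w) (m * y) / m) (at y)"
    and "((\<lambda>y. kern2 \<theta> L e (m * w) (m * y) / m) has_real_derivative kern3 \<theta> L e (m * w) (m * y)) (at y)"
    and "((\<lambda>y. kern3 \<theta> L e (m * w) (m * y)) has_real_derivative
      m * (2 * kern2 \<theta> L e (m * w) (m * y) - kern0 \<theta> L e (m * w) (m * y))) (at y)"
proof -
  have c: "((\<lambda>y. G (m * y)) has_real_derivative G' (m * y) * m) (at y)"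
    if "\<And>z. (G has_real_derivative G' z) (at z)" for G G' :: "real \<Rightarrow> real"
    by (rule DERIV_chain2[OF that]) (auto intro!: derivative_eq_intros)
  have c0: "((\<lambda>y. kern0 \<theta> L e (m * w) (m * y)) has_real_derivative kern1 \<theta> L e (m * w) (m * y) * m) (at y)"
    by (rule c) (rule kern_deriv)
  have c1: "((\<lambda>y. kern1 \<theta> L e (m * w) (m * y)) has_real_derivative kern2 \<theta> L e (m * w) (m * y) * m) (at y)"
    by (rule c) (rule kern_deriv)
  have c2: "((\<lambda>y. kern2 \<theta> L e (m * w) (m * y)) has_real_derivative kern3 \<theta> L e (m * w) (m * y) * m) (at y)"
    by (rule c) (rule kern_deriv)
  have c3: "((\<lambda>y. kern3 \<theta> L e (m * w) (m * y)) has_real_derivative (2 * kern2 \<theta> L e (m * w) (m * y) - kern0 \<theta> L e (m * w) (m * y)) * m) (at y)"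
    by (rule c) (rule kern_deriv)
  show "((\<lambda>y. kern0 \<theta> L e (m * w) (m * y) / m ^ 3) has_real_derivative kern1 \<theta> L e (m * w) (m * y) / m\<^sup>2) (at y)"
    using DERIV_cdivide[OF c0, of "m ^ 3"] assms by (simp add: power2_eq_square power3_eq_cube)
  show "((\<lambda>y. kern1 \<theta> L e (m * w) (m * y) / m\<^sup>2) has_real_derivative kern2 \<theta> L e (m * w) (m * y) / m) (at y)"
    using DERIV_cdivide[OF c1, of "m\<^sup>2"] assms by (simp add: power2_eq_square)
  show "((\<lambda>y. kern2 \<theta> L e (m * w) (m * y) / m) has_real_derivative kern3 \<theta> L e (m * w) (m * y)) (at y)"
    using DERIV_cdivide[OF c2, of m] assms by simp
  show "((\<lambda>y. kern3 \<theta> L e (m * w) (m * y)) has_real_derivative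
      m * (2 * kern2 \<theta> L e (m * w) (m * y) - kern0 \<theta> L e (m * w) (m * y))) (at y)"
    using c3 by (simp add: mult.commute)
qed

text \<open>The terms carrying the side \<open>e\<close> vanish at y = w in \<open>kern0\<close>,
  \<open>kern1\<close> and \<open>kern2\<close>, so the two branches fit together up to the second
  derivative; only the third one jumps.\<close>

lemma green_deriv:
  assumes "m \<noteq> 0"
  shows "(green0 \<theta> l m w has_real_derivative green1 \<theta> l m w y) (at y)"
    and "(green1 \<theta> l m w has_real_derivative green2 \<theta> l m w y) (at y)"
proof -
  let ?L = "m * l"
  have eq: "kern0 \<theta> ?L 1 (m * w) (m * w) = kern0 \<theta> ?L (-1) (m * w) (m * w)"
    "kern1 \<theta> ?L 1 (m * w) (m * w) = kern1 \<theta> ?L (-1) (m * w) (m * w)"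
    "kern2 \<theta> ?L 1 (m * w) (m * w) = kern2 \<theta> ?L (-1) (m * w) (m * w)"
    by (simp_all add: kern0_def kern1_def kern2_def)
  have i: "green0 \<theta> l m w = (\<lambda>y. if w \<le> y then kern0 \<theta> ?L 1 (m * w) (m * y) / m ^ 3 else kern0 \<theta> ?L (-1) (m * w) (m * y) / m ^ 3)"
    "green1 \<theta> l m w = (\<lambda>y. if w \<le> y then kern1 \<theta> ?L 1 (m * w) (m * y) / m\<^sup>2 else kern1 \<theta> ?L (-1) (m * w) (m * y) / m\<^sup>2)"
    "green2 \<theta> l m w = (\<lambda>y. if w \<le> y then kern2 \<theta> ?L 1 (m * w) (m * y) / m else kern2 \<theta> ?L (-1) (m * w) (m * y) / m)"
    by (auto simp: green0_def green1_def green2_def)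
  show "(green0 \<theta> l m w has_real_derivative green1 \<theta> l m w y) (at y)"
    unfolding i by (rule has_real_derivative_glue[OF kern_scaled_deriv(1) kern_scaled_deriv(1)]) (use assms eq in auto)
  show "(green1 \<theta> l m w has_real_derivative green2 \<theta> l m w y) (at y)"
    unfolding i by (rule has_real_derivative_glue[OF kern_scaled_deriv(2) kern_scaled_deriv(2)]) (use assms eq in auto)
qed

lemma green_sym: "green0 \<theta> l m y w = green0 \<theta> l m w y"
proof -
  consider "w < y" | "y < w" | "y = w" by linarith
  then show ?thesis
  proof cases
    case 1
    then show ?thesis by (simp add: green0_def kern_sym[of \<theta> "m * l" 1])
  next
    case 2
    then show ?thesis by (simp add: green0_def kern_sym[of \<theta> "m * l" "-1", simplified])
  qed simp
qed

lemma green2_bound: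
  assumes "0 < l" "0 < \<theta>" "\<theta> \<le> 1" "0 < m" "w \<in> {-l..l}" "y \<in> {-l..l}"
  shows "\<bar>green2 \<theta> l m w y\<bar> \<le> m\<^sup>2 * green0 \<theta> l m w y"
proof -
  let ?e = "if w \<le> y then 1 else -1"
  have "\<bar>kern2 \<theta> (m * l) ?e (m * w) (m * y)\<bar> \<le> kern0 \<theta> (m * l) ?e (m * w) (m * y)"
  proof (cases "w \<le> y")
    case True
    then show ?thesis
      using kern_bounds_right[of "m * l" \<theta> "m * w" "m * y"] assms mult_left_mono[of "-l" w m]
      by (simp add: mult_left_mono)
  next
    case False
    then show ?thesis
      using kern_bounds_left[of "m * l" \<theta> "m * y" "m * w"] assms mult_left_mono[of "-l" y m]
      by (simp add: mult_left_mono)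
  qed
  then have "\<bar>kern2 \<theta> (m * l) ?e (m * w) (m * y)\<bar> / m \<le> kern0 \<theta> (m * l) ?e (m * w) (m * y) / m"
    using assms by (intro divide_right_mono) auto
  then show ?thesis
    using assms by (simp add: green2_def green0_def power2_eq_square power3_eq_cube abs_divide)
qed

lemma green0_nonneg:
  assumes "0 < l" "0 < \<theta>" "\<theta> \<le> 1" "0 < m" "w \<in> {-l..l}" "y \<in> {-l..l}"
  shows "0 \<le> green0 \<theta> l m w y"
proof -
  have "0 \<le> m\<^sup>2 * green0 \<theta> l m w y"
    using green2_bound[OF assms] by linarith
  then show ?thesis using assms(4) by (simp add: zero_le_mult_iff)
qed

lemma green_at_top:
  assumes "0 < l" "0 < \<theta>" "\<theta> \<le> 1" "0 < m" "w \<in> {-l..l}"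
  shows "0 < green0 \<theta> l m w l" and "green2 \<theta> l m w l = (1 - \<theta>) * m\<^sup>2 * green0 \<theta> l m w l"
proof -
  have "\<bar>m * w\<bar> \<le> m * l"
    using assms by (simp add: abs_mult abs_le_iff)
  then show "0 < green0 \<theta> l m w l"
    using kern_top_pos[of "m * l" \<theta> "m * w"] assms by (simp add: green0_def)
  show "green2 \<theta> l m w l = (1 - \<theta>) * m\<^sup>2 * green0 \<theta> l m w l"
    using kern_bc_top(1)[of "m * l" \<theta> "m * w"] assms
    by (simp add: green2_def green0_def power2_eq_square power3_eq_cube)
qed

text \<open>The functions enter through the values of g, g', g'' and h, h', h'' at one point, so
  that no derivative operator has to be attached to the piecewise kernel.\<close>

definition bform :: "real \<Rightarrow> real \<Rightarrow> real \<Rightarrow> real \<Rightarrow> real \<Rightarrow> real \<Rightarrow> real \<Rightarrow> real \<Rightarrow> real"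
  where "bform \<sigma> m g g1 g2 h h1 h2 =
    g2 * h2 - \<sigma> * m\<^sup>2 * (g * h2 + g2 * h) + m ^ 4 * (g * h) + 2 * (1 - \<sigma>) * m\<^sup>2 * (g1 * h1)"

text \<open>\<open>Q\<close> is the primitive obtained by integrating by parts twice onto the
  kernel, on each side of the pole. The natural conditions of the kernel remove the terms at -l and
  l, so h is free there; at w only the third derivative is discontinuous, and its jump 1 leaves
  h(w).\<close>

lemma green_reproducing:
  fixes h h1 h2 :: "real \<Rightarrow> real"
  assumes l: "0 < l" and \<sigma>: "0 \<le> \<sigma>" "\<sigma> < 1" and m: "0 < m" and w: "w \<in> {-l..l}"
    and h: "\<And>y. (h has_real_derivative h1 y) (at y)" "\<And>y. (h1 has_real_derivative h2 y) (at y)"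
  shows "((\<lambda>y. bform \<sigma> m (green0 (1 - \<sigma>) l m w y) (green1 (1 - \<sigma>) l m w y) (green2 (1 - \<sigma>) l m w y)
      (h y) (h1 y) (h2 y)) has_integral h w) {-l..l}"
proof -
  define \<theta> where "\<theta> = 1 - \<sigma>"
  define k0 where "k0 = (\<lambda>e y. kern0 \<theta> (m * l) e (m * w) (m * y) / m ^ 3)"
  define k1 where "k1 = (\<lambda>e y. kern1 \<theta> (m * l) e (m * w) (m * y) / m\<^sup>2)"
  define k2 where "k2 = (\<lambda>e y. kern2 \<theta> (m * l) e (m * w) (m * y) / m)"
  define k3 where "k3 = (\<lambda>e y. kern3 \<theta> (m * l) e (m * w) (m * y))"
  have dk: "(k0 e has_real_derivative k1 e y) (at y)" "(k1 e has_real_derivative k2 e y) (at y)"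
    "(k2 e has_real_derivative k3 e y) (at y)"
    "(k3 e has_real_derivative 2 * m\<^sup>2 * k2 e y - m ^ 4 * k0 e y) (at y)" for e y
  proof -
    have "m * (2 * kern2 \<theta> (m * l) e (m * w) (m * y) - kern0 \<theta> (m * l) e (m * w) (m * y))
      = 2 * m\<^sup>2 * k2 e y - m ^ 4 * k0 e y"
      using m by (simp add: k2_def k0_def power2_eq_square power3_eq_cube power4_eq_xxxx field_simps)
    with kern_scaled_deriv(4)[of m \<theta> "m * l" e w y]
    show "(k3 e has_real_derivative 2 * m\<^sup>2 * k2 e y - m ^ 4 * k0 e y) (at y)"
      using m unfolding k3_def by simp
  qed (unfold k0_def k1_def k2_def k3_def, use kern_scaled_deriv[of m] m in auto)
  define Q where "Q = (\<lambda>e y. (k2 e y - \<sigma> * m\<^sup>2 * k0 e y) * h1 y + (- k3 e y + (2 - \<sigma>) * m\<^sup>2 * k1 e y) * h y)"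
  define F where "F = (\<lambda>e y. bform \<sigma> m (k0 e y) (k1 e y) (k2 e y) (h y) (h1 y) (h2 y))"
  have dQ: "(Q e has_real_derivative F e y) (at y)" for e y
    unfolding Q_def F_def bform_def
    by (rule derivative_eq_intros dk h refl)+ (simp add: algebra_simps)
  have int: "(F e has_integral (Q e b - Q e a)) {a..b}" if "a \<le> b" for e a b
    by (rule fundamental_theorem_of_calculus[OF that])
      (use dQ in \<open>auto simp flip: has_real_derivative_iff_has_vector_derivative intro: has_field_derivative_at_within\<close>)
  have ml: "0 < m * l" "0 < \<theta>" "\<theta> \<le> 1" using assms by (auto simp: \<theta>_def)
  note bc = kern_bc_top[OF ml, of "m * w"] kern_bc_bot[OF ml, of "m * w"]
  have top: "Q 1 l = 0"
  proof -
    have "k2 1 l = \<sigma> * m\<^sup>2 * k0 1 l" "k3 1 l = (2 - \<sigma>) * m\<^sup>2 * k1 1 l"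
      using bc m by (simp_all add: k0_def k1_def k2_def k3_def \<theta>_def power2_eq_square power3_eq_cube)
    then show ?thesis by (simp add: Q_def)
  qed
  have bot: "Q (-1) (-l) = 0"
  proof -
    have "k2 (-1) (-l) = \<sigma> * m\<^sup>2 * k0 (-1) (-l)" "k3 (-1) (-l) = (2 - \<sigma>) * m\<^sup>2 * k1 (-1) (-l)"
      using bc m by (simp_all add: k0_def k1_def k2_def k3_def \<theta>_def power2_eq_square power3_eq_cube)
    then show ?thesis by (simp add: Q_def)
  qed
  have jump: "Q (-1) w - Q 1 w = h w"
    unfolding Q_def k0_def k1_def k2_def k3_def kern0_def kern1_def kern2_def kern3_def by (simp add: algebra_simps)
  define T where "T = (\<lambda>y. bform \<sigma> m (green0 \<theta> l m w y) (green1 \<theta> l m w y) (green2 \<theta> l m w y)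
      (h y) (h1 y) (h2 y))"
  \<comment> \<open>At y = w itself the kernel is given by the branch e = 1, so this point is
    discarded on the left half.\<close>
  have "(T has_integral (Q (-1) w - Q (-1) (-l))) {-l..w}"
  proof (rule has_integral_spike_finite[OF _ _ int])
    show "finite {w}" by simp
    show "T y = F (-1) y" if "y \<in> {-l..w} - {w}" for y
      using that unfolding T_def F_def k0_def k1_def k2_def green0_def green1_def green2_def by auto
  qed (use w in auto)
  moreover have "(T has_integral (Q 1 l - Q 1 w)) {w..l}"
  proof (rule has_integral_eq[OF _ int])
    show "F 1 y = T y" if "y \<in> {w..l}" for y
      using that unfolding T_def F_def k0_def k1_def k2_def green0_def green1_def green2_def by auto
  qed (use w in auto)
  ultimately have "(T has_integral (Q (-1) w - Q (-1) (-l) + (Q 1 l - Q 1 w))) {-l..l}"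
    using w by (intro has_integral_combine) auto
  then show ?thesis
    using top bot jump unfolding T_def \<theta>_def by simp
qed

text \<open>The same form integrated by parts the other way, onto h. Now the natural conditions of h
  remove the boundary terms; comparing with \<open>green_reproducing\<close> shows that the kernel
  inverts D^4 - 2 m^2 D^2 + m^4 under these conditions.\<close>

lemma green_inverts_operator:
  fixes h :: "nat \<Rightarrow> real \<Rightarrow> real"
  assumes l: "0 < l" and \<sigma>: "0 \<le> \<sigma>" "\<sigma> < 1" and m: "0 < m" and w: "w \<in> {-l..l}"
    and h: "\<And>i y. i < 4 \<Longrightarrow> (h i has_real_derivative h (Suc i) y) (at y)"
    and bc: "\<And>y. y = l \<or> y = -l \<Longrightarrow> h 2 y = \<sigma> * m\<^sup>2 * h 0 y"
      "\<And>y. y = l \<or> y = -l \<Longrightarrow> h 3 y = (2 - \<sigma>) * m\<^sup>2 * h 1 y"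
  shows "((\<lambda>y. green0 (1 - \<sigma>) l m w y * (h 4 y - 2 * m\<^sup>2 * h 2 y + m ^ 4 * h 0 y)) has_integral h 0 w) {-l..l}"
proof -
  define k0 k1 k2 where k: "k0 = green0 (1 - \<sigma>) l m w" "k1 = green1 (1 - \<sigma>) l m w" "k2 = green2 (1 - \<sigma>) l m w"
  have dk: "(k0 has_real_derivative k1 y) (at y)" "(k1 has_real_derivative k2 y) (at y)" for y
    unfolding k using green_deriv m by auto
  have dh: "(h 0 has_real_derivative h 1 y) (at y)" "(h 1 has_real_derivative h 2 y) (at y)"
    "(h 2 has_real_derivative h 3 y) (at y)" "(h 3 has_real_derivative h 4 y) (at y)" for y
    using h[of 0] h[of 1] h[of 2] h[of 3] by (auto simp: eval_nat_numeral)
  define Q where "Q = (\<lambda>y. (h 2 y - \<sigma> * m\<^sup>2 * h 0 y) * k1 y + (- h 3 y + (2 - \<sigma>) * m\<^sup>2 * h 1 y) * k0 y)"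
  define F where "F = (\<lambda>y. bform \<sigma> m (k0 y) (k1 y) (k2 y) (h 0 y) (h 1 y) (h 2 y))"
  have dQ: "(Q has_real_derivative F y - k0 y * (h 4 y - 2 * m\<^sup>2 * h 2 y + m ^ 4 * h 0 y)) (at y)" for y
    unfolding Q_def F_def bform_def
    by (rule derivative_eq_intros dk dh refl)+ (simp add: algebra_simps)
  have "((\<lambda>y. F y - k0 y * (h 4 y - 2 * m\<^sup>2 * h 2 y + m ^ 4 * h 0 y)) has_integral (Q l - Q (-l))) {-l..l}"
    by (rule fundamental_theorem_of_calculus)
      (use dQ l in \<open>auto simp flip: has_real_derivative_iff_has_vector_derivative intro: has_field_derivative_at_within\<close>)
  from has_integral_diff[OF green_reproducing[OF l \<sigma> m w dh(1,2), folded k, folded F_def] this]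
  have "((\<lambda>y. k0 y * (h 4 y - 2 * m\<^sup>2 * h 2 y + m ^ 4 * h 0 y)) has_integral (h 0 w - (Q l - Q (-l)))) {-l..l}"
    by simp
  moreover have "Q l = 0" "Q (-l) = 0" using bc by (simp_all add: Q_def)
  ultimately show ?thesis unfolding k by simp
qed

text \<open>In terms of |y - w| the two branches are one formula, from which joint continuity in the
  pole and the variable is immediate.\<close>

lemma green0_alt:
  "green0 \<theta> l m w y = ((\<bar>m * y - m * w\<bar> * cosh \<bar>m * y - m * w\<bar> - sinh \<bar>m * y - m * w\<bar>) / 4
    + cf_cosh \<theta> (m * l) (m * w) * cosh (m * y) + cf_ysinh \<theta> (m * l) (m * w) * (m * y * sinh (m * y))
    + cf_sinh \<theta> (m * l) (m * w) * sinh (m * y) + cf_ycosh \<theta> (m * l) (m * w) * (m * y * cosh (m * y))) / m ^ 3"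
  if "0 < m"
proof (cases "w \<le> y")
  case True
  then have "\<bar>m * y - m * w\<bar> = m * y - m * w" using that by (simp add: mult_left_mono)
  then show ?thesis using True by (simp add: green0_def kern0_def)
next
  case False
  then have e: "\<bar>m * y - m * w\<bar> = - (m * y - m * w)" using that by (simp add: mult_left_mono)
  show ?thesis unfolding e cosh_minus sinh_minus using False by (simp add: green0_def kern0_def algebra_simps)
qed

lemma green2_alt:
  "green2 \<theta> l m w y = ((sinh \<bar>m * y - m * w\<bar> + \<bar>m * y - m * w\<bar> * cosh \<bar>m * y - m * w\<bar>) / 4
    + cf_cosh \<theta> (m * l) (m * w) * cosh (m * y) + cf_ysinh \<theta> (m * l) (m * w) * (2 * cosh (m * y) + m * y * sinh (m * y))
    + cf_sinh \<theta> (m * l) (m * w) * sinh (m * y) + cf_ycosh \<theta> (m * l) (m * w) * (2 * sinh (m * y) + m * y * cosh (m * y))) / m"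
  if "0 < m"
proof (cases "w \<le> y")
  case True
  then have "\<bar>m * y - m * w\<bar> = m * y - m * w" using that by (simp add: mult_left_mono)
  then show ?thesis using True by (simp add: green2_def kern2_def)
next
  case False
  then have e: "\<bar>m * y - m * w\<bar> = - (m * y - m * w)" using that by (simp add: mult_left_mono)
  show ?thesis unfolding e cosh_minus sinh_minus using False by (simp add: green2_def kern2_def algebra_simps)
qed

lemma continuous_on_cf:
  assumes "0 < L" "0 < \<theta>" "\<theta> \<le> 1" "continuous_on S f"
  shows "continuous_on S (\<lambda>x. cf_cosh \<theta> L (f x))" "continuous_on S (\<lambda>x. cf_ysinh \<theta> L (f x))"
    "continuous_on S (\<lambda>x. cf_sinh \<theta> L (f x))" "continuous_on S (\<lambda>x. cf_ycosh \<theta> L (f x))"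
  using det_even_pos[OF assms(1-3)] det_odd_pos[OF assms(1-3)]
  unfolding cf_cosh_def cf_ysinh_def cf_sinh_def cf_ycosh_def
  by (auto intro!: continuous_intros assms(4))

lemma continuous_on_green0:
  assumes "0 < l" "0 < \<theta>" "\<theta> \<le> 1" "0 < m" "continuous_on S f" "continuous_on S g"
  shows "continuous_on S (\<lambda>x. green0 \<theta> l m (f x) (g x))"
  unfolding green0_alt[OF assms(4)]
  by (intro continuous_intros continuous_on_cf assms mult_pos_pos) (use assms in auto)

lemma continuous_on_green2:
  assumes "0 < l" "0 < \<theta>" "\<theta> \<le> 1" "0 < m"
  shows "continuous_on S (green2 \<theta> l m w)"
proof -
  have "continuous_on S (\<lambda>y. green2 \<theta> l m w y)"
    unfolding green2_alt[OF assms(4)] by (intro continuous_intros) (use assms in auto)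
  then show ?thesis .
qed

section \<open>Size of the kernel and monotonicity in the wave number\<close>

lemma green_energy_bound:
  assumes l: "0 < l" and \<sigma>: "0 \<le> \<sigma>" "\<sigma> < 1" and m: "0 < m" and w: "w \<in> {-l..l}"
  shows "integral {-l..l} (\<lambda>y. m ^ 4 * (green0 (1 - \<sigma>) l m w y)\<^sup>2 + m\<^sup>2 * (green1 (1 - \<sigma>) l m w y)\<^sup>2)
    \<le> green0 (1 - \<sigma>) l m w w / (1 - \<sigma>)"
proof -
  define g0 g1 g2 where g: "g0 = green0 (1 - \<sigma>) l m w" "g1 = green1 (1 - \<sigma>) l m w" "g2 = green2 (1 - \<sigma>) l m w"
  have dg: "(g0 has_real_derivative g1 y) (at y)" "(g1 has_real_derivative g2 y) (at y)" for y
    unfolding g using green_deriv m by auto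
  have int: "((\<lambda>y. bform \<sigma> m (g0 y) (g1 y) (g2 y) (g0 y) (g1 y) (g2 y)) has_integral g0 w) {-l..l}"
    unfolding g by (rule green_reproducing[OF l \<sigma> m w]) (use dg g in auto)
  have cont: "continuous_on {-l..l} g0" "continuous_on {-l..l} g1"
    by (rule DERIV_continuous_on, rule has_field_derivative_at_within, rule dg)+
  have "(\<lambda>y. (1 - \<sigma>) * (m ^ 4 * (g0 y)\<^sup>2 + m\<^sup>2 * (g1 y)\<^sup>2)) integrable_on {-l..l}"
    by (intro integrable_continuous_interval continuous_intros cont)
  then have "integral {-l..l} (\<lambda>y. (1 - \<sigma>) * (m ^ 4 * (g0 y)\<^sup>2 + m\<^sup>2 * (g1 y)\<^sup>2))
    \<le> g0 w"
  proof (rule integral_le[OF _ has_integral_integrable[OF int], unfolded integral_unique[OF int]])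
    fix y
    \<comment> \<open>Coercivity by completing the square: the mixed term -2 sigma m^2 g g'' uses up
      only the share sigma of g''^2 and of m^4 g^2.\<close>
    have "bform \<sigma> m (g0 y) (g1 y) (g2 y) (g0 y) (g1 y) (g2 y) - (1 - \<sigma>) * (m ^ 4 * (g0 y)\<^sup>2 + m\<^sup>2 * (g1 y)\<^sup>2)
      = \<sigma> * (g2 y - m\<^sup>2 * g0 y)\<^sup>2 + (1 - \<sigma>) * (g2 y)\<^sup>2 + (1 - \<sigma>) * (m * g1 y)\<^sup>2"
      unfolding bform_def by (simp add: algebra_simps power2_eq_square power4_eq_xxxx)
    moreover have "0 \<le> \<sigma> * (g2 y - m\<^sup>2 * g0 y)\<^sup>2 + (1 - \<sigma>) * (g2 y)\<^sup>2 + (1 - \<sigma>) * (m * g1 y)\<^sup>2"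
      using \<sigma> by (intro add_nonneg_nonneg mult_nonneg_nonneg) auto
    ultimately show "(1 - \<sigma>) * (m ^ 4 * (g0 y)\<^sup>2 + m\<^sup>2 * (g1 y)\<^sup>2)
      \<le> bform \<sigma> m (g0 y) (g1 y) (g2 y) (g0 y) (g1 y) (g2 y)" by linarith
  qed
  then have "(1 - \<sigma>) * integral {-l..l} (\<lambda>y. m ^ 4 * (g0 y)\<^sup>2 + m\<^sup>2 * (g1 y)\<^sup>2) \<le> g0 w"
    by (simp only: integral_mult_right)
  then show ?thesis unfolding g using \<sigma> by (simp add: pos_le_divide_eq mult.commute)
qed

text \<open>A one-dimensional Sobolev inequality, applied to the energy of the Green function.\<close>

lemma green0_bound:
  assumes l: "0 < l" and \<sigma>: "0 \<le> \<sigma>" "\<sigma> < 1" and m: "1 \<le> m" and w: "w \<in> {-l..l}" and y: "y \<in> {-l..l}"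
  shows "green0 (1 - \<sigma>) l m w y \<le> (1 / (2 * l) + 1) / (1 - \<sigma>) / m ^ 3"
proof -
  define g0 g1 where g: "g0 = green0 (1 - \<sigma>) l m w" "g1 = green1 (1 - \<sigma>) l m w"
  have m0: "0 < m" using m by simp
  have dg: "(g0 has_real_derivative g1 y) (at y)" for y
    unfolding g using green_deriv m by auto
  have cont: "continuous_on S g0" "continuous_on S g1" for S
    unfolding g by (rule DERIV_continuous_on, rule has_field_derivative_at_within, rule green_deriv, use m in simp)+
  define e where "e = (\<lambda>y. m ^ 4 * (g0 y)\<^sup>2 + m\<^sup>2 * (g1 y)\<^sup>2)"
  have ei: "e integrable_on {a..b}" for a b
    unfolding e_def by (intro integrable_continuous_interval continuous_intros cont)
  have e0: "0 \<le> e y" for y unfolding e_def by simp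
  define J where "J = integral {-l..l} e"
  have J: "J \<le> g0 w / (1 - \<sigma>)"
    unfolding J_def e_def g by (rule green_energy_bound[OF l \<sigma> m0 w])
  have J0: "0 \<le> J" unfolding J_def by (rule integral_nonneg[OF ei e0])
  have step: "(g0 b)\<^sup>2 - (g0 a)\<^sup>2 \<le> J / m ^ 3" "(g0 a)\<^sup>2 - (g0 b)\<^sup>2 \<le> J / m ^ 3"
    if "a \<le> b" "a \<in> {-l..l}" "b \<in> {-l..l}" for a b
  proof -
    have i: "((\<lambda>y. 2 * g0 y * g1 y) has_integral ((g0 b)\<^sup>2 - (g0 a)\<^sup>2)) {a..b}"
    proof (rule fundamental_theorem_of_calculus[OF that(1)])
      fix x
      have "((\<lambda>y. (g0 y)\<^sup>2) has_real_derivative 2 * g0 x * g1 x) (at x within {a..b})"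
        by (rule derivative_eq_intros has_field_derivative_at_within[OF dg] refl)+ simp
      then show "((\<lambda>y. (g0 y)\<^sup>2) has_vector_derivative 2 * g0 x * g1 x) (at x within {a..b})"
        by (simp add: has_real_derivative_iff_has_vector_derivative)
    qed
    have "\<bar>2 * g0 y * g1 y\<bar> \<le> e y / m ^ 3" for y
    proof -
      have "0 \<le> (m\<^sup>2 * \<bar>g0 y\<bar> - m * \<bar>g1 y\<bar>)\<^sup>2" by simp
      also have "\<dots> = e y - m ^ 3 * \<bar>2 * g0 y * g1 y\<bar>"
        unfolding e_def by (simp add: power2_diff power_mult_distrib abs_mult flip: power_mult)
          (simp add: power2_eq_square power3_eq_cube)
      finally show ?thesis using m0 by (simp add: field_simps)
    qed
    then have "norm (integral {a..b} (\<lambda>y. 2 * g0 y * g1 y)) \<le> integral {a..b} (\<lambda>y. e y / m ^ 3)"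
      by (intro integral_norm_bound_integral integrable_on_divide ei has_integral_integrable[OF i]) auto
    also have "\<dots> = integral {a..b} e / m ^ 3" by simp
    also have "\<dots> \<le> J / m ^ 3"
      unfolding J_def using that m0 e0 by (intro divide_right_mono integral_subset_le ei) auto
    finally show "(g0 b)\<^sup>2 - (g0 a)\<^sup>2 \<le> J / m ^ 3" "(g0 a)\<^sup>2 - (g0 b)\<^sup>2 \<le> J / m ^ 3"
      unfolding integral_unique[OF i] by auto
  qed
  \<comment> \<open>The term 1 / (2 l) comes from averaging over an interval of length 2 l, the term
    1 from the oscillation of g^2 on it, and 1 / (1 - sigma) from the energy bound.\<close>
  define M where "M = (1 / (2 * l) + 1) / (1 - \<sigma>) / m ^ 3"
  have M0: "0 < M" unfolding M_def using l \<sigma> m0 by (intro divide_pos_pos add_pos_pos) auto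
  have sq: "(g0 y)\<^sup>2 \<le> M * g0 w" if "y \<in> {-l..l}" for y
  proof -
    have "integral {-l..l} (\<lambda>z. (g0 y)\<^sup>2) \<le> integral {-l..l} (\<lambda>z. e z / m ^ 4 + J / m ^ 3)"
    proof (rule integral_le)
      fix z assume z: "z \<in> {-l..l}"
      have "(g0 y)\<^sup>2 - (g0 z)\<^sup>2 \<le> J / m ^ 3"
        using step[of y z] step[of z y] that z by (cases "y \<le> z") auto
      moreover have "(g0 z)\<^sup>2 \<le> e z / m ^ 4"
        unfolding e_def using m0 by (simp add: field_simps)
      ultimately show "(g0 y)\<^sup>2 \<le> e z / m ^ 4 + J / m ^ 3" by linarith
    qed (auto intro!: integrable_add integrable_on_divide ei)
    also have "\<dots> = J / m ^ 4 + 2 * l * (J / m ^ 3)"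
      unfolding J_def using l by (subst integral_add) (auto intro!: integrable_on_divide ei)
    finally have "2 * l * (g0 y)\<^sup>2 \<le> J / m ^ 4 + 2 * l * (J / m ^ 3)" using l by simp
    also have "J / m ^ 4 \<le> J / m ^ 3"
      using m J0 by (intro divide_left_mono power_increasing mult_pos_pos) auto
    finally have "2 * l * (g0 y)\<^sup>2 \<le> J / m ^ 3 + 2 * l * (J / m ^ 3)" by simp
    also have "\<dots> = 2 * l * ((1 / (2 * l) + 1) * (J / m ^ 3))"
      using l by (simp add: distrib_right distrib_left add_divide_distrib)
    finally have "(g0 y)\<^sup>2 \<le> (1 / (2 * l) + 1) * (J / m ^ 3)"
      using l by (simp only: mult_le_cancel_left_pos mult_pos_pos zero_less_numeral)
    also have "\<dots> \<le> (1 / (2 * l) + 1) * (g0 w / (1 - \<sigma>) / m ^ 3)"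
      using J l m0 by (intro mult_left_mono divide_right_mono) auto
    also have "\<dots> = M * g0 w" unfolding M_def by simp
    finally show ?thesis .
  qed
  \<comment> \<open>The energy was bounded by g(w), which is itself unknown. At y = w the inequality
    reads g(w)^2 \<le> M g(w) and closes up; inserting g(w) \<le> M then bounds all other y.\<close>
  have "g0 w \<le> M"
  proof (rule ccontr)
    assume "\<not> g0 w \<le> M"
    then have "M * g0 w < g0 w * g0 w" using M0 by simp
    then show False using sq[OF w] by (simp add: power2_eq_square)
  qed
  then have "(g0 y)\<^sup>2 \<le> M\<^sup>2"
    using order_trans[OF sq[OF y] mult_left_mono[of "g0 w" M M]] M0 by (simp add: power2_eq_square)
  then have "g0 y \<le> M" using M0 by (meson less_imp_le power2_le_imp_le)
  then show ?thesis unfolding g M_def .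
qed

text \<open>Comparing two wave numbers: apply the reproducing property of either kernel to the other one
  and subtract. All terms with \<open>\<sigma>\<close> cancel.\<close>

lemma green0_scaled_antimono:
  assumes l: "0 < l" and \<sigma>: "0 \<le> \<sigma>" "\<sigma> < 1" and m: "0 < m" "m < n" and w: "w \<in> {-l..l}" and y: "y \<in> {-l..l}"
  shows "n\<^sup>2 * green0 (1 - \<sigma>) l n w y < m\<^sup>2 * green0 (1 - \<sigma>) l m w y"
proof -
  have n: "0 < n" using m by simp
  have \<theta>: "0 < 1 - \<sigma>" "1 - \<sigma> \<le> 1" using \<sigma> by auto
  define g0 g1 g2 where g: "g0 = green0 (1 - \<sigma>) l m w" "g1 = green1 (1 - \<sigma>) l m w" "g2 = green2 (1 - \<sigma>) l m w"
  define h0 h1 h2 where h: "h0 = green0 (1 - \<sigma>) l n y" "h1 = green1 (1 - \<sigma>) l n y" "h2 = green2 (1 - \<sigma>) l n y"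
  have dg: "(g0 has_real_derivative g1 y) (at y)" "(g1 has_real_derivative g2 y) (at y)" for y
    unfolding g using green_deriv m by auto
  have dh: "(h0 has_real_derivative h1 y) (at y)" "(h1 has_real_derivative h2 y) (at y)" for y
    unfolding h using green_deriv n by auto
  have i1: "((\<lambda>z. bform \<sigma> m (g0 z) (g1 z) (g2 z) (h0 z) (h1 z) (h2 z)) has_integral h0 w) {-l..l}"
    unfolding g by (rule green_reproducing[OF l \<sigma> m(1) w]) (use dh in auto)
  have i2: "((\<lambda>z. bform \<sigma> n (h0 z) (h1 z) (h2 z) (g0 z) (g1 z) (g2 z)) has_integral g0 y) {-l..l}"
    unfolding h by (rule green_reproducing[OF l \<sigma> n y]) (use dg in auto)
  define F where "F = (\<lambda>z. (n\<^sup>2 - m\<^sup>2) * (m\<^sup>2 * g0 z * (n\<^sup>2 * h0 z) - g2 z * h2 z))"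
  have "m\<^sup>2 * bform \<sigma> n (h0 z) (h1 z) (h2 z) (g0 z) (g1 z) (g2 z)
      - n\<^sup>2 * bform \<sigma> m (g0 z) (g1 z) (g2 z) (h0 z) (h1 z) (h2 z) = F z" for z
    unfolding bform_def F_def by (simp add: algebra_simps power2_eq_square power4_eq_xxxx)
  with has_integral_diff[OF has_integral_mult_right[OF i2, of "m\<^sup>2"] has_integral_mult_right[OF i1, of "n\<^sup>2"]]
  have F: "(F has_integral (m\<^sup>2 * g0 y - n\<^sup>2 * h0 w)) {-l..l}" by simp
  have nm: "0 < n\<^sup>2 - m\<^sup>2" using m by (simp add: power_strict_mono)
  have Fnn: "0 \<le> F z" if "z \<in> {-l..l}" for z
  proof -
    have "\<bar>g2 z\<bar> \<le> m\<^sup>2 * g0 z" "\<bar>h2 z\<bar> \<le> n\<^sup>2 * h0 z"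
      unfolding g h by (rule green2_bound; use l \<theta> m n w y that in auto)+
    then have "\<bar>g2 z\<bar> * \<bar>h2 z\<bar> \<le> (m\<^sup>2 * g0 z) * (n\<^sup>2 * h0 z)"
      by (intro mult_mono) (auto intro: order_trans[OF abs_ge_zero])
    then have "g2 z * h2 z \<le> (m\<^sup>2 * g0 z) * (n\<^sup>2 * h0 z)"
      by (metis abs_ge_self abs_mult order_trans)
    then show ?thesis unfolding F_def using nm by simp
  qed
  \<comment> \<open>Strictness is read off at the end l. There the natural condition makes the
    product of the second derivatives sigma^2 times the product of the functions, and sigma^2 <
    1.\<close>
  have Fl: "0 < F l"
  proof -
    have p: "0 < g0 l" "0 < h0 l" and e: "g2 l = \<sigma> * (m\<^sup>2 * g0 l)" "h2 l = \<sigma> * (n\<^sup>2 * h0 l)"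
      using green_at_top[OF l \<theta> m(1) w] green_at_top[OF l \<theta> n y] by (simp_all add: g h)
    have "F l = (n\<^sup>2 - m\<^sup>2) * ((1 - \<sigma>\<^sup>2) * (m\<^sup>2 * g0 l * (n\<^sup>2 * h0 l)))"
      unfolding F_def e by (simp add: algebra_simps power2_eq_square)
    moreover have "\<sigma>\<^sup>2 < 1" using \<sigma> by (simp add: abs_square_less_1)
    ultimately show ?thesis using p nm m n by simp
  qed
  have cF: "continuous_on {-l..l} F"
    unfolding F_def g h
    by (intro continuous_intros continuous_on_green2 continuous_on_green0 l \<theta> m n)
  have "m\<^sup>2 * g0 y - n\<^sup>2 * h0 w \<noteq> 0"
  proof
    assume "m\<^sup>2 * g0 y - n\<^sup>2 * h0 w = 0"
    then have "(F has_integral 0) (cbox (-l) l)" using F by simp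
    then have "F l = 0"
      using has_integral_0_cbox_imp_0[of "-l" l F l] cF Fnn l by (simp add: box_real)
    then show False using Fl by simp
  qed
  moreover have "0 \<le> m\<^sup>2 * g0 y - n\<^sup>2 * h0 w"
    by (rule has_integral_nonneg[OF F Fnn])
  ultimately have "n\<^sup>2 * h0 w < m\<^sup>2 * g0 y" by simp
  then show ?thesis unfolding g h by (simp add: green_sym)
qed

section \<open>Smooth functions of one variable\<close>

text \<open>The one-variable counterpart of \<open>C_k\<close>, with the derivative quantified
  existentially, so that it can be supplied by a formula.\<close>

primrec Ck_real :: "nat \<Rightarrow> (real \<Rightarrow> real) \<Rightarrow> bool" where
  "Ck_real 0 f \<longleftrightarrow> continuous_on UNIV f"
| "Ck_real (Suc k) f \<longleftrightarrow> (\<exists>f'. (\<forall>x. (f has_real_derivative f' x) (at x)) \<and> Ck_real k f')"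

definition smooth :: "(real \<Rightarrow> real) \<Rightarrow> bool"
  where "smooth f \<longleftrightarrow> (\<forall>k. Ck_real k f)"

lemma Ck_real_SucE:
  assumes "Ck_real (Suc k) f"
  obtains f' where "\<And>x. (f has_real_derivative f' x) (at x)" "Ck_real k f'"
  using assms by auto

lemma Ck_real_SucI: "(\<And>x. (f has_real_derivative f' x) (at x)) \<Longrightarrow> Ck_real k f' \<Longrightarrow> Ck_real (Suc k) f"
  by auto

declare Ck_real.simps(2) [simp del]

lemma derivative_imp_continuous_on:
  fixes f :: "real \<Rightarrow> real"
  assumes "\<And>x. (f has_real_derivative f' x) (at x)"
  shows "continuous_on S f"
  by (rule DERIV_continuous_on) (rule has_field_derivative_at_within[OF assms])

lemma Ck_real_SucD: "Ck_real (Suc k) f \<Longrightarrow> Ck_real k f"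
proof (induction k arbitrary: f)
  case 0
  then obtain f' where "\<And>x. (f has_real_derivative f' x) (at x)" by (rule Ck_real_SucE) blast
  then show ?case unfolding Ck_real.simps(1) by (rule derivative_imp_continuous_on)
next
  case (Suc k)
  from Suc.prems obtain f' where f': "\<And>x. (f has_real_derivative f' x) (at x)" "Ck_real (Suc k) f'"
    by (rule Ck_real_SucE) blast
  show ?case by (rule Ck_real_SucI[OF f'(1) Suc.IH[OF f'(2)]])
qed

text \<open>Meant for parametric families closed under differentiation, such as a sin (m x) + b cos
  (m x): P is membership in the family.\<close>

lemma smooth_coinduct:
  assumes "P f" and step: "\<And>g. P g \<Longrightarrow> \<exists>g'. (\<forall>x. (g has_real_derivative g' x) (at x)) \<and> P g'"
  shows "smooth f"
proof -
  have "P f \<Longrightarrow> Ck_real k f" for k f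
  proof (induction k arbitrary: f)
    case 0
    then obtain f' where "\<And>x. (f has_real_derivative f' x) (at x)" using step by blast
    then show ?case unfolding Ck_real.simps(1) by (rule derivative_imp_continuous_on)
  next
    case (Suc k)
    then obtain f' where "\<And>x. (f has_real_derivative f' x) (at x)" "P f'" using step by blast
    then show ?case using Suc.IH by (intro Ck_real_SucI)
  qed
  then show ?thesis using assms(1) by (simp add: smooth_def)
qed

lemma smooth_derivative:
  assumes "smooth f" and f': "\<And>x. (f has_real_derivative f' x) (at x)"
  shows "smooth f'"
  unfolding smooth_def
proof
  fix k
  have "Ck_real (Suc k) f" using assms(1) unfolding smooth_def by blast
  then obtain g where g: "\<And>x. (f has_real_derivative g x) (at x)" "Ck_real k g"
    by (rule Ck_real_SucE) blast
  have "g = f'" using DERIV_unique[OF g(1) f'] by (rule ext)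
  then show "Ck_real k f'" using g by simp
qed

lemma smooth_deriv_ex:
  assumes "smooth f"
  obtains f' where "\<And>x. (f has_real_derivative f' x) (at x)" "smooth f'"
proof -
  have "Ck_real (Suc 0) f" using assms unfolding smooth_def by blast
  then obtain f' where f': "\<And>x. (f has_real_derivative f' x) (at x)"
    by (rule Ck_real_SucE) blast
  show thesis by (rule that[OF f' smooth_derivative[OF assms f']])
qed

lemma smooth_continuous:
  assumes "smooth f"
  shows "continuous_on S f"
proof -
  have "Ck_real 0 f" using assms unfolding smooth_def by blast
  then show ?thesis by (auto intro: continuous_on_subset)
qed

lemma smooth_affine: "smooth (\<lambda>x. c * x + d)"
proof (rule smooth_coinduct[where P = "\<lambda>g. \<exists>c d. g = (\<lambda>x. c * x + d)"])
  fix g :: "real \<Rightarrow> real" assume "\<exists>c d. g = (\<lambda>x. c * x + d)"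
  then obtain c d where "g = (\<lambda>x. c * x + d)" by blast
  have d: "(g has_real_derivative 0 * x + c) (at x)" for x
    unfolding \<open>g = _\<close> by (auto intro!: derivative_eq_intros)
  show "\<exists>g'. (\<forall>x. (g has_real_derivative g' x) (at x)) \<and> (\<exists>c d. g' = (\<lambda>x. c * x + d))"
    by (rule exI, rule conjI, rule allI, rule d, rule exI, rule exI, rule refl)
qed (intro exI, rule refl)

lemma smooth_const [intro]: "smooth (\<lambda>x. c)"
  using smooth_affine[of 0 c] by simp

lemma Ck_real_add: "Ck_real k f \<Longrightarrow> Ck_real k g \<Longrightarrow> Ck_real k (\<lambda>x. f x + g x)"
proof (induction k arbitrary: f g)
  case (Suc k)
  obtain f' where f': "\<And>x. (f has_real_derivative f' x) (at x)" "Ck_real k f'"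
    using Suc.prems(1) by (rule Ck_real_SucE) blast
  obtain g' where g': "\<And>x. (g has_real_derivative g' x) (at x)" "Ck_real k g'"
    using Suc.prems(2) by (rule Ck_real_SucE) blast
  show ?case
    by (rule Ck_real_SucI[OF DERIV_add[OF f'(1) g'(1)] Suc.IH[OF f'(2) g'(2)]])
qed (auto intro: continuous_on_add)

lemma Ck_real_mult: "Ck_real k f \<Longrightarrow> Ck_real k g \<Longrightarrow> Ck_real k (\<lambda>x. f x * g x)"
proof (induction k arbitrary: f g)
  case (Suc k)
  obtain f' where f': "\<And>x. (f has_real_derivative f' x) (at x)" "Ck_real k f'"
    using Suc.prems(1) by (rule Ck_real_SucE) blast
  obtain g' where g': "\<And>x. (g has_real_derivative g' x) (at x)" "Ck_real k g'"
    using Suc.prems(2) by (rule Ck_real_SucE) blast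
  have "Ck_real k f" "Ck_real k g" using Suc.prems Ck_real_SucD by blast+
  then have "Ck_real k (\<lambda>x. f' x * g x + g' x * f x)"
    using f'(2) g'(2) by (intro Ck_real_add Suc.IH)
  then show ?case
    by (rule Ck_real_SucI[OF DERIV_mult[OF f'(1) g'(1)]])
qed (auto intro: continuous_on_mult)

lemma smooth_add [intro]: "smooth f \<Longrightarrow> smooth g \<Longrightarrow> smooth (\<lambda>x. f x + g x)"
  by (simp add: smooth_def Ck_real_add)

lemma smooth_mult [intro]: "smooth f \<Longrightarrow> smooth g \<Longrightarrow> smooth (\<lambda>x. f x * g x)"
  by (simp add: smooth_def Ck_real_mult)

lemma smooth_sin_cos: "smooth (\<lambda>x. a * sin (m * x) + b * cos (m * x))"
proof (rule smooth_coinduct[where P = "\<lambda>g. \<exists>a b. g = (\<lambda>x. a * sin (m * x) + b * cos (m * x))"])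
  fix g :: "real \<Rightarrow> real" assume "\<exists>a b. g = (\<lambda>x. a * sin (m * x) + b * cos (m * x))"
  then obtain a b where g: "g = (\<lambda>x. a * sin (m * x) + b * cos (m * x))" by blast
  have d: "(g has_real_derivative (- b * m) * sin (m * x) + (a * m) * cos (m * x)) (at x)" for x
    unfolding g by (auto intro!: derivative_eq_intros)
  show "\<exists>g'. (\<forall>x. (g has_real_derivative g' x) (at x)) \<and> (\<exists>a b. g' = (\<lambda>x. a * sin (m * x) + b * cos (m * x)))"
    by (rule exI, rule conjI, rule allI, rule d, rule exI, rule exI, rule refl)
qed (intro exI, rule refl)

lemma smooth_sin: "smooth (\<lambda>x. sin (m * x))" and smooth_cos: "smooth (\<lambda>x. cos (m * x))"
  using smooth_sin_cos[of 1 m 0] smooth_sin_cos[of 0 m 1] by simp_all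

lemma smooth_exp: "smooth (\<lambda>x. exp (m * x))"
proof (rule smooth_coinduct[where P = "\<lambda>g. \<exists>a. g = (\<lambda>x. a * exp (m * x))"])
  fix g :: "real \<Rightarrow> real" assume "\<exists>a. g = (\<lambda>x. a * exp (m * x))"
  then obtain a where g: "g = (\<lambda>x. a * exp (m * x))" by blast
  have d: "(g has_real_derivative (a * m) * exp (m * x)) (at x)" for x
    unfolding g by (auto intro!: derivative_eq_intros)
  show "\<exists>g'. (\<forall>x. (g has_real_derivative g' x) (at x)) \<and> (\<exists>a. g' = (\<lambda>x. a * exp (m * x)))"
    by (rule exI, rule conjI, rule allI, rule d, rule exI, rule refl)
qed (rule exI[of _ 1], simp)

lemma smooth_cosh: "smooth (\<lambda>x. cosh (m * x))" and smooth_sinh: "smooth (\<lambda>x. sinh (m * x))"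
proof -
  have "smooth (\<lambda>x. (1/2) * exp (m * x) + (1/2) * exp ((- m) * x))"
    by (intro smooth_add smooth_mult smooth_const smooth_exp)
  then show "smooth (\<lambda>x. cosh (m * x))" by (simp add: cosh_field_def add_divide_distrib)
  have "smooth (\<lambda>x. (1/2) * exp (m * x) + (- 1/2) * exp ((- m) * x))"
    by (intro smooth_add smooth_mult smooth_const smooth_exp)
  then show "smooth (\<lambda>x. sinh (m * x))" by (simp add: sinh_field_def diff_divide_distrib)
qed

text \<open>A exp(k y) with A = 1 / (k^2 - m^2)^2 solves the equation, where k > m excludes
  resonance. Homogeneous solutions correct its boundary values. Half-sums and half-differences of
  the data at l and -l separate the even from the odd unknowns, and the two 2 x 2 systems have the
  nonzero determinants theta \<open>det_even\<close> and theta \<open>det_odd\<close>.\<close>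

lemma natural_bc_solvable:
  assumes l: "0 < l" and \<sigma>: "0 \<le> \<sigma>" "\<sigma> < 1" and m: "0 < m" and k: "m < k"
  obtains h :: "nat \<Rightarrow> real \<Rightarrow> real" where
    "\<And>i y. i < 4 \<Longrightarrow> (h i has_real_derivative h (Suc i) y) (at y)" "smooth (h 0)"
    "\<And>y. y = l \<or> y = -l \<Longrightarrow> h 2 y = \<sigma> * m\<^sup>2 * h 0 y"
    "\<And>y. y = l \<or> y = -l \<Longrightarrow> h 3 y = (2 - \<sigma>) * m\<^sup>2 * h 1 y"
    "\<And>y. h 4 y - 2 * m\<^sup>2 * h 2 y + m ^ 4 * h 0 y = exp (k * y)"
proof -
  define \<theta> where "\<theta> = 1 - \<sigma>"
  have \<theta>: "0 < \<theta>" "\<theta> \<le> 1" using \<sigma> by (auto simp: \<theta>_def)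
  define s c where sc: "s = sinh (m * l)" "c = cosh (m * l)"
  have cc1: "c * c = s * s + 1" by (simp add: sc cosh_square_eq flip: power2_eq_square)
  have cc2: "c * (c * x) = s * (s * x) + x" for x
    unfolding mult.assoc[symmetric] cc1 by (simp add: distrib_right)
  define D E where DE: "D = \<theta> * det_even \<theta> (m * l)" "E = \<theta> * det_odd \<theta> (m * l)"
  have D0: "D \<noteq> 0" "E \<noteq> 0"
    using det_even_pos[of "m * l" \<theta>] det_odd_pos[of "m * l" \<theta>] \<theta> l m by (auto simp: DE)
  have solve: "\<exists>\<alpha> \<beta>. \<alpha> * p + \<beta> * q = r1 \<and> \<alpha> * p' + \<beta> * q' = r2"
    if "p * q' - p' * q = d" "d \<noteq> 0" for p q p' q' d r1 r2 :: real
  proof (intro exI conjI)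
    have "(r1 * q' - r2 * q) * p + (p * r2 - p' * r1) * q = r1 * d"
      "(r1 * q' - r2 * q) * p' + (p * r2 - p' * r1) * q' = r2 * d"
      unfolding that(1)[symmetric] by algebra+
    then show "(r1 * q' - r2 * q) / d * p + (p * r2 - p' * r1) / d * q = r1"
      "(r1 * q' - r2 * q) / d * p' + (p * r2 - p' * r1) / d * q' = r2"
      using that(2) by (simp_all add: add_divide_distrib[symmetric])
  qed
  define A where "A = 1 / (k\<^sup>2 - m\<^sup>2)\<^sup>2"
  have km: "(k\<^sup>2 - m\<^sup>2)\<^sup>2 * A = 1"
    using k m power_strict_mono[of m k 2] by (simp add: A_def)
  define r1 r2 where r: "r1 = (\<lambda>y. (k\<^sup>2 - \<sigma> * m\<^sup>2) * A * exp (k * y))"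
    "r2 = (\<lambda>y. (k ^ 3 - (2 - \<sigma>) * m\<^sup>2 * k) * A * exp (k * y))"
  have "\<theta> * c * ((2 - \<theta>) * s - \<theta> * (m * l) * c) - (- \<theta> * s) * (2 * c + \<theta> * (m * l) * s) = D"
    unfolding DE det_even_def sc[symmetric] by (simp add: algebra_simps cc1 cc2)
  from solve[OF this D0(1)] obtain \<alpha> \<beta> where ab:
    "\<alpha> * (\<theta> * c) + \<beta> * (2 * c + \<theta> * (m * l) * s) = - (r1 l + r1 (-l)) / (2 * m\<^sup>2)"
    "\<alpha> * (- \<theta> * s) + \<beta> * ((2 - \<theta>) * s - \<theta> * (m * l) * c) = - (r2 l - r2 (-l)) / (2 * m ^ 3)"
    by blast
  have "\<theta> * s * ((2 - \<theta>) * c - \<theta> * (m * l) * s) - (- \<theta> * c) * (2 * s + \<theta> * (m * l) * c) = E"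
    unfolding DE det_odd_def sc[symmetric] by (simp add: algebra_simps cc1 cc2)
  from solve[OF this D0(2)] obtain \<gamma> \<delta> where cd:
    "\<gamma> * (\<theta> * s) + \<delta> * (2 * s + \<theta> * (m * l) * c) = - (r1 l - r1 (-l)) / (2 * m\<^sup>2)"
    "\<gamma> * (- \<theta> * c) + \<delta> * ((2 - \<theta>) * c - \<theta> * (m * l) * s) = - (r2 l + r2 (-l)) / (2 * m ^ 3)"
    by blast
  \<comment> \<open>All derivatives at once: the i-th derivative of y sinh y is i cosh y + y sinh y
    for even i and i sinh y + y cosh y for odd i, and likewise for y cosh y with sinh and cosh
    exchanged.\<close>
  define h where "h = (\<lambda>(i::nat) y. A * k ^ i * exp (k * y) + m ^ i *
     (if even i then \<alpha> * cosh (m * y) + \<beta> * (real i * cosh (m * y) + (m * y) * sinh (m * y))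
        + \<gamma> * sinh (m * y) + \<delta> * (real i * sinh (m * y) + (m * y) * cosh (m * y))
      else \<alpha> * sinh (m * y) + \<beta> * (real i * sinh (m * y) + (m * y) * cosh (m * y))
        + \<gamma> * cosh (m * y) + \<delta> * (real i * cosh (m * y) + (m * y) * sinh (m * y))))"
  have ab': "m\<^sup>2 * (\<alpha> * (\<theta> * c) + \<beta> * (2 * c + \<theta> * (m * l) * s)) = - (r1 l + r1 (-l)) / 2"
    "m ^ 3 * (\<alpha> * (- \<theta> * s) + \<beta> * ((2 - \<theta>) * s - \<theta> * (m * l) * c)) = - (r2 l - r2 (-l)) / 2"
    "m\<^sup>2 * (\<gamma> * (\<theta> * s) + \<delta> * (2 * s + \<theta> * (m * l) * c)) = - (r1 l - r1 (-l)) / 2"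
    "m ^ 3 * (\<gamma> * (- \<theta> * c) + \<delta> * ((2 - \<theta>) * c - \<theta> * (m * l) * s)) = - (r2 l + r2 (-l)) / 2"
    unfolding ab cd using m by simp_all
  show thesis
  proof (rule that[of h])
    show "(h i has_real_derivative h (Suc i) y) (at y)" for i y
      unfolding h_def by (cases "even i"; simp; (rule derivative_eq_intros refl | simp)+; simp add: algebra_simps)
    have "smooth (\<lambda>y. A * exp (k * y) + (\<alpha> * cosh (m * y) + \<beta> * ((m * y + 0) * sinh (m * y))
        + \<gamma> * sinh (m * y) + \<delta> * ((m * y + 0) * cosh (m * y))))"
      by (intro smooth_add smooth_mult smooth_const smooth_exp smooth_cosh smooth_sinh smooth_affine)
    then show "smooth (h 0)" by (simp add: h_def algebra_simps)
    show "h 2 y = \<sigma> * m\<^sup>2 * h 0 y" if "y = l \<or> y = -l" for y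
    proof -
      have "h 2 y - \<sigma> * m\<^sup>2 * h 0 y = r1 y + m\<^sup>2 * (\<alpha> * (\<theta> * cosh (m * y)) + \<beta> * (2 * cosh (m * y) + \<theta> * (m * y) * sinh (m * y)))
         + m\<^sup>2 * (\<gamma> * (\<theta> * sinh (m * y)) + \<delta> * (2 * sinh (m * y) + \<theta> * (m * y) * cosh (m * y)))"
        unfolding h_def r \<theta>_def by (simp add: algebra_simps)
      also have "\<dots> = 0" (is "?lhs = 0")
      proof (cases "y = l")
        case True
        show ?thesis unfolding True sc[symmetric] ab'(1) ab'(3) by (simp add: field_simps)
      next
        case False
        then have y: "y = -l" using that by simp
        have "?lhs = r1 (- l) + m\<^sup>2 * (\<alpha> * (\<theta> * c) + \<beta> * (2 * c + \<theta> * (m * l) * s)) - m\<^sup>2 * (\<gamma> * (\<theta> * s) + \<delta> * (2 * s + \<theta> * (m * l) * c))"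
          unfolding y mult_minus_right[of m l] cosh_minus sinh_minus sc[symmetric] by (simp add: algebra_simps)
        also have "\<dots> = 0" unfolding ab'(1) ab'(3) by (simp add: field_simps)
        finally show ?thesis .
      qed
      finally show ?thesis by simp
    qed
    show "h 3 y = (2 - \<sigma>) * m\<^sup>2 * h 1 y" if "y = l \<or> y = -l" for y
    proof -
      have "h 3 y - (2 - \<sigma>) * m\<^sup>2 * h 1 y = r2 y + m ^ 3 * (\<alpha> * (- \<theta> * sinh (m * y)) + \<beta> * ((2 - \<theta>) * sinh (m * y) - \<theta> * (m * y) * cosh (m * y)))
         + m ^ 3 * (\<gamma> * (- \<theta> * cosh (m * y)) + \<delta> * ((2 - \<theta>) * cosh (m * y) - \<theta> * (m * y) * sinh (m * y)))"
        unfolding h_def r \<theta>_def by (simp add: algebra_simps power3_eq_cube power2_eq_square)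
      also have "\<dots> = 0" (is "?lhs = 0")
      proof (cases "y = l")
        case True
        show ?thesis unfolding True sc[symmetric] ab'(2) ab'(4) by (simp add: field_simps)
      next
        case False
        then have y: "y = -l" using that by simp
        have "?lhs = r2 (- l) - m ^ 3 * (\<alpha> * (- \<theta> * s) + \<beta> * ((2 - \<theta>) * s - \<theta> * (m * l) * c)) + m ^ 3 * (\<gamma> * (- \<theta> * c) + \<delta> * ((2 - \<theta>) * c - \<theta> * (m * l) * s))"
          unfolding y mult_minus_right[of m l] cosh_minus sinh_minus sc[symmetric] by (simp add: algebra_simps)
        also have "\<dots> = 0" unfolding ab'(2) ab'(4) by (simp add: field_simps)
        finally show ?thesis .
      qed
      finally show ?thesis by simp
    qed
    show "h 4 y - 2 * m\<^sup>2 * h 2 y + m ^ 4 * h 0 y = exp (k * y)" for y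
    proof -
      have "h 4 y - 2 * m\<^sup>2 * h 2 y + m ^ 4 * h 0 y = ((k\<^sup>2 - m\<^sup>2)\<^sup>2 * A) * exp (k * y)"
        unfolding h_def by (simp add: algebra_simps power4_eq_xxxx power2_eq_square)
      then show ?thesis using km by simp
    qed
  qed
qed

section \<open>Trigonometric series\<close>

text \<open>The Dirichlet kernel with its denominator cleared; it telescopes.\<close>

lemma sum_cos_mult_sin:
  "2 * sin (x / 2) * (\<Sum>m=1..n. cos (real m * x)) = sin (real n * x + x / 2) - sin (x / 2)"
proof (induction n)
  case (Suc n)
  have "sin (real (Suc n) * x + x / 2) - sin (real n * x + x / 2) = 2 * sin (x / 2) * cos (real (Suc n) * x)"
    using sin_add[of "real (Suc n) * x" "x / 2"] sin_diff[of "real (Suc n) * x" "x / 2"]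
    by (simp add: algebra_simps)
  then show ?case using Suc.IH by (simp add: distrib_left)
qed simp

text \<open>At an interior minimum of the \<open>n\<close>-th sum, the last term is nonnegative.\<close>

lemma fejer_jackson:
  assumes "0 \<le> x" "x \<le> pi"
  shows "0 \<le> (\<Sum>m=1..n. sin (real m * x) / real m)"
  using assms
proof (induction n arbitrary: x)
  case (Suc n)
  define S where "S = (\<lambda>n x. \<Sum>m=1..n. sin (real m * x) / real m)"
  have dS: "(S N has_real_derivative (\<Sum>m=1..N. cos (real m * y))) (at y)" for N y
    unfolding S_def by (auto intro!: derivative_eq_intros sum.cong)
  have cont: "continuous_on {0..pi} (S (Suc n))"
    by (rule DERIV_continuous_on) (rule has_field_derivative_at_within[OF dS])
  obtain z where z: "z \<in> {0..pi}" "\<And>y. y \<in> {0..pi} \<Longrightarrow> S (Suc n) z \<le> S (Suc n) y"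
    using continuous_attains_inf[OF compact_Icc _ cont] by auto
  have "0 \<le> S (Suc n) z"
  proof (cases "z = 0 \<or> z = pi")
    case True
    have "sin (real m * z) = 0" for m using True by (auto simp: sin_npi)
    then show ?thesis unfolding S_def by simp
  next
    case False
    then have zi: "0 < z" "z < pi" using z(1) by auto
    have "(\<Sum>m=1..Suc n. cos (real m * z)) = 0"
    proof (rule DERIV_local_min[OF dS, of "min z (pi - z)"])
      show "\<forall>y. \<bar>z - y\<bar> < min z (pi - z) \<longrightarrow> S (Suc n) z \<le> S (Suc n) y"
      proof (intro allI impI)
        fix y assume "\<bar>z - y\<bar> < min z (pi - z)"
        then have "y \<in> {0..pi}" by (auto simp: abs_less_iff)
        then show "S (Suc n) z \<le> S (Suc n) y" by (rule z(2))
      qed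
    qed (use zi in auto)
    \<comment> \<open>With N the index of the last term, a critical point satisfies sin (N z + z/2)
      = sin (z/2). The two cosines then agree up to sign, so cos (N z + z/2) \<le> cos (z/2), and
      the difference formula for sin (N z) makes the last term nonnegative.\<close>
    then have s: "sin (real (Suc n) * z + z / 2) = sin (z / 2)"
      using sum_cos_mult_sin[of z "Suc n"] by simp
    have pos: "0 < sin (z / 2)" "0 < cos (z / 2)"
      using zi by (auto intro!: sin_gt_zero cos_gt_zero)
    have "(cos (real (Suc n) * z + z / 2))\<^sup>2 = (cos (z / 2))\<^sup>2"
      using s by (simp add: cos_squared_eq)
    then have c: "cos (real (Suc n) * z + z / 2) \<le> cos (z / 2)"
      using pos by (metis abs_ge_self abs_of_pos power2_eq_iff_nonneg less_imp_le abs_ge_zero power2_abs)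
    have "sin (real (Suc n) * z) = sin (z / 2) * (cos (z / 2) - cos (real (Suc n) * z + z / 2))"
      using sin_diff[of "real (Suc n) * z + z / 2" "z / 2"] s by (simp add: algebra_simps)
    also have "\<dots> \<ge> 0" using pos c by simp
    finally have "0 \<le> sin (real (Suc n) * z) / real (Suc n)" by simp
    moreover have "0 \<le> S n z" unfolding S_def using zi by (intro Suc.IH) auto
    ultimately show ?thesis unfolding S_def by simp
  qed
  then have "0 \<le> S (Suc n) x" using z(2)[of x] Suc.prems by auto
  then show ?case unfolding S_def .
qed simp

text \<open>In the Abel summation all contributions (b_m - b_(m+1)) S_m are nonnegative. The first
  one, (b_1 - b_2) sin x, is kept and the later ones are dropped: this bounds all partial sums from
  below by one positive number, so that the limit is strictly positive.\<close>

lemma sine_series_pos: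
  fixes b :: "nat \<Rightarrow> real"
  assumes dec: "\<And>m. 1 \<le> m \<Longrightarrow> b (Suc m) < b m" and nn: "\<And>m. 1 \<le> m \<Longrightarrow> 0 \<le> b m"
    and sums: "(\<lambda>m. b m / real m * sin (real m * x)) sums s" and x: "0 < x" "x < pi"
  shows "0 < s"
proof -
  define S where "S = (\<lambda>n. \<Sum>m=1..n. sin (real m * x) / real m)"
  define T where "T = (\<lambda>n. \<Sum>m=1..n. b m / real m * sin (real m * x))"
  have S0: "0 \<le> S n" for n unfolding S_def by (rule fejer_jackson) (use x in auto)
  have key: "T (n + 2) \<ge> (b 1 - b 2) * sin x + b (n + 2) * S (n + 2)" for n
  proof (induction n)
    case 0
    have "{1..2::nat} = {1, 2}" by auto
    then show ?case unfolding T_def S_def by (simp add: algebra_simps numeral_2_eq_2)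
  next
    case (Suc n)
    let ?t = "sin (real (n + 3) * x) / real (n + 3)"
    have 1: "S (Suc n + 2) = S (n + 2) + ?t" "T (Suc n + 2) = T (n + 2) + b (n + 3) * ?t"
      unfolding S_def T_def by (simp_all add: eval_nat_numeral)
    have "b (n + 3) * S (n + 2) \<le> b (n + 2) * S (n + 2)"
      using dec[of "n + 2"] S0[of "n + 2"] by (intro mult_right_mono) (auto simp: eval_nat_numeral)
    then have "(b 1 - b 2) * sin x + b (n + 3) * (S (n + 2) + ?t) \<le> T (n + 2) + b (n + 3) * ?t"
      using Suc.IH by (simp add: distrib_left)
    then show ?case unfolding 1 by (simp add: numeral_eq_Suc)
  qed
  have "(\<lambda>n. \<Sum>m\<le>n. b m / real m * sin (real m * x)) \<longlonglongrightarrow> s"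
    using sums by (simp add: sums_def_le)
  moreover have "(\<Sum>m\<le>n. b m / real m * sin (real m * x)) = T n" for n
    unfolding T_def atMost_atLeast0 by (simp add: sum.atLeast_Suc_atMost)
  ultimately have "T \<longlonglongrightarrow> s" by simp
  then have "(\<lambda>n. T (n + 2)) \<longlonglongrightarrow> s" by (rule LIMSEQ_ignore_initial_segment)
  moreover have "(b 1 - b 2) * sin x \<le> T (n + 2)" for n
  proof -
    have "0 \<le> b (n + 2) * S (n + 2)" using nn S0 by simp
    then show ?thesis using key[of n] by linarith
  qed
  ultimately have "(b 1 - b 2) * sin x \<le> s"
    by (intro LIMSEQ_le_const) auto
  moreover have "0 < (b 1 - b 2) * sin x"
    using dec[of 1] x by (intro mult_pos_pos sin_gt_zero) (auto simp: numeral_2_eq_2)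
  ultimately show ?thesis by linarith
qed

text \<open>The polynomials in e form an algebra that separates points, hence are uniformly dense.
  If g is such a polynomial within \<epsilon> of d, the integral of d^2 equals that of d (d - g) and
  is at most \<epsilon> times the integral of |d|. The lemma is applied with e = cos in x and e =
  exp in y.\<close>

lemma moments_zero_imp_zero:
  fixes d e :: "real \<Rightarrow> real"
  assumes d: "continuous_on {a..b} d" and e: "continuous_on {a..b} e" "inj_on e {a..b}"
    and mom: "\<And>n. integral {a..b} (\<lambda>x. d x * e x ^ n) = 0" and x: "x \<in> {a..b}" and ab: "a < b"
  shows "d x = 0"
proof -
  define R where "R = {f. \<exists>p. real_polynomial_function p \<and> f = (\<lambda>x. p (e x))}"
  have RI: "(\<lambda>x. p (e x)) \<in> R" if "real_polynomial_function p" for p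
    using that unfolding R_def by blast
  have RE: "\<exists>p. real_polynomial_function p \<and> f = (\<lambda>x. p (e x))" if "f \<in> R" for f
    using that unfolding R_def by simp
  interpret function_ring_on R "{a..b}"
  proof
    show "continuous_on {a..b} f" if fR: "f \<in> R" for f
    proof -
      obtain p where p: "real_polynomial_function p" "f = (\<lambda>x. p (e x))" using RE[OF fR] by blast
      have "continuous_on (e ` {a..b}) p"
        using continuous_on_polymonial_function[of p] p(1) by (simp add: real_polynomial_function_eq)
      then show ?thesis unfolding p by (rule continuous_on_compose2[OF _ e(1)]) auto
    qed
    show "(\<lambda>x. f x + g x) \<in> R" "(\<lambda>x. f x * g x) \<in> R" if fg: "f \<in> R" "g \<in> R" for f g
    proof -
      obtain p q where pq: "real_polynomial_function p" "f = (\<lambda>x. p (e x))"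
        "real_polynomial_function q" "g = (\<lambda>x. q (e x))"
        using RE[OF fg(1)] RE[OF fg(2)] by blast
      show "(\<lambda>x. f x + g x) \<in> R" "(\<lambda>x. f x * g x) \<in> R"
        unfolding pq using RI[OF real_polynomial_function.intros(3)[OF pq(1,3)]]
          RI[OF real_polynomial_function.intros(4)[OF pq(1,3)]] by simp_all
    qed
    show "(\<lambda>_. c) \<in> R" for c
      using RI[OF real_polynomial_function.intros(2)] by simp
    show "\<exists>f\<in>R. f x \<noteq> f y" if "x \<in> {a..b}" "y \<in> {a..b}" "x \<noteq> y" for x y
    proof (rule bexI[of _ e])
      show "e x \<noteq> e y" using that e(2) by (auto dest: inj_onD)
      have "real_polynomial_function (\<lambda>x::real. x)"
        by (rule real_polynomial_function.intros(1)) (rule bounded_linear_ident)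
      from RI[OF this] show "e \<in> R" by simp
    qed
  qed simp
  have orth: "integral {a..b} (\<lambda>x. d x * f x) = 0" if fR: "f \<in> R" for f
  proof -
    obtain p where p: "real_polynomial_function p" "f = (\<lambda>x. p (e x))" using RE[OF fR] by blast
    obtain c n where c: "p = (\<lambda>x. \<Sum>i\<le>n. c i * x ^ i)"
      using p(1) unfolding real_polynomial_function_iff_sum by blast
    have "integral {a..b} (\<lambda>x. d x * f x) = integral {a..b} (\<lambda>x. \<Sum>i\<le>n. c i * (d x * e x ^ i))"
      unfolding p(2) c by (simp add: sum_distrib_left mult_ac)
    also have "\<dots> = (\<Sum>i\<le>n. integral {a..b} (\<lambda>x. c i * (d x * e x ^ i)))"
      by (intro integral_sum) (auto intro!: integrable_continuous_interval continuous_intros d e)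
    also have "\<dots> = 0" by (simp add: mom)
    finally show ?thesis .
  qed
  have di: "(\<lambda>x. d x * d x) integrable_on {a..b}" "(\<lambda>x. \<bar>d x\<bar>) integrable_on {a..b}"
    by (intro integrable_continuous_interval continuous_intros d)+
  define I where "I = integral {a..b} (\<lambda>x. \<bar>d x\<bar>)"
  have main: "integral {a..b} (\<lambda>x. d x * d x) \<le> \<epsilon> * I" if \<epsilon>: "0 < \<epsilon>" for \<epsilon>
  proof -
    obtain g where g: "g \<in> R" "\<forall>x\<in>{a..b}. \<bar>d x - g x\<bar> < \<epsilon>"
      using Stone_Weierstrass_basic[OF d \<epsilon>] by blast
    have gi: "(\<lambda>x. d x * g x) integrable_on {a..b}"
      by (intro integrable_continuous_interval continuous_intros d continuous g(1))
    have "integral {a..b} (\<lambda>x. d x * d x) = integral {a..b} (\<lambda>x. d x * d x - d x * g x)"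
      using orth[OF g(1)] by (simp add: integral_diff[OF di(1) gi])
    also have "\<dots> \<le> integral {a..b} (\<lambda>x. \<epsilon> * \<bar>d x\<bar>)"
    proof (rule integral_le)
      fix x assume "x \<in> {a..b}"
      then have "\<bar>d x - g x\<bar> < \<epsilon>" using g(2) by blast
      then have "\<bar>d x - g x\<bar> \<le> \<epsilon>" by simp
      then have "\<bar>d x\<bar> * \<bar>d x - g x\<bar> \<le> \<bar>d x\<bar> * \<epsilon>" by (intro mult_left_mono) auto
      moreover have "d x * d x - d x * g x \<le> \<bar>d x\<bar> * \<bar>d x - g x\<bar>"
        by (metis abs_ge_self abs_mult right_diff_distrib)
      ultimately show "d x * d x - d x * g x \<le> \<epsilon> * \<bar>d x\<bar>" by (simp add: mult.commute)
    qed (intro integrable_diff di gi integrable_on_mult_right)+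
    finally show ?thesis by (simp add: I_def)
  qed
  have le: "integral {a..b} (\<lambda>x. d x * d x) / (I + 1) \<le> \<epsilon>" if "0 < \<epsilon>" for \<epsilon>
  proof -
    have I0: "0 \<le> I" unfolding I_def by (rule integral_nonneg[OF di(2)]) simp
    have "integral {a..b} (\<lambda>x. d x * d x) \<le> \<epsilon> * I" by (rule main[OF that])
    also have "\<dots> \<le> \<epsilon> * (I + 1)" using that by simp
    finally show ?thesis using I0 by (simp add: field_simps)
  qed
  have "integral {a..b} (\<lambda>x. d x * d x) / (I + 1) \<le> 0"
    by (rule field_le_epsilon) (use le in simp)
  moreover have I0: "0 \<le> I" unfolding I_def by (rule integral_nonneg[OF di(2)]) simp
  ultimately have "integral {a..b} (\<lambda>x. d x * d x) \<le> 0"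
    by (simp add: divide_le_0_iff)
  moreover have "0 \<le> integral {a..b} (\<lambda>x. d x * d x)"
    by (rule integral_nonneg[OF di(1)]) simp
  ultimately have "((\<lambda>x. d x * d x) has_integral 0) (cbox a b)"
    using di(1) by (simp add: has_integral_iff)
  then have "d x * d x = 0"
    using has_integral_0_cbox_imp_0[of a b "\<lambda>x. d x * d x" x] x d ab
    by (simp add: continuous_on_mult box_real)
  then show ?thesis by simp
qed

section \<open>Cutoff functions\<close>

lemma Ck_real_affine:
  assumes "Ck_real k f"
  shows "Ck_real k (\<lambda>x. f (c * x + d))"
  using assms
proof (induction k arbitrary: f)
  case 0
  then show ?case
    by (auto intro!: continuous_intros continuous_on_compose2[of UNIV f])
next
  case (Suc k)
  obtain f' where f': "\<And>x. (f has_real_derivative f' x) (at x)" "Ck_real k f'"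
    using Suc.prems by (rule Ck_real_SucE) blast
  have "((\<lambda>x. f (c * x + d)) has_real_derivative f' (c * x + d) * c) (at x)" for x
    by (rule DERIV_chain2[OF f'(1)]) (auto intro!: derivative_eq_intros)
  moreover have "Ck_real k (\<lambda>x. f' (c * x + d) * c)"
    using Ck_real_mult[OF Suc.IH[OF f'(2)], of "\<lambda>_. c"] smooth_const[of c] by (simp add: smooth_def)
  ultimately show ?case by (rule Ck_real_SucI)
qed

lemma smooth_comp_affine: "smooth f \<Longrightarrow> smooth (\<lambda>x. f (c * x + d))"
  by (simp add: smooth_def Ck_real_affine)

lemma Ck_real_inverse:
  assumes "Ck_real k f" "\<And>x. f x \<noteq> 0"
  shows "Ck_real k (\<lambda>x. inverse (f x))"
  using assms(1)
proof (induction k)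
  case 0
  then show ?case using assms(2) by (auto intro!: continuous_intros)
next
  case (Suc k)
  obtain f' where f': "\<And>x. (f has_real_derivative f' x) (at x)" "Ck_real k f'"
    using Suc.prems by (rule Ck_real_SucE) blast
  have i: "Ck_real k (\<lambda>x. inverse (f x))" by (rule Suc.IH[OF Ck_real_SucD[OF Suc.prems]])
  have "Ck_real k (\<lambda>x. (-1) * f' x)"
    using Ck_real_mult[OF _ f'(2), of "\<lambda>_. -1"] smooth_const[of "-1"] by (simp add: smooth_def)
  then have "Ck_real k (\<lambda>x. ((-1) * f' x) * (inverse (f x) * inverse (f x)))"
    by (rule Ck_real_mult[OF _ Ck_real_mult[OF i i]])
  moreover have "((\<lambda>x. inverse (f x)) has_real_derivative ((-1) * f' x) * (inverse (f x) * inverse (f x))) (at x)" for x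
    by (rule derivative_eq_intros f'(1) assms(2) refl)+ simp
  ultimately show ?case by (intro Ck_real_SucI)
qed

text \<open>The factor (1 / x)^j makes the family closed under differentiation up to linear
  combinations, so that smoothness follows by induction on the order with j arbitrary.\<close>

definition flat :: "nat \<Rightarrow> real \<Rightarrow> real"
  where "flat j x = (if 0 < x then (1 / x) ^ j * exp (- (1 / x)) else 0)"

lemma flat_tendsto_0: "(flat j \<longlongrightarrow> 0) (at_right 0)"
proof -
  have "((\<lambda>t. t ^ j / exp t) \<longlongrightarrow> (0::real)) at_top" by (rule tendsto_power_div_exp_0)
  then have "((\<lambda>x. (1 / x) ^ j / exp (1 / x)) \<longlongrightarrow> (0::real)) (at_right 0)"
    by (rule filterlim_compose) (simp add: divide_inverse filterlim_inverse_at_top_right)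
  then show ?thesis
    by (rule Lim_transform_eventually)
      (auto simp: flat_def exp_minus divide_inverse eventually_at_right_less intro: eventually_mono[OF eventually_at_right_less])
qed

lemma flat_deriv: "(flat j has_real_derivative flat (j + 2) x + (- real j) * flat (j + 1) x) (at x)"
proof -
  consider "0 < x" | "x < 0" | "x = 0" by linarith
  then show ?thesis
  proof cases
    case 1
    define t where "t = 1 / x"
    have du: "((\<lambda>x. 1 / x) has_real_derivative - (t * t)) (at x)"
      using 1 by (auto intro!: derivative_eq_intros simp: t_def)
    have "((\<lambda>x. (1 / x) ^ j * exp (- (1 / x))) has_real_derivative
      (real j * (t ^ (j - Suc 0) * - (t * t))) * exp (- t) + (exp (- t) * (t * t)) * t ^ j) (at x)"
      unfolding t_def
      by (rule derivative_eq_intros du[unfolded t_def] refl)+ (simp add: mult_ac)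
    also have "(real j * (t ^ (j - Suc 0) * - (t * t))) * exp (- t) + (exp (- t) * (t * t)) * t ^ j
      = t ^ (j + 2) * exp (- t) + (- real j) * (t ^ (j + 1) * exp (- t))"
      by (cases j) (simp_all add: algebra_simps)
    finally have "((\<lambda>x. (1 / x) ^ j * exp (- (1 / x))) has_real_derivative
      (1 / x) ^ (j + 2) * exp (- (1 / x)) + (- real j) * ((1 / x) ^ (j + 1) * exp (- (1 / x)))) (at x)"
      unfolding t_def .
    then have "(flat j has_real_derivative
      (1 / x) ^ (j + 2) * exp (- (1 / x)) + (- real j) * ((1 / x) ^ (j + 1) * exp (- (1 / x)))) (at x)"
      by (rule has_field_derivative_transform_within_open[where S = "{0<..}"]) (use 1 in \<open>auto simp: flat_def\<close>)
    then show ?thesis using 1 by (simp add: flat_def)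
  next
    case 2
    have "(flat j has_real_derivative 0) (at x)"
      by (rule has_field_derivative_transform_within_open[where S = "{..<0}" and f = "\<lambda>_. 0"]) (use 2 in \<open>auto simp: flat_def\<close>)
    then show ?thesis using 2 by (simp add: flat_def)
  next
    case 3
    have "((\<lambda>y. flat j y / y) \<longlongrightarrow> 0) (at_right 0)"
      by (rule Lim_transform_eventually[OF flat_tendsto_0[of "j + 1"]])
        (auto intro!: eventually_mono[OF eventually_at_right_less] simp: flat_def divide_inverse)
    moreover have "((\<lambda>y. flat j y / y) \<longlongrightarrow> 0) (at_left 0)"
      by (rule Lim_transform_eventually[OF tendsto_const])
        (auto simp: eventually_at_filter flat_def)
    ultimately have "((\<lambda>y. flat j y / y) \<longlongrightarrow> 0) (at 0)"
      by (simp add: filterlim_split_at)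
    then show ?thesis using 3 by (simp add: has_field_derivative_iff flat_def)
  qed
qed

lemma smooth_flat: "smooth (flat j)"
proof -
  have "Ck_real k (flat j)" for k
  proof (induction k arbitrary: j)
    case 0
    show ?case unfolding Ck_real.simps(1) by (rule derivative_imp_continuous_on[OF flat_deriv])
  next
    case (Suc k)
    have "Ck_real k (\<lambda>x. flat (j + 2) x + (- real j) * flat (j + 1) x)"
      using smooth_const[of "- real j"]
      by (intro Ck_real_add Ck_real_mult Suc.IH) (simp add: smooth_def)
    then show ?case by (rule Ck_real_SucI[OF flat_deriv])
  qed
  then show ?thesis by (simp add: smooth_def)
qed

lemma smooth_step_exists:
  obtains S S' :: "real \<Rightarrow> real" and C :: real where
    "smooth S" "\<And>x. (S has_real_derivative S' x) (at x)"
    "\<And>x. x \<le> 1 \<Longrightarrow> S x = 0" "\<And>x. 2 \<le> x \<Longrightarrow> S x = 1" "\<And>x. 0 \<le> S x" "\<And>x. S x \<le> 1"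
    "\<And>x. x < 1 \<or> 2 < x \<Longrightarrow> S' x = 0" "\<And>x. \<bar>S' x\<bar> \<le> C" "0 \<le> C"
proof -
  \<comment> \<open>The denominator of the usual quotient. It never vanishes, since every x
    satisfies x > 1 or x < 2.\<close>
  define D where "D = (\<lambda>x. flat 0 (1 * x + (-1)) + flat 0 ((-1) * x + 2))"
  have nn: "0 \<le> flat 0 x" for x by (simp add: flat_def)
  have Dp: "0 < D x" for x
  proof (cases "x > 1")
    case True
    then have "0 < flat 0 (1 * x + (-1))" by (simp add: flat_def)
    then show ?thesis unfolding D_def using nn[of "(-1) * x + 2"] by linarith
  next
    case False
    then have "0 < flat 0 ((-1) * x + 2)" by (simp add: flat_def)
    then show ?thesis unfolding D_def using nn[of "1 * x + (-1)"] by linarith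
  qed
  have sD: "smooth D" unfolding D_def by (intro smooth_add smooth_comp_affine smooth_flat)
  define S where "S = (\<lambda>x. flat 0 (1 * x + (-1)) * inverse (D x))"
  have "smooth (\<lambda>x. inverse (D x))"
    using sD Dp Ck_real_inverse[of _ D] by (auto simp: smooth_def less_le)
  then have sS: "smooth S" unfolding S_def by (intro smooth_mult smooth_comp_affine smooth_flat)
  then obtain S' where S': "\<And>x. (S has_real_derivative S' x) (at x)" "smooth S'"
    by (rule smooth_deriv_ex) blast
  have 0: "S x = 0" if "x \<le> 1" for x using that by (simp add: S_def flat_def)
  have 1: "S x = 1" if "2 \<le> x" for x
    using that Dp[of x] by (simp add: S_def D_def flat_def)
  have z: "S' x = 0" if "x < 1 \<or> 2 < x" for x
  proof -
    have "(S has_real_derivative 0) (at x)"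
    proof (cases "x < 1")
      case True
      show ?thesis
        by (rule has_field_derivative_transform_within_open[where S = "{..<1}" and f = "\<lambda>_. 0"])
          (use True 0 in auto)
    next
      case False
      show ?thesis
        by (rule has_field_derivative_transform_within_open[where S = "{2<..}" and f = "\<lambda>_. 1"])
          (use False that 1 in auto)
    qed
    then show ?thesis using S'(1) DERIV_unique by blast
  qed
  have "bounded (S' ` {1..2})"
    by (intro compact_imp_bounded compact_continuous_image smooth_continuous S'(2)) auto
  then obtain C where C: "\<And>x. x \<in> {1..2} \<Longrightarrow> \<bar>S' x\<bar> \<le> C"
    unfolding bounded_iff by (metis imageI real_norm_def)
  have C0: "0 \<le> C" using C[of 1] by (auto intro: order_trans[OF abs_ge_zero])
  show thesis
  proof (rule that[OF sS S'(1) 0 1 _ _ z])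
    show "0 \<le> S x" for x using nn Dp[of x] by (simp add: S_def)
    show "S x \<le> 1" for x
      using Dp[of x] nn[of "(-1) * x + 2"] by (simp add: S_def D_def field_simps)
    show "\<bar>S' x\<bar> \<le> C" for x
      using z[of x] C[of x] C0 by (cases "x < 1 \<or> 2 < x") auto
  qed (use C0 in auto)
qed

text \<open>\<open>{c..d}\<close> may be empty, so the zero function qualifies even for b \<le> a;
  empty intervals do occur when boxes are intersected with the plate.\<close>

definition smooth_supp :: "real \<Rightarrow> real \<Rightarrow> (real \<Rightarrow> real) \<Rightarrow> bool"
  where "smooth_supp a b f \<longleftrightarrow> smooth f \<and> (\<exists>c d. a < c \<and> d < b \<and> (\<forall>x. x \<notin> {c..d} \<longrightarrow> f x = 0))"

lemma smooth_supp_smooth: "smooth_supp a b f \<Longrightarrow> smooth f"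
  by (simp add: smooth_supp_def)

lemma smooth_supp_mult: "smooth_supp a b f \<Longrightarrow> smooth g \<Longrightarrow> smooth_supp a b (\<lambda>x. f x * g x)"
  unfolding smooth_supp_def by auto

lemma smooth_supp_deriv:
  assumes "smooth_supp a b f" and f': "\<And>x. (f has_real_derivative f' x) (at x)"
  shows "smooth_supp a b f'"
proof -
  obtain c d where cd: "a < c" "d < b" "\<And>x. x \<notin> {c..d} \<Longrightarrow> f x = 0"
    using assms(1) unfolding smooth_supp_def by auto
  have "f' x = 0" if "x \<notin> {c..d}" for x
  proof -
    have "(f has_real_derivative 0) (at x)"
      by (rule has_field_derivative_transform_within_open[where S = "- {c..d}" and f = "\<lambda>_. 0"])
        (use that cd(3) in auto)
    then show ?thesis using f' DERIV_unique by blast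
  qed
  then show ?thesis
    using smooth_derivative[OF smooth_supp_smooth[OF assms(1)] f'] cd(1,2) unfolding smooth_supp_def by blast
qed

text \<open>The functions are S (N (x - a)) S (N (b - x)) with N = n + 1, for the smooth step S.
  Their derivatives have size of order N and live in end layers of width 2 / N. The list serves two
  ways of discarding the term \<eta>' f of the product rule: the bound by the inverse distance to
  the ends applies when f vanishes there, the bounds on size and layer when f is paired with a
  function that vanishes there.\<close>

lemma cutoff_exists:
  fixes a b :: real
  obtains \<eta> \<eta>' :: "nat \<Rightarrow> real \<Rightarrow> real" and K :: real where
    "\<And>n. smooth_supp a b (\<eta> n)" "\<And>n x. (\<eta> n has_real_derivative \<eta>' n x) (at x)" "\<And>n. continuous_on UNIV (\<eta>' n)"
    "\<And>n x. \<bar>\<eta> n x\<bar> \<le> 1" "\<And>x. x \<in> {a<..<b} \<Longrightarrow> (\<lambda>n. \<eta> n x) \<longlonglongrightarrow> 1"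
    "\<And>n x. x \<notin> {a<..<b} \<Longrightarrow> \<eta> n x = 0"
    "\<And>x. x \<in> {a<..<b} \<Longrightarrow> (\<lambda>n. \<eta>' n x) \<longlonglongrightarrow> 0"
    "\<And>n x. x \<in> {a<..<b} \<Longrightarrow> \<bar>\<eta>' n x\<bar> * min (x - a) (b - x) \<le> K"
    "\<And>n x. \<bar>\<eta>' n x\<bar> \<le> K * real (Suc n)"
    "\<And>n x. x \<in> {a<..<b} \<Longrightarrow> \<eta>' n x \<noteq> 0 \<Longrightarrow> x - a \<le> 2 / real (Suc n) \<or> b - x \<le> 2 / real (Suc n)"
proof -
  obtain S S' :: "real \<Rightarrow> real" and C :: real where S:
    "smooth S" "\<And>x. (S has_real_derivative S' x) (at x)"
    "\<And>x. x \<le> 1 \<Longrightarrow> S x = 0" "\<And>x. 2 \<le> x \<Longrightarrow> S x = 1" "\<And>x. 0 \<le> S x" "\<And>x. S x \<le> 1"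
    "\<And>x. x < 1 \<or> 2 < x \<Longrightarrow> S' x = 0" "\<And>x. \<bar>S' x\<bar> \<le> C" "0 \<le> C"
    by (rule smooth_step_exists) blast
  define N where "N = (\<lambda>n. real (Suc n))"
  have N: "0 < N n" for n by (simp add: N_def)
  define \<eta> where "\<eta> = (\<lambda>n x. S (N n * x + (- N n * a)) * S ((- N n) * x + N n * b))"
  define \<eta>' where "\<eta>' = (\<lambda>n x. (S' (N n * x + (- N n * a)) * N n) * S ((- N n) * x + N n * b)
      + (S' ((- N n) * x + N n * b) * (- N n)) * S (N n * x + (- N n * a)))"
  have arg: "N n * x + (- N n * a) = N n * (x - a)" "(- N n) * x + N n * b = N n * (b - x)" for n x
    by (simp_all add: algebra_simps)
  have sm: "smooth (\<eta> n)" for n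
    unfolding \<eta>_def by (intro smooth_mult smooth_comp_affine S)
  have d: "(\<eta> n has_real_derivative \<eta>' n x) (at x)" for n x
    unfolding \<eta>_def \<eta>'_def
    by (intro DERIV_mult DERIV_chain2[OF S(2)]) (auto intro!: derivative_eq_intros)
  have d0: "\<eta>' n x = (S' (N n * (x - a)) * N n) * S (N n * (b - x)) + (S' (N n * (b - x)) * (- N n)) * S (N n * (x - a))" for n x
    unfolding \<eta>'_def arg ..
  have c0: "\<eta> n x = S (N n * (x - a)) * S (N n * (b - x))" for n x
    unfolding \<eta>_def arg ..
  have large: "\<forall>\<^sub>F n in sequentially. 2 < N n * t" if "0 < t" for t
  proof -
    have "filterlim (\<lambda>n. t * N n) at_top sequentially"
      unfolding N_def using that
      by (intro filterlim_tendsto_pos_mult_at_top[OF tendsto_const] that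
          filterlim_compose[OF filterlim_real_sequentially] filterlim_Suc)
    then show ?thesis by (simp add: filterlim_at_top_dense mult.commute)
  qed
  have ev: "\<forall>\<^sub>F n in sequentially. 2 < N n * (x - a) \<and> 2 < N n * (b - x)" if "x \<in> {a<..<b}" for x
    using large[of "x - a"] large[of "b - x"] that by (auto intro: eventually_conj)
  \<comment> \<open>With t = N (x - a) the factor N of the chain rule turns into the inverse of the
    distance x - a. Each end contributes 2 C, hence the constant 4 C.\<close>
  have S'b: "\<bar>S' t\<bar> * t \<le> 2 * C" if "0 < t" for t
  proof (cases "2 < t")
    case True
    then show ?thesis using S(7,9) by simp
  next
    case False
    then have "\<bar>S' t\<bar> * t \<le> C * 2" using S(8)[of t] S(9) that by (intro mult_mono) auto
    then show ?thesis by simp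
  qed
  have ab: "\<bar>\<eta>' n x\<bar> \<le> \<bar>S' (N n * (x - a))\<bar> * N n + \<bar>S' (N n * (b - x))\<bar> * N n" for n x
  proof -
    have "\<bar>\<eta>' n x\<bar> \<le> \<bar>(S' (N n * (x - a)) * N n) * S (N n * (b - x))\<bar> + \<bar>(S' (N n * (b - x)) * (- N n)) * S (N n * (x - a))\<bar>"
      unfolding d0 by (rule abs_triangle_ineq)
    also have "\<dots> \<le> (\<bar>S' (N n * (x - a))\<bar> * N n) * 1 + (\<bar>S' (N n * (b - x))\<bar> * N n) * 1"
      unfolding abs_mult using N[of n] S(5,6) by (intro add_mono mult_mono) auto
    finally show ?thesis by simp
  qed
  show thesis
  proof (rule that[of \<eta> \<eta>' "4 * C"])
    show "smooth_supp a b (\<eta> n)" for n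
      unfolding smooth_supp_def
    proof (intro conjI sm exI allI impI)
      show "a < a + 1 / N n" "b - 1 / N n < b" using N by simp_all
      fix x assume "x \<notin> {a + 1 / N n..b - 1 / N n}"
      then have "N n * (x - a) \<le> 1 \<or> N n * (b - x) \<le> 1"
        using N[of n] by (auto simp: field_simps)
      then show "\<eta> n x = 0" unfolding c0 using S(3) by auto
    qed
    show "(\<eta> n has_real_derivative \<eta>' n x) (at x)" for n x by (rule d)
    show "continuous_on UNIV (\<eta>' n)" for n
      by (rule smooth_continuous[OF smooth_derivative[OF sm d]])
    show "\<bar>\<eta> n x\<bar> \<le> 1" for n x
      unfolding c0 using S(5,6) by (simp add: abs_mult mult_le_one)
    show "\<eta> n x = 0" if "x \<notin> {a<..<b}" for n x
    proof -
      have "x - a \<le> 0 \<or> b - x \<le> 0" using that by auto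
      then have "N n * (x - a) \<le> 0 \<or> N n * (b - x) \<le> 0"
        using N[of n] by (simp add: mult_le_0_iff)
      then show ?thesis unfolding c0 using S(3) by (metis le_numeral_extra(1) mult_eq_0_iff order_trans zero_le_one)
    qed
    show "(\<lambda>n. \<eta> n x) \<longlonglongrightarrow> 1" if "x \<in> {a<..<b}" for x
    proof (rule tendsto_eventually)
      show "\<forall>\<^sub>F n in sequentially. \<eta> n x = 1"
        using ev[OF that] by eventually_elim (simp add: c0 S(4))
    qed
    show "(\<lambda>n. \<eta>' n x) \<longlonglongrightarrow> 0" if "x \<in> {a<..<b}" for x
    proof (rule tendsto_eventually)
      show "\<forall>\<^sub>F n in sequentially. \<eta>' n x = 0"
        using ev[OF that] by eventually_elim (simp add: d0 S(7))
    qed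
    show "\<bar>\<eta>' n x\<bar> * min (x - a) (b - x) \<le> 4 * C" if "x \<in> {a<..<b}" for n x
    proof -
      have p: "0 < x - a" "0 < b - x" using that by auto
      have "\<bar>\<eta>' n x\<bar> * min (x - a) (b - x)
        \<le> (\<bar>S' (N n * (x - a))\<bar> * N n + \<bar>S' (N n * (b - x))\<bar> * N n) * min (x - a) (b - x)"
        using p by (intro mult_right_mono ab) auto
      also have "\<dots> = (\<bar>S' (N n * (x - a))\<bar> * N n) * min (x - a) (b - x) + (\<bar>S' (N n * (b - x))\<bar> * N n) * min (x - a) (b - x)"
        by (rule distrib_right)
      also have "\<dots> \<le> (\<bar>S' (N n * (x - a))\<bar> * N n) * (x - a) + (\<bar>S' (N n * (b - x))\<bar> * N n) * (b - x)"
        using N[of n] by (intro add_mono mult_left_mono) auto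
      also have "\<dots> \<le> 2 * C + 2 * C"
        using S'b[of "N n * (x - a)"] S'b[of "N n * (b - x)"] p N[of n] by (simp add: mult.assoc)
      finally show ?thesis by simp
    qed
    show "\<bar>\<eta>' n x\<bar> \<le> 4 * C * real (Suc n)" for n x
    proof -
      have "\<bar>\<eta>' n x\<bar> \<le> C * N n + C * N n"
        using ab[of n x] S(8) N[of n] by (smt (verit) mult_right_mono)
      also have "\<dots> \<le> 4 * C * N n" using S(9) N[of n] by simp
      finally show ?thesis by (simp add: N_def)
    qed
    show "x - a \<le> 2 / real (Suc n) \<or> b - x \<le> 2 / real (Suc n)" if "x \<in> {a<..<b}" "\<eta>' n x \<noteq> 0" for n x
    proof (rule ccontr)
      assume "\<not> ?thesis"
      then have "2 / N n < x - a" "2 / N n < b - x" by (auto simp: N_def)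
      then have "2 < N n * (x - a)" "2 < N n * (b - x)"
        using N[of n] by (simp_all add: pos_divide_less_eq mult.commute)
      then show False using that(2) by (simp add: d0 S(7))
    qed
  qed
qed

text \<open>What bounded convergence says about a plate pairing with one tensor factor frozen.
  Stated for abstract functionals, the removal of cutoffs can be used in x and in y alike.\<close>

definition dct_functional :: "real \<Rightarrow> real \<Rightarrow> ((real \<Rightarrow> real) \<Rightarrow> real) \<Rightarrow> bool"
  where "dct_functional a b \<Phi> \<longleftrightarrow>
    (\<forall>f g C. (\<forall>n. continuous_on UNIV (f n)) \<longrightarrow> continuous_on UNIV g \<longrightarrow>
      (\<forall>n. \<forall>x\<in>{a<..<b}. \<bar>f n x\<bar> \<le> C) \<longrightarrow> (\<forall>x\<in>{a<..<b}. (\<lambda>n. f n x) \<longlonglongrightarrow> g x) \<longrightarrow>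
      (\<lambda>n. \<Phi> (f n)) \<longlonglongrightarrow> \<Phi> g)"

lemma dct_functionalD:
  assumes "dct_functional a b \<Phi>" "\<And>n. continuous_on UNIV (f n)" "continuous_on UNIV g"
    "\<And>n x. x \<in> {a<..<b} \<Longrightarrow> \<bar>f n x\<bar> \<le> C" "\<And>x. x \<in> {a<..<b} \<Longrightarrow> (\<lambda>n. f n x) \<longlonglongrightarrow> g x"
  shows "(\<lambda>n. \<Phi> (f n)) \<longlonglongrightarrow> \<Phi> g"
  using assms unfolding dct_functional_def by blast

lemma continuous_bounded_on:
  assumes "continuous_on UNIV f"
  obtains M where "\<And>x::real. x \<in> {a..b} \<Longrightarrow> \<bar>f x :: real\<bar> \<le> M" "0 \<le> M"
proof -
  have "bounded (f ` {a..b})"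
    by (intro compact_imp_bounded compact_continuous_image continuous_on_subset[OF assms]) auto
  then obtain M where M: "\<forall>x\<in>f ` {a..b}. norm x \<le> M" unfolding bounded_iff by blast
  show thesis
  proof (rule that[of "max M 0"])
    show "\<bar>f x\<bar> \<le> max M 0" if "x \<in> {a..b}" for x
      using M that by (intro order_trans[OF _ max.cobounded1]) auto
  qed simp
qed

lemma cutoff_approximation:
  assumes \<Phi>: "dct_functional a b \<Phi>" and g: "smooth g" and \<eta>: "\<And>n. smooth_supp a b (\<eta> n)" "\<And>n x. \<bar>\<eta> n x\<bar> \<le> 1"
    "\<And>x. x \<in> {a<..<b} \<Longrightarrow> (\<lambda>n. \<eta> n x) \<longlonglongrightarrow> 1"
  shows "(\<lambda>n. \<Phi> (\<lambda>x. \<eta> n x * g x)) \<longlonglongrightarrow> \<Phi> g"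
proof -
  obtain M where M: "\<And>x. x \<in> {a..b} \<Longrightarrow> \<bar>g x\<bar> \<le> M"
    using continuous_bounded_on[OF smooth_continuous[OF g], of a b] by metis
  show ?thesis
  proof (rule dct_functionalD[OF \<Phi>, where C = M])
    show "\<bar>\<eta> n x * g x\<bar> \<le> M" if "x \<in> {a<..<b}" for n x
      using mult_mono[OF \<eta>(2)[of n x] M[of x]] that by (simp add: abs_mult)
    show "(\<lambda>n. \<eta> n x * g x) \<longlonglongrightarrow> g x" if "x \<in> {a<..<b}" for x
      using tendsto_mult[OF \<eta>(3)[OF that] tendsto_const[of "g x"]] by simp
  qed (intro continuous_intros smooth_continuous smooth_supp_smooth[OF \<eta>(1)] g)+
qed

lemma cutoff_removal:
  assumes "dct_functional a b \<Phi>" "dct_functional a b \<Psi>"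
    and eq: "\<And>f. smooth_supp a b f \<Longrightarrow> \<Phi> f = \<Psi> f" and f: "smooth f"
  shows "\<Phi> f = \<Psi> f"
proof -
  obtain \<eta> where \<eta>: "\<And>n. smooth_supp a b (\<eta> n)" "\<And>n x. \<bar>\<eta> n x\<bar> \<le> 1" "\<And>x. x \<in> {a<..<b} \<Longrightarrow> (\<lambda>n. \<eta> n x) \<longlonglongrightarrow> (1::real)"
    by (rule cutoff_exists[of a b]) blast
  note lim = cutoff_approximation[OF _ f \<eta>]
  have "(\<lambda>n. \<Phi> (\<lambda>x. \<eta> n x * f x)) = (\<lambda>n. \<Psi> (\<lambda>x. \<eta> n x * f x))"
    using eq[OF smooth_supp_mult[OF \<eta>(1) f]] by simp
  then show ?thesis using lim[OF assms(1)] lim[OF assms(2)] LIMSEQ_unique by metis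
qed

lemma vanishing_at_ends_bound:
  assumes f': "\<And>x. (f has_real_derivative f' x) (at x)" and M: "\<And>x. x \<in> {a..b} \<Longrightarrow> \<bar>f' x\<bar> \<le> M"
    and "f a = 0" "f b = 0" and x: "x \<in> {a<..<b}"
  shows "\<bar>f x\<bar> \<le> M * min (x - a) (b - x)"
proof -
  have M0: "0 \<le> M" using M[of x] x by auto
  obtain y where y: "a < y" "y < x" "f x - f a = (x - a) * f' y"
    using MVT2[of a x f f'] f' x by auto
  obtain z where z: "x < z" "z < b" "f b - f x = (b - x) * f' z"
    using MVT2[of x b f f'] f' x by auto
  have 1: "\<bar>f x\<bar> = (x - a) * \<bar>f' y\<bar>" using y(3) assms(3) x by (simp add: abs_mult)
  have "\<bar>f b - f x\<bar> = (b - x) * \<bar>f' z\<bar>" using z(3) x by (simp add: abs_mult)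
  then have 2: "\<bar>f x\<bar> = (b - x) * \<bar>f' z\<bar>" using assms(4) by simp
  have "\<bar>f x\<bar> \<le> M * (x - a)" unfolding 1 using M[of y] x y by (simp add: mult.commute mult_left_mono)
  moreover have "\<bar>f x\<bar> \<le> M * (b - x)" unfolding 2 using M[of z] x z by (simp add: mult.commute mult_left_mono)
  ultimately show ?thesis by (simp add: min_def)
qed

text \<open>In the derivative \<eta>' f + f' \<eta> of the cut-off function the first term tends to
  0 pointwise and stays bounded: |f| is at most a constant times the distance to the ends, |\<eta>'|
  at most a constant divided by it.\<close>

lemma cutoff_removal_deriv:
  assumes "dct_functional a b \<Phi>" "dct_functional a b \<Psi>"
    and eq: "\<And>f f'. smooth_supp a b f \<Longrightarrow> (\<And>x. (f has_real_derivative f' x) (at x)) \<Longrightarrow> \<Phi> f' = \<Psi> f"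
    and f: "smooth f" "\<And>x. (f has_real_derivative f' x) (at x)" and "f a = 0" "f b = 0"
  shows "\<Phi> f' = \<Psi> f"
proof -
  obtain \<eta> \<eta>' K where \<eta>: "\<And>n. smooth_supp a b (\<eta> n)" "\<And>n x. (\<eta> n has_real_derivative \<eta>' n x) (at x)"
    "\<And>n. continuous_on UNIV (\<eta>' n)" "\<And>n x. \<bar>\<eta> n x\<bar> \<le> 1"
    "\<And>x. x \<in> {a<..<b} \<Longrightarrow> (\<lambda>n. \<eta> n x) \<longlonglongrightarrow> (1::real)" "\<And>x. x \<in> {a<..<b} \<Longrightarrow> (\<lambda>n. \<eta>' n x) \<longlonglongrightarrow> (0::real)"
    "\<And>n x. x \<in> {a<..<b} \<Longrightarrow> \<bar>\<eta>' n x\<bar> * min (x - a) (b - x) \<le> K"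
    by (rule cutoff_exists[of a b]) blast
  have sf': "smooth f'" by (rule smooth_derivative[OF f])
  obtain M' where M': "\<And>x. x \<in> {a..b} \<Longrightarrow> \<bar>f' x\<bar> \<le> M'" "0 \<le> M'"
    using continuous_bounded_on[OF smooth_continuous[OF sf'], of a b] by metis
  note ct = smooth_continuous[OF smooth_supp_smooth[OF \<eta>(1)]] smooth_continuous[OF f(1)] smooth_continuous[OF sf'] \<eta>(3)
  have 1: "(\<lambda>n. \<Psi> (\<lambda>x. \<eta> n x * f x)) \<longlonglongrightarrow> \<Psi> f"
    by (rule cutoff_approximation[OF assms(2) f(1) \<eta>(1,4,5)])
  have 2: "(\<lambda>n. \<Phi> (\<lambda>x. \<eta>' n x * f x + f' x * \<eta> n x)) \<longlonglongrightarrow> \<Phi> f'"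
  proof (rule dct_functionalD[OF assms(1), where C = "M' * K + M'"])
    show "\<bar>\<eta>' n x * f x + f' x * \<eta> n x\<bar> \<le> M' * K + M'" if x: "x \<in> {a<..<b}" for n x
    proof -
      have "\<bar>\<eta>' n x * f x\<bar> \<le> \<bar>\<eta>' n x\<bar> * (M' * min (x - a) (b - x))"
        unfolding abs_mult
        by (intro mult_left_mono vanishing_at_ends_bound[OF f(2) M'(1) assms(6,7) x]) auto
      also have "\<dots> = M' * (\<bar>\<eta>' n x\<bar> * min (x - a) (b - x))" by simp
      also have "\<dots> \<le> M' * K" by (intro mult_left_mono \<eta>(7) x M')
      finally have "\<bar>\<eta>' n x * f x\<bar> \<le> M' * K" .
      moreover have "\<bar>f' x * \<eta> n x\<bar> \<le> M' * 1"
        unfolding abs_mult using x M' \<eta>(4) by (intro mult_mono) auto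
      ultimately show ?thesis by linarith
    qed
    show "(\<lambda>n. \<eta>' n x * f x + f' x * \<eta> n x) \<longlonglongrightarrow> f' x" if x: "x \<in> {a<..<b}" for x
      using tendsto_add[OF tendsto_mult[OF \<eta>(6)[OF x] tendsto_const[of "f x"]] tendsto_mult[OF tendsto_const[of "f' x"] \<eta>(5)[OF x]]]
      by simp
  qed (intro continuous_intros ct)+
  have "\<Phi> (\<lambda>x. \<eta>' n x * f x + f' x * \<eta> n x) = \<Psi> (\<lambda>x. \<eta> n x * f x)" for n
    by (rule eq[OF smooth_supp_mult[OF \<eta>(1) f(1)] DERIV_mult[OF \<eta>(2) f(2)]])
  then show ?thesis using 1 2 LIMSEQ_unique by simp
qed

section \<open>Tensor products as test functions\<close>

definition tensor :: "(real \<Rightarrow> real) \<Rightarrow> (real \<Rightarrow> real) \<Rightarrow> real \<times> real \<Rightarrow> real"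
  where "tensor A B p = A (fst p) * B (snd p)"

abbreviation plate_pairing ::
    "real \<Rightarrow> (real \<times> real \<Rightarrow> real) \<Rightarrow> (real \<Rightarrow> real) \<Rightarrow> (real \<Rightarrow> real) \<Rightarrow> real"
  where "plate_pairing l v A B \<equiv> LINT p:plate l|lborel. v p * tensor A B p"

lemma tensor_has_derivative:
  assumes "\<And>x. (A has_real_derivative A' x) (at x)" "\<And>x. (B has_real_derivative B' x) (at x)"
  shows "(tensor A B has_derivative (\<lambda>h. fst h * tensor A' B p + snd h * tensor A B' p)) (at p)"
proof -
  have A: "((\<lambda>p. A (fst p)) has_derivative (\<lambda>h. fst h * A' (fst p))) (at p)"
    using has_derivative_compose[OF has_derivative_fst[OF has_derivative_ident] assms(1)[unfolded has_field_derivative_def], of p]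
    by (simp add: mult.commute)
  have B: "((\<lambda>p. B (snd p)) has_derivative (\<lambda>h. snd h * B' (snd p))) (at p)"
    using has_derivative_compose[OF has_derivative_snd[OF has_derivative_ident] assms(2)[unfolded has_field_derivative_def], of p]
    by (simp add: mult.commute)
  have "((\<lambda>p. A (fst p) * B (snd p)) has_derivative (\<lambda>h. fst h * tensor A' B p + snd h * tensor A B' p)) (at p)"
    using has_derivative_mult[OF A B] by (rule has_derivative_eq_rhs) (simp add: tensor_def algebra_simps)
  then show ?thesis unfolding tensor_def[abs_def] by simp
qed

lemma pderiv_tensor:
  assumes "\<And>x. (A has_real_derivative A' x) (at x)" "\<And>x. (B has_real_derivative B' x) (at x)"
  shows "pderiv_dir (1, 0) (tensor A B) = tensor A' B" "pderiv_dir (0, 1) (tensor A B) = tensor A B'"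
  unfolding pderiv_dir_def
  using frechet_derivative_at[OF tensor_has_derivative[OF assms], symmetric] by (auto simp: fun_eq_iff)

lemma continuous_on_tensor:
  assumes "continuous_on UNIV A" "continuous_on UNIV B"
  shows "continuous_on S (tensor A B)"
  unfolding tensor_def[abs_def]
  by (intro continuous_intros continuous_on_compose2[OF assms(1)] continuous_on_compose2[OF assms(2)]) auto

lemma C_k_tensor: "Ck_real k A \<Longrightarrow> Ck_real k B \<Longrightarrow> C_k k (tensor A B)"
proof (induction k arbitrary: A B)
  case 0
  then show ?case by (simp add: continuous_on_tensor)
next
  case (Suc k)
  obtain A' where A': "\<And>x. (A has_real_derivative A' x) (at x)" "Ck_real k A'"
    using Suc.prems(1) by (rule Ck_real_SucE) blast
  obtain B' where B': "\<And>x. (B has_real_derivative B' x) (at x)" "Ck_real k B'"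
    using Suc.prems(2) by (rule Ck_real_SucE) blast
  have "tensor A B differentiable at p" for p
    using tensor_has_derivative[OF A'(1) B'(1)] unfolding differentiable_def by blast
  then show ?case
    using Suc.IH[OF A'(2) Ck_real_SucD[OF Suc.prems(2)]] Suc.IH[OF Ck_real_SucD[OF Suc.prems(1)] B'(2)]
    by (simp add: pderiv_tensor[OF A'(1) B'(1)])
qed

lemma tensor_test_fun:
  assumes "smooth_supp a b A" "smooth_supp a' b' B"
  shows "tensor A B \<in> test_fun ({a<..<b} \<times> {a'<..<b'})"
proof -
  obtain c d where c: "a < c" "d < b" "\<And>x. x \<notin> {c..d} \<Longrightarrow> A x = 0"
    using assms(1) unfolding smooth_supp_def by auto
  obtain c' d' where c': "a' < c'" "d' < b'" "\<And>x. x \<notin> {c'..d'} \<Longrightarrow> B x = 0"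
    using assms(2) unfolding smooth_supp_def by auto
  have sub: "closure {p. tensor A B p \<noteq> 0} \<subseteq> {c..d} \<times> {c'..d'}"
  proof (rule closure_minimal)
    show "{p. tensor A B p \<noteq> 0} \<subseteq> {c..d} \<times> {c'..d'}"
      using c(3) c'(3) by (auto simp: tensor_def) force+
  qed (intro closed_Times closed_real_atLeastAtMost)
  have "compact ({c..d} \<times> {c'..d'})" by (intro compact_Times) auto
  then have "compact (closure {p. tensor A B p \<noteq> 0})"
    using sub by (metis closed_closure compact_Int_closed inf.absorb_iff2)
  moreover have "{c..d} \<times> {c'..d'} \<subseteq> {a<..<b} \<times> {a'<..<b'}"
    using c(1,2) c'(1,2) by auto
  moreover have "C_k k (tensor A B)" for k
    using smooth_supp_smooth[OF assms(1)] smooth_supp_smooth[OF assms(2)] by (intro C_k_tensor) (auto simp: smooth_def)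
  ultimately show ?thesis using sub unfolding test_fun_def by blast
qed

lemma plate_sets [measurable]: "plate l \<in> sets borel"
  unfolding plate_def by (intro borel_open open_Times open_greaterThanLessThan)

lemma closure_plate: "0 < l \<Longrightarrow> closure (plate l) = {0..pi} \<times> {-l..l}"
  unfolding plate_def by (simp add: closure_Times)

lemma set_integrable_plate_continuous:
  fixes f :: "real \<times> real \<Rightarrow> real"
  assumes "0 < l" "continuous_on (closure (plate l)) f"
  shows "set_integrable lborel (plate l) f"
proof -
  have "compact (closure (plate l))" unfolding closure_plate[OF assms(1)] by (intro compact_Times) auto
  from borel_integrable_compact[OF this assms(2)] have "set_integrable lborel (closure (plate l)) f"
    unfolding set_integrable_def .
  then show ?thesis by (rule set_integrable_subset) (auto simp: closure_subset)
qed

lemma set_integrable_plate_L2: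
  assumes "0 < l" "v \<in> L2 (plate l)"
  shows "set_integrable lborel (plate l) v"
proof -
  have m: "set_borel_measurable lborel (plate l) v" and i: "set_integrable lborel (plate l) (\<lambda>p. (v p)\<^sup>2)"
    using assms(2) by (auto simp: L2_def)
  have "set_integrable lborel (plate l) (\<lambda>p. 1 + (v p)\<^sup>2)"
    by (intro set_integral_add i set_integrable_plate_continuous[OF assms(1)] continuous_on_const)
  then show ?thesis
    unfolding set_integrable_def
  proof (rule Bochner_Integration.integrable_bound)
    show "(\<lambda>x. indicator (plate l) x *\<^sub>R v x) \<in> borel_measurable lborel"
      using m by (simp add: set_borel_measurable_def)
    have "\<bar>t\<bar> \<le> 1 + t\<^sup>2" for t :: real
    proof -
      have "0 \<le> (\<bar>t\<bar> - 1)\<^sup>2" by simp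
      then have "2 * \<bar>t\<bar> \<le> 1 + t\<^sup>2" by (simp add: power2_diff)
      then show ?thesis by linarith
    qed
    then show "AE x in lborel. norm (indicator (plate l) x *\<^sub>R v x) \<le> norm (indicator (plate l) x *\<^sub>R (1 + (v x)\<^sup>2))"
      by (auto simp: indicator_def)
  qed
qed

lemma set_integrable_mult_bounded:
  fixes v k :: "real \<times> real \<Rightarrow> real"
  assumes v: "set_integrable lborel S v" and k: "k \<in> borel_measurable borel" "\<And>p. p \<in> S \<Longrightarrow> \<bar>k p\<bar> \<le> C"
  shows "set_integrable lborel S (\<lambda>p. v p * k p)"
proof -
  have "integrable lborel (\<lambda>p. C *\<^sub>R (indicator S p *\<^sub>R v p))"
    using v unfolding set_integrable_def by (rule integrable_scaleR_right)
  then show ?thesis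
    unfolding set_integrable_def
  proof (rule Bochner_Integration.integrable_bound)
    have [measurable]: "(\<lambda>p. indicator S p *\<^sub>R v p) \<in> borel_measurable lborel"
      using v unfolding set_integrable_def by (rule borel_measurable_integrable)
    have [measurable]: "k \<in> borel_measurable lborel" using k(1) by simp
    have "(\<lambda>p. (indicator S p *\<^sub>R v p) * k p) \<in> borel_measurable lborel" by measurable
    then show "(\<lambda>p. indicator S p *\<^sub>R (v p * k p)) \<in> borel_measurable lborel"
      by (simp add: mult.assoc)
    have "norm (indicator S p *\<^sub>R (v p * k p)) \<le> norm (C *\<^sub>R (indicator S p *\<^sub>R v p))" for p
    proof (cases "p \<in> S")
      case True
      then have "\<bar>v p\<bar> * \<bar>k p\<bar> \<le> \<bar>v p\<bar> * \<bar>C\<bar>" using k(2)[OF True] by (intro mult_left_mono) auto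
      then show ?thesis using True by (simp add: abs_mult mult.commute)
    qed simp
    then show "AE p in lborel. norm (indicator S p *\<^sub>R (v p * k p)) \<le> norm (C *\<^sub>R (indicator S p *\<^sub>R v p))"
      by simp
  qed
qed

lemma set_integral_bounded_convergence:
  fixes v g :: "real \<times> real \<Rightarrow> real"
  assumes v: "set_integrable lborel S v" and k: "\<And>n. k n \<in> borel_measurable borel" "g \<in> borel_measurable borel"
    and b: "\<And>n p. p \<in> S \<Longrightarrow> \<bar>k n p\<bar> \<le> C" and lim: "\<And>p. p \<in> S \<Longrightarrow> (\<lambda>n. k n p) \<longlonglongrightarrow> g p"
  shows "(\<lambda>n. LINT p:S|lborel. v p * k n p) \<longlonglongrightarrow> (LINT p:S|lborel. v p * g p)"
  unfolding set_lebesgue_integral_def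
proof (rule integral_dominated_convergence[where w = "\<lambda>p. C *\<^sub>R \<bar>indicator S p *\<^sub>R v p\<bar>"])
  have [measurable]: "(\<lambda>p. indicator S p *\<^sub>R v p) \<in> borel_measurable lborel"
    using v unfolding set_integrable_def by (rule borel_measurable_integrable)
  have [measurable]: "k n \<in> borel_measurable lborel" "g \<in> borel_measurable lborel" for n using k by simp_all
  have "(\<lambda>p. (indicator S p *\<^sub>R v p) * k n p) \<in> borel_measurable lborel" for n by measurable
  then show "(\<lambda>p. indicator S p *\<^sub>R (v p * k n p)) \<in> borel_measurable lborel" for n
    by (simp add: mult.assoc)
  have "(\<lambda>p. (indicator S p *\<^sub>R v p) * g p) \<in> borel_measurable lborel" by measurable
  then show "(\<lambda>p. indicator S p *\<^sub>R (v p * g p)) \<in> borel_measurable lborel"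
    by (simp add: mult.assoc)
  show "integrable lborel (\<lambda>p. C *\<^sub>R \<bar>indicator S p *\<^sub>R v p\<bar>)"
    using v unfolding set_integrable_def by (intro integrable_scaleR_right integrable_abs)
  have "(\<lambda>n. indicator S p *\<^sub>R (v p * k n p)) \<longlonglongrightarrow> indicator S p *\<^sub>R (v p * g p)" for p
    using lim[of p] by (cases "p \<in> S") (auto intro!: tendsto_intros)
  then show "AE p in lborel. (\<lambda>n. indicator S p *\<^sub>R (v p * k n p)) \<longlonglongrightarrow> indicator S p *\<^sub>R (v p * g p)"
    by simp
  have "norm (indicator S p *\<^sub>R (v p * k n p)) \<le> C *\<^sub>R \<bar>indicator S p *\<^sub>R v p\<bar>" for p n
  proof (cases "p \<in> S")
    case True
    have "\<bar>v p\<bar> * \<bar>k n p\<bar> \<le> \<bar>v p\<bar> * C" using b[OF True] by (intro mult_left_mono) auto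
    then show ?thesis using True by (simp add: abs_mult mult.commute)
  qed simp
  then show "AE p in lborel. norm (indicator S p *\<^sub>R (v p * k n p)) \<le> C *\<^sub>R \<bar>indicator S p *\<^sub>R v p\<bar>" for n
    by simp
qed

lemma dct_functional_tensor:
  assumes l: "0 < l" and v: "set_integrable lborel (plate l) v"
  shows "continuous_on UNIV B \<Longrightarrow> dct_functional 0 pi (\<lambda>A. plate_pairing l v A B)"
    and "continuous_on UNIV A \<Longrightarrow> dct_functional (-l) l (\<lambda>B. plate_pairing l v A B)"
proof -
  assume B: "continuous_on UNIV B"
  obtain M where M: "\<And>x. x \<in> {-l..l} \<Longrightarrow> \<bar>B x\<bar> \<le> M" "0 \<le> M"
    using continuous_bounded_on[OF B] by metis
  show "dct_functional 0 pi (\<lambda>A. plate_pairing l v A B)"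
    unfolding dct_functional_def
  proof (intro allI impI)
    fix f g and C :: real
    assume f: "\<forall>n. continuous_on UNIV (f n)" "continuous_on UNIV g" "\<forall>n. \<forall>x\<in>{0<..<pi}. \<bar>f n x\<bar> \<le> C"
      "\<forall>x\<in>{0<..<pi}. (\<lambda>n. f n x) \<longlonglongrightarrow> (g x :: real)"
    show "(\<lambda>n. plate_pairing l v (f n) B) \<longlonglongrightarrow> plate_pairing l v g B"
    proof (rule set_integral_bounded_convergence[OF v, where C = "C * M"])
      show "tensor (f n) B \<in> borel_measurable borel" "tensor g B \<in> borel_measurable borel" for n
        using f(1,2) B by (auto intro!: borel_measurable_continuous_onI continuous_on_tensor)
      show "\<bar>tensor (f n) B p\<bar> \<le> C * M" if "p \<in> plate l" for n p
        unfolding tensor_def abs_mult using that f(3) M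
        by (intro mult_mono) (auto simp: plate_def intro: order_trans[OF abs_ge_zero])
      show "(\<lambda>n. tensor (f n) B p) \<longlonglongrightarrow> tensor g B p" if "p \<in> plate l" for p
        unfolding tensor_def using that f(4) by (intro tendsto_intros) (auto simp: plate_def)
    qed
  qed
next
  assume A: "continuous_on UNIV A"
  obtain M where M: "\<And>x. x \<in> {0..pi} \<Longrightarrow> \<bar>A x\<bar> \<le> M" "0 \<le> M"
    using continuous_bounded_on[OF A] by metis
  show "dct_functional (-l) l (\<lambda>B. plate_pairing l v A B)"
    unfolding dct_functional_def
  proof (intro allI impI)
    fix f g and C :: real
    assume f: "\<forall>n. continuous_on UNIV (f n)" "continuous_on UNIV g" "\<forall>n. \<forall>x\<in>{-l<..<l}. \<bar>f n x\<bar> \<le> C"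
      "\<forall>x\<in>{-l<..<l}. (\<lambda>n. f n x) \<longlonglongrightarrow> (g x :: real)"
    show "(\<lambda>n. plate_pairing l v A (f n)) \<longlonglongrightarrow> plate_pairing l v A g"
    proof (rule set_integral_bounded_convergence[OF v, where C = "M * C"])
      show "tensor A (f n) \<in> borel_measurable borel" "tensor A g \<in> borel_measurable borel" for n
        using f(1,2) A by (auto intro!: borel_measurable_continuous_onI continuous_on_tensor)
      show "\<bar>tensor A (f n) p\<bar> \<le> M * C" if "p \<in> plate l" for n p
        unfolding tensor_def abs_mult using that f(3) M
        by (intro mult_mono) (auto simp: plate_def intro: order_trans[OF abs_ge_zero])
      show "(\<lambda>n. tensor A (f n) p) \<longlonglongrightarrow> tensor A g p" if "p \<in> plate l" for p
        unfolding tensor_def using that f(4) by (intro tendsto_intros) (auto simp: plate_def)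
    qed
  qed
qed

lemma weak_partial_tensor:
  assumes "weak_partial (plate l) i j u v" "smooth_supp 0 pi A" "smooth_supp (-l) l B"
  shows "(LINT p:plate l|lborel. u p * partial i j (tensor A B) p) = (-1) ^ (i + j) * plate_pairing l v A B"
  using assms tensor_test_fun[OF assms(2,3)] unfolding weak_partial_def plate_def by blast

lemma partial_tensor:
  assumes A: "\<And>x. (A has_real_derivative A' x) (at x)" "\<And>x. (A' has_real_derivative A'' x) (at x)"
    and B: "\<And>x. (B has_real_derivative B' x) (at x)" "\<And>x. (B' has_real_derivative B'' x) (at x)"
  shows "partial 0 0 (tensor A B) = tensor A B"
    "partial 1 0 (tensor A B) = tensor A' B" "partial 0 1 (tensor A B) = tensor A B'"
    "partial 2 0 (tensor A B) = tensor A'' B" "partial 1 1 (tensor A B) = tensor A' B'" "partial 0 2 (tensor A B) = tensor A B''"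
  unfolding partial_def
  by (simp_all add: eval_nat_numeral pderiv_tensor[OF A(1) B(1)] pderiv_tensor[OF A(2) B(1)] pderiv_tensor[OF A(1) B(2)])

lemma weak_partial_wD:
  assumes "u \<in> H2 \<Omega>" "i + j \<le> 2"
  shows "weak_partial \<Omega> i j u (wD \<Omega> i j u)"
proof -
  have "\<exists>v. weak_partial \<Omega> i j u v" using assms unfolding H2_def by blast
  then show ?thesis unfolding wD_def by (rule someI_ex)
qed

text \<open>A' and B' have compact support again and may serve as test factors. So
  \<open>D 1 0 u\<close> against A' and \<open>D 2 0 u\<close> against A both reduce to u against
  A'', which links weak derivatives of consecutive orders.\<close>

lemma weak_pairings:
  assumes u: "u \<in> H2 (plate l)" and A: "smooth_supp 0 pi A" "\<And>x. (A has_real_derivative A' x) (at x)"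
    and B: "smooth_supp (-l) l B" "\<And>x. (B has_real_derivative B' x) (at x)"
  defines "D \<equiv> wD (plate l)"
  shows "plate_pairing l u A' B = - plate_pairing l (D 1 0 u) A B"
    and "plate_pairing l u A B' = - plate_pairing l (D 0 1 u) A B"
    and "plate_pairing l u A' B' = plate_pairing l (D 1 1 u) A B"
    and "plate_pairing l (D 1 0 u) A' B = - plate_pairing l (D 2 0 u) A B"
    and "plate_pairing l (D 0 1 u) A B' = - plate_pairing l (D 0 2 u) A B"
proof -
  have A'c: "smooth_supp 0 pi A'" by (rule smooth_supp_deriv[OF A])
  have B'c: "smooth_supp (-l) l B'" by (rule smooth_supp_deriv[OF B])
  obtain A'' where A'': "\<And>x. (A' has_real_derivative A'' x) (at x)"
    by (rule smooth_deriv_ex[OF smooth_supp_smooth[OF A'c]]) blast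
  obtain B'' where B'': "\<And>x. (B' has_real_derivative B'' x) (at x)"
    by (rule smooth_deriv_ex[OF smooth_supp_smooth[OF B'c]]) blast
  obtain A3 where A3: "\<And>x. (A'' has_real_derivative A3 x) (at x)"
    by (rule smooth_deriv_ex[OF smooth_derivative[OF smooth_supp_smooth[OF A'c] A'']]) blast
  obtain B3 where B3: "\<And>x. (B'' has_real_derivative B3 x) (at x)"
    by (rule smooth_deriv_ex[OF smooth_derivative[OF smooth_supp_smooth[OF B'c] B'']]) blast
  note p = partial_tensor[OF A(2) A'' B(2) B'']
  note pA = partial_tensor[OF A'' A3 B(2) B'']
  note pB = partial_tensor[OF A(2) A'' B'' B3]
  note w = weak_partial_wD[OF u, folded D_def]
  show 1: "plate_pairing l u A' B = - plate_pairing l (D 1 0 u) A B"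
    using weak_partial_tensor[OF w[of 1 0] A(1) B(1)] unfolding p by simp
  show 2: "plate_pairing l u A B' = - plate_pairing l (D 0 1 u) A B"
    using weak_partial_tensor[OF w[of 0 1] A(1) B(1)] unfolding p by simp
  show "plate_pairing l u A' B' = plate_pairing l (D 1 1 u) A B"
    using weak_partial_tensor[OF w[of 1 1] A(1) B(1)] unfolding p by simp
  show "plate_pairing l (D 1 0 u) A' B = - plate_pairing l (D 2 0 u) A B"
    using weak_partial_tensor[OF w[of 1 0] A'c B(1)] weak_partial_tensor[OF w[of 2 0] A(1) B(1)] unfolding p pA by simp
  show "plate_pairing l (D 0 1 u) A B' = - plate_pairing l (D 0 2 u) A B"
    using weak_partial_tensor[OF w[of 0 1] A(1) B'c] weak_partial_tensor[OF w[of 0 2] A(1) B(1)] unfolding p pB by simp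
qed

text \<open>No rate of decay of u at the hinged sides is known, only continuity. This suffices: the
  integrand is of order n on two strips of area of order 1 / n, and on them |u| \<le> \<epsilon>
  eventually, by uniform continuity.\<close>

lemma boundary_layer_tendsto_0:
  fixes u :: "real \<times> real \<Rightarrow> real"
  assumes l: "0 < l" and u: "continuous_on (closure (plate l)) u" "\<And>q. q \<in> {0, pi} \<times> {-l<..<l} \<Longrightarrow> u q = 0"
    and A: "continuous_on UNIV A" and B: "continuous_on UNIV B" and c: "\<And>n. continuous_on UNIV (\<eta>' n)"
    and K: "\<And>n x. \<bar>\<eta>' n x\<bar> \<le> K * real (Suc n)"
    and supp: "\<And>n x. x \<in> {0<..<pi} \<Longrightarrow> \<eta>' n x \<noteq> 0 \<Longrightarrow> x - 0 \<le> 2 / real (Suc n) \<or> pi - x \<le> 2 / real (Suc n)"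
  shows "(\<lambda>n. plate_pairing l u (\<lambda>x. \<eta>' n x * A x) B) \<longlonglongrightarrow> 0"
proof -
  obtain MA where MA: "\<And>x. x \<in> {0..pi} \<Longrightarrow> \<bar>A x\<bar> \<le> MA" "0 \<le> MA"
    using continuous_bounded_on[OF A] by metis
  obtain MB where MB: "\<And>x. x \<in> {-l..l} \<Longrightarrow> \<bar>B x\<bar> \<le> MB" "0 \<le> MB"
    using continuous_bounded_on[OF B] by metis
  have K0: "0 \<le> K" using K[of 0 0] abs_ge_zero[of "\<eta>' 0 0"] by simp
  \<comment> \<open>The factor 8 l is what remains of two strips of area 2 / (n + 1) times 2 l,
    multiplied by the factor n + 1 of the cutoff derivative.\<close>
  define M where "M = K * MA * MB * (8 * l)"
  have M0: "0 \<le> M" using K0 MA MB l by (simp add: M_def)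
  have bound: "\<forall>\<^sub>F n in sequentially. \<bar>LINT p:plate l|lborel. u p * tensor (\<lambda>x. \<eta>' n x * A x) B p\<bar> \<le> \<epsilon> * M"
    if \<epsilon>: "0 < \<epsilon>" for \<epsilon>
  proof -
    have "compact (closure (plate l))" unfolding closure_plate[OF l] by (intro compact_Times) auto
    then have "uniformly_continuous_on (closure (plate l)) u"
      using u(1) compact_uniformly_continuous by blast
    then obtain \<delta> where \<delta>: "0 < \<delta>"
      "\<And>p q. p \<in> closure (plate l) \<Longrightarrow> q \<in> closure (plate l) \<Longrightarrow> dist q p < \<delta> \<Longrightarrow> dist (u q) (u p) < \<epsilon>"
      using \<epsilon> unfolding uniformly_continuous_on_def by metis
    have "(\<lambda>n. 2 / real (Suc n)) \<longlonglongrightarrow> 0" by (rule LIMSEQ_Suc[OF lim_const_over_n])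
    then have "\<forall>\<^sub>F n in sequentially. 2 / real (Suc n) < \<delta>" using \<delta>(1) by (rule order_tendstoD)
    moreover have "(\<lambda>n. 2 / real (Suc n)) \<longlonglongrightarrow> 0" by (rule LIMSEQ_Suc[OF lim_const_over_n])
    then have "\<forall>\<^sub>F n in sequentially. 2 / real (Suc n) < pi" using pi_gt_zero by (rule order_tendstoD)
    ultimately show ?thesis
    proof eventually_elim
      case (elim n)
      define t where "t = 2 / real (Suc n)"
      have t: "0 < t" "t < \<delta>" "t < pi" using elim by (auto simp: t_def)
      define R1 R2 where R: "R1 = cbox (0::real, -l) (t, l)" "R2 = cbox (pi - t, -l) (pi, l)"
      define c where "c = \<epsilon> * (K * real (Suc n)) * MA * MB"
      have small: "\<bar>u (x, y)\<bar> \<le> \<epsilon>" if "(x, y) \<in> plate l" "x \<le> t \<or> pi - x \<le> t" for x y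
      proof -
        have xy: "0 < x" "x < pi" "-l < y" "y < l" using that(1) by (auto simp: plate_def)
        show ?thesis
        proof (cases "x \<le> t")
          case True
          have "dist (u (x, y)) (u (0, y)) < \<epsilon>"
            by (rule \<delta>(2)) (use xy True t in \<open>auto simp: closure_plate[OF l] dist_Pair_Pair dist_real_def\<close>)
          then show ?thesis using u(2)[of "(0, y)"] xy by (simp add: dist_real_def)
        next
          case False
          have "dist (u (x, y)) (u (pi, y)) < \<epsilon>"
            by (rule \<delta>(2)) (use xy False that(2) t in \<open>auto simp: closure_plate[OF l] dist_Pair_Pair dist_real_def\<close>)
          then show ?thesis using u(2)[of "(pi, y)"] xy by (simp add: dist_real_def)
        qed
      qed
      let ?F = "\<lambda>p. indicator (plate l) p *\<^sub>R (u p * tensor (\<lambda>x. \<eta>' n x * A x) B p)"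
      have Fi: "integrable lborel ?F"
        using set_integrable_plate_continuous[OF l, of "\<lambda>p. u p * tensor (\<lambda>x. \<eta>' n x * A x) B p"]
        unfolding set_integrable_def
        by (auto intro!: continuous_intros u(1) continuous_on_tensor c A B)
      have c0: "0 \<le> c" unfolding c_def using \<epsilon> K0 MA MB by simp
      have le: "norm (?F p) \<le> c * (indicator R1 p + indicator R2 p)" for p
      proof (cases "p \<in> plate l \<and> \<eta>' n (fst p) \<noteq> 0")
        case True
        obtain x y where p: "p = (x, y)" by (cases p)
        have xy: "0 < x" "x < pi" "-l < y" "y < l" using True by (auto simp: plate_def p)
        have near: "x \<le> t \<or> pi - x \<le> t" using supp[of x n] True xy by (auto simp: p t_def)
        have "norm (?F p) = \<bar>u p\<bar> * \<bar>\<eta>' n x\<bar> * \<bar>A x\<bar> * \<bar>B y\<bar>"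
          using True by (simp add: p tensor_def abs_mult)
        also have "\<dots> \<le> c"
          unfolding c_def using small[of x y] near True K[of n x] MA(1)[of x] MB(1)[of y] xy K0 \<epsilon> MA(2) MB(2)
          by (intro mult_mono mult_nonneg_nonneg) (auto simp: p)
        also have "\<dots> \<le> c * (indicator R1 p + indicator R2 p)"
          using near xy c0 unfolding R p by (auto simp: indicator_def cbox_Pair_eq)
        finally show ?thesis .
      next
        case False
        then have F0: "?F p = 0" by (auto simp: tensor_def)
        show ?thesis unfolding F0 using c0 by simp
      qed
      have Ri: "integrable lborel (indicator R1 :: _ \<Rightarrow> real)" "integrable lborel (indicator R2 :: _ \<Rightarrow> real)"
        unfolding R by (auto intro!: integrable_real_indicator simp del: infinity_ennreal_def simp: emeasure_lborel_cbox_finite)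
      have m: "measure lborel R1 = t * (2 * l)" "measure lborel R2 = t * (2 * l)"
        unfolding R using t l by (simp_all add: content_Pair)
      have "\<bar>LINT p:plate l|lborel. u p * tensor (\<lambda>x. \<eta>' n x * A x) B p\<bar> \<le> (LINT p|lborel. norm (?F p))"
        unfolding set_lebesgue_integral_def using integral_norm_bound[of lborel ?F] by simp
      also have "\<dots> \<le> (LINT p|lborel. c * (indicator R1 p + indicator R2 p))"
        by (intro integral_mono integrable_norm Fi integrable_mult_right Bochner_Integration.integrable_add Ri le)
      also have "\<dots> = c * (measure lborel R1 + measure lborel R2)"
        using Ri by (simp add: R)
      also have "\<dots> = \<epsilon> * M"
        unfolding m c_def M_def t_def by (simp add: field_simps del: of_nat_Suc)
      finally show ?case .
    qed
  qed
  show ?thesis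
  proof (rule tendstoI)
    fix e :: real assume e: "0 < e"
    have "\<forall>\<^sub>F n in sequentially. \<bar>LINT p:plate l|lborel. u p * tensor (\<lambda>x. \<eta>' n x * A x) B p\<bar> \<le> e / (M + 1) * M"
      using e M0 by (intro bound) simp
    moreover have "e / (M + 1) * M < e" using e M0 by (simp add: field_simps)
    ultimately show "\<forall>\<^sub>F n in sequentially. dist (plate_pairing l u (\<lambda>x. \<eta>' n x * A x) B) 0 < e"
      by (auto elim!: eventually_mono)
  qed
qed

text \<open>The counterpart of \<open>cutoff_removal_deriv\<close> for functions f that do not
  vanish at 0 and pi, such as cos (m x): the zero boundary values of u take over.\<close>

lemma cutoff_removal_trace:
  fixes u :: "real \<times> real \<Rightarrow> real"
  assumes l: "0 < l" and u: "continuous_on (closure (plate l)) u" "\<And>q. q \<in> {0, pi} \<times> {-l<..<l} \<Longrightarrow> u q = 0"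
    and B: "continuous_on UNIV B" and \<Psi>: "dct_functional 0 pi \<Psi>"
    and eq: "\<And>A A'. smooth_supp 0 pi A \<Longrightarrow> (\<And>x. (A has_real_derivative A' x) (at x)) \<Longrightarrow>
      plate_pairing l u A' B = \<Psi> A"
    and f: "smooth f" "\<And>x. (f has_real_derivative f' x) (at x)"
  shows "plate_pairing l u f' B = \<Psi> f"
proof -
  obtain \<eta> \<eta>' K where \<eta>: "\<And>n. smooth_supp 0 pi (\<eta> n)" "\<And>n x. (\<eta> n has_real_derivative \<eta>' n x) (at x)"
    "\<And>n. continuous_on UNIV (\<eta>' n)" "\<And>n x. \<bar>\<eta> n x\<bar> \<le> 1"
    "\<And>x. x \<in> {0<..<pi} \<Longrightarrow> (\<lambda>n. \<eta> n x) \<longlonglongrightarrow> (1::real)"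
    "\<And>n x. \<bar>\<eta>' n x\<bar> \<le> K * real (Suc n)"
    "\<And>n x. x \<in> {0<..<pi} \<Longrightarrow> \<eta>' n x \<noteq> 0 \<Longrightarrow> x - 0 \<le> 2 / real (Suc n) \<or> pi - x \<le> 2 / real (Suc n)"
    by (rule cutoff_exists[of 0 pi]) blast
  define \<Phi> where "\<Phi> = (\<lambda>A. plate_pairing l u A B)"
  have ui: "set_integrable lborel (plate l) u" by (rule set_integrable_plate_continuous[OF l u(1)])
  have \<Phi>: "dct_functional 0 pi \<Phi>" unfolding \<Phi>_def by (rule dct_functional_tensor(1)[OF l ui B])
  have sf': "smooth f'" by (rule smooth_derivative[OF f])
  note lim = cutoff_approximation[OF _ _ \<eta>(1,4,5)]
  have "(\<lambda>n. \<Phi> (\<lambda>x. \<eta>' n x * f x)) \<longlonglongrightarrow> 0"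
    unfolding \<Phi>_def
    by (rule boundary_layer_tendsto_0[OF l u smooth_continuous[OF f(1)] B \<eta>(3) \<eta>(6) \<eta>(7)])
  then have "(\<lambda>n. \<Phi> (\<lambda>x. \<eta>' n x * f x) + \<Phi> (\<lambda>x. \<eta> n x * f' x)) \<longlonglongrightarrow> 0 + \<Phi> f'"
    by (rule tendsto_add[OF _ lim[OF \<Phi> sf']])
  moreover have "\<Phi> (\<lambda>x. \<eta>' n x * f x) + \<Phi> (\<lambda>x. \<eta> n x * f' x) = \<Psi> (\<lambda>x. \<eta> n x * f x)" for n
  proof -
    have "set_integrable lborel (plate l) (\<lambda>p. u p * tensor (\<lambda>x. \<eta>' n x * f x) B p)"
      "set_integrable lborel (plate l) (\<lambda>p. u p * tensor (\<lambda>x. \<eta> n x * f' x) B p)"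
      by (intro set_integrable_plate_continuous[OF l] continuous_intros u(1) continuous_on_tensor B
          smooth_continuous f(1) sf' smooth_supp_smooth[OF \<eta>(1)] \<eta>(3))+
    from set_integral_add(2)[OF this]
    have "\<Phi> (\<lambda>x. \<eta>' n x * f x) + \<Phi> (\<lambda>x. \<eta> n x * f' x) = \<Phi> (\<lambda>x. \<eta>' n x * f x + f' x * \<eta> n x)"
      unfolding \<Phi>_def by (simp add: tensor_def algebra_simps)
    also have "\<dots> = \<Psi> (\<lambda>x. \<eta> n x * f x)"
      unfolding \<Phi>_def by (rule eq[OF smooth_supp_mult[OF \<eta>(1) f(1)] DERIV_mult[OF \<eta>(2) f(2)]])
    finally show ?thesis .
  qed
  ultimately have "(\<lambda>n. \<Psi> (\<lambda>x. \<eta> n x * f x)) \<longlonglongrightarrow> \<Phi> f'" by simp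
  then show ?thesis
    using lim[OF \<Psi> f(1)] LIMSEQ_unique unfolding \<Phi>_def by blast
qed

lemma dct_functional_cmult: "dct_functional a b \<Phi> \<Longrightarrow> dct_functional a b (\<lambda>f. c * \<Phi> f)"
  unfolding dct_functional_def by (intro allI impI tendsto_mult_left) blast

section \<open>Pairing with a mode\<close>

lemma set_integral_tens_scale:
  "(LINT p:S|lborel. v p * tensor (\<lambda>x. c * A x) B p) = c * (LINT p:S|lborel. v p * tensor A B p)"
  by (simp add: tensor_def mult.assoc mult.left_commute[of _ c])

lemma wD_integrable:
  assumes "0 < l" "u \<in> H2 (plate l)" "i + j \<le> 2"
  shows "set_integrable lborel (plate l) (wD (plate l) i j u)"
  using weak_partial_wD[OF assms(2,3)] set_integrable_plate_L2[OF assms(1)] unfolding weak_partial_def by blast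

text \<open>Testing with \<open>sin (m x) B(y)\<close>, where \<open>B\<close> need not have compact support. In the mixed
  derivative one integrates back in \<open>y\<close> before the cutoff in \<open>y\<close> is removed, so that no boundary
  term on \<open>y = \<plusminus>l\<close> appears.\<close>

context
  fixes l m :: real and u :: "real \<times> real \<Rightarrow> real" and D and s c :: "real \<Rightarrow> real"
  assumes l: "0 < l" and u: "u \<in> H2_star l" and m: "sin (m * pi) = 0"
  defines "D \<equiv> wD (plate l)" and "s \<equiv> \<lambda>x. sin (m * x)" and "c \<equiv> \<lambda>x. cos (m * x)"
begin

lemma mode_H2: "u \<in> H2 (plate l)" and mode_continuous: "continuous_on (closure (plate l)) u"
  and mode_boundary: "q \<in> {0, pi} \<times> {-l<..<l} \<Longrightarrow> u q = 0"
  using u unfolding H2_star_def by auto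

lemma smooth_modes: "smooth s" "smooth c"
  unfolding s_def c_def by (rule smooth_sin smooth_cos)+

lemma mode_deriv: "(s has_real_derivative m * c x) (at x)" "(c has_real_derivative (- m) * s x) (at x)"
  unfolding s_def c_def by (auto intro!: derivative_eq_intros)

lemma mode_ends: "s 0 = 0" "s pi = 0"
  using m by (simp_all add: s_def)

lemma mode_integrable: "set_integrable lborel (plate l) u"
  by (rule set_integrable_plate_continuous[OF l mode_continuous])

lemma mode_wD_integrable: "i + j \<le> 2 \<Longrightarrow> set_integrable lborel (plate l) (D i j u)"
  unfolding D_def by (rule wD_integrable[OF l mode_H2])

lemma dct_functional_x: "set_integrable lborel (plate l) v \<Longrightarrow> continuous_on UNIV B \<Longrightarrow>
    dct_functional 0 pi (\<lambda>A. k * plate_pairing l v A B)"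
  by (intro dct_functional_cmult dct_functional_tensor(1)[OF l])

lemma dct_functional_y: "set_integrable lborel (plate l) v \<Longrightarrow> continuous_on UNIV A \<Longrightarrow>
    dct_functional (-l) l (\<lambda>B. k * plate_pairing l v A B)"
  by (intro dct_functional_cmult dct_functional_tensor(2)[OF l])

text \<open>Two integrations by parts in x. The first differentiates sin (m x), which vanishes at
  the ends; the second differentiates cos (m x), which does not, but there the boundary values of u
  vanish. Both are done for B of compact support, and the cutoff in y is removed last.\<close>

lemma mode_D20:
  assumes B: "smooth B"
  shows "plate_pairing l (D 2 0 u) s B = - m\<^sup>2 * plate_pairing l u s B"
proof -
  have 1: "plate_pairing l (D 2 0 u) s B = - m\<^sup>2 * plate_pairing l u s B"
    if Bc: "smooth_supp (-l) l B" for B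
  proof -
    have cB: "continuous_on UNIV B" by (rule smooth_continuous[OF smooth_supp_smooth[OF Bc]])
    obtain B' where B': "\<And>x. (B has_real_derivative B' x) (at x)"
      by (rule smooth_deriv_ex[OF smooth_supp_smooth[OF Bc]]) blast
    note wp = weak_pairings[OF mode_H2 _ _ Bc B', folded D_def]
    have "1 * plate_pairing l (D 1 0 u) (\<lambda>x. m * c x) B = (-1) * plate_pairing l (D 2 0 u) s B"
      by (rule cutoff_removal_deriv[where a = 0 and b = pi, OF dct_functional_x dct_functional_x _ smooth_modes(1) mode_deriv(1) mode_ends])
        (use mode_wD_integrable cB wp(4) in auto)
    moreover have "plate_pairing l u (\<lambda>x. (- m) * s x) B = (-1) * plate_pairing l (D 1 0 u) c B"
      by (rule cutoff_removal_trace[OF l mode_continuous mode_boundary cB dct_functional_x _ smooth_modes(2) mode_deriv(2)])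
        (use mode_wD_integrable cB wp(1) in auto)
    ultimately have "plate_pairing l (D 2 0 u) s B = - (m * plate_pairing l (D 1 0 u) c B)"
      "plate_pairing l (D 1 0 u) c B = m * plate_pairing l u s B"
      unfolding set_integral_tens_scale by linarith+
    then show ?thesis by (simp add: power2_eq_square)
  qed
  have "1 * plate_pairing l (D 2 0 u) s B = - m\<^sup>2 * plate_pairing l u s B"
    by (rule cutoff_removal[where a = "-l" and b = l, OF dct_functional_y dct_functional_y _ B])
      (use mode_wD_integrable mode_integrable smooth_continuous[OF smooth_modes(1)] 1 in auto)
  then show ?thesis by simp
qed

lemma mode_D11:
  assumes B: "smooth B"
  shows "plate_pairing l (D 1 1 u) c B = m * plate_pairing l (D 0 1 u) s B"
proof -
  have 1: "plate_pairing l (D 1 1 u) c B = m * plate_pairing l (D 0 1 u) s B"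
    if Bc: "smooth_supp (-l) l B" for B
  proof -
    have cB: "continuous_on UNIV B" by (rule smooth_continuous[OF smooth_supp_smooth[OF Bc]])
    obtain B' where B': "\<And>x. (B has_real_derivative B' x) (at x)"
      by (rule smooth_deriv_ex[OF smooth_supp_smooth[OF Bc]]) blast
    have cB': "continuous_on UNIV B'"
      by (rule smooth_continuous[OF smooth_derivative[OF smooth_supp_smooth[OF Bc] B']])
    note wp = weak_pairings[OF mode_H2 _ _ Bc B', folded D_def]
    have "plate_pairing l u (\<lambda>x. (- m) * s x) B' = 1 * plate_pairing l (D 1 1 u) c B"
      by (rule cutoff_removal_trace[OF l mode_continuous mode_boundary cB' dct_functional_x _ smooth_modes(2) mode_deriv(2)])
        (use mode_wD_integrable cB wp(3) in auto)
    moreover have "1 * plate_pairing l u s B' = (-1) * plate_pairing l (D 0 1 u) s B"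
    proof (rule cutoff_removal[where a = 0 and b = pi, OF dct_functional_x dct_functional_x _ smooth_modes(1)])
      fix A assume A: "smooth_supp 0 pi A"
      obtain A' where "\<And>x. (A has_real_derivative A' x) (at x)"
        by (rule smooth_deriv_ex[OF smooth_supp_smooth[OF A]]) blast
      from wp(2)[OF A this]
      show "1 * plate_pairing l u A B' = (-1) * plate_pairing l (D 0 1 u) A B"
        by simp
    qed (use mode_wD_integrable mode_integrable cB cB' in auto)
    ultimately show ?thesis
      unfolding set_integral_tens_scale by simp
  qed
  have "1 * plate_pairing l (D 1 1 u) c B = m * plate_pairing l (D 0 1 u) s B"
    by (rule cutoff_removal[where a = "-l" and b = l, OF dct_functional_y dct_functional_y _ B])
      (use mode_wD_integrable smooth_continuous[OF smooth_modes(1)] smooth_continuous[OF smooth_modes(2)] 1 in auto)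
  then show ?thesis by simp
qed

text \<open>On the free sides nothing is known to vanish on the part of u, so here the boundary
  terms have to be removed by B.\<close>

lemma mode_dy:
  assumes B: "smooth B" "\<And>x. (B has_real_derivative B' x) (at x)" and ends: "B (-l) = 0" "B l = 0"
  shows "plate_pairing l (D 0 2 u) s B = - plate_pairing l (D 0 1 u) s B'"
    and "plate_pairing l (D 0 1 u) s B = - plate_pairing l u s B'"
proof -
  have cs: "continuous_on UNIV s" by (rule smooth_continuous[OF smooth_modes(1)])
  have 1: "1 * plate_pairing l (D 0 1 u) s B' = (-1) * plate_pairing l (D 0 2 u) s B"
    "1 * plate_pairing l u s B' = (-1) * plate_pairing l (D 0 1 u) s B"
    if Bc: "smooth_supp (-l) l B" and B': "\<And>x. (B has_real_derivative B' x) (at x)" for B B'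
  proof -
    have cB: "continuous_on UNIV B" by (rule smooth_continuous[OF smooth_supp_smooth[OF Bc]])
    have cB': "continuous_on UNIV B'"
      by (rule smooth_continuous[OF smooth_derivative[OF smooth_supp_smooth[OF Bc] B']])
    note wp = weak_pairings[OF mode_H2 _ _ Bc B', folded D_def]
    have wpA: "1 * plate_pairing l (D 0 1 u) A B' = (-1) * plate_pairing l (D 0 2 u) A B"
      "1 * plate_pairing l u A B' = (-1) * plate_pairing l (D 0 1 u) A B"
      if A: "smooth_supp 0 pi A" for A
    proof -
      obtain A' where "\<And>x. (A has_real_derivative A' x) (at x)"
        by (rule smooth_deriv_ex[OF smooth_supp_smooth[OF A]]) blast
      from wp(5)[OF A this] wp(2)[OF A this]
      show "1 * plate_pairing l (D 0 1 u) A B' = (-1) * plate_pairing l (D 0 2 u) A B"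
        "1 * plate_pairing l u A B' = (-1) * plate_pairing l (D 0 1 u) A B"
        by simp_all
    qed
    show "1 * plate_pairing l (D 0 1 u) s B' = (-1) * plate_pairing l (D 0 2 u) s B"
      by (rule cutoff_removal[where a = 0 and b = pi, OF dct_functional_x dct_functional_x wpA(1) smooth_modes(1)]) (use mode_wD_integrable cB cB' in auto)
    show "1 * plate_pairing l u s B' = (-1) * plate_pairing l (D 0 1 u) s B"
      by (rule cutoff_removal[where a = 0 and b = pi, OF dct_functional_x dct_functional_x wpA(2) smooth_modes(1)]) (use mode_wD_integrable mode_integrable cB cB' in auto)
  qed
  have "1 * plate_pairing l (D 0 1 u) s B' = (-1) * plate_pairing l (D 0 2 u) s B"
    by (rule cutoff_removal_deriv[where a = "-l" and b = l, OF dct_functional_y dct_functional_y 1(1) B ends]) (use mode_wD_integrable cs in auto)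
  then show "plate_pairing l (D 0 2 u) s B = - plate_pairing l (D 0 1 u) s B'" by simp
  have "1 * plate_pairing l u s B' = (-1) * plate_pairing l (D 0 1 u) s B"
    by (rule cutoff_removal_deriv[where a = "-l" and b = l, OF dct_functional_y dct_functional_y 1(2) B ends]) (use mode_wD_integrable mode_integrable cs in auto)
  then show "plate_pairing l (D 0 1 u) s B = - plate_pairing l u s B'" by simp
qed

lemma D_tens_int:
  assumes "i + j \<le> 2" "smooth A" "smooth B"
  shows "set_integrable lborel (plate l) (\<lambda>p. D i j u p * tensor A B p)"
proof -
  obtain MA where MA: "\<And>x. x \<in> {0..pi} \<Longrightarrow> \<bar>A x\<bar> \<le> MA" "0 \<le> MA"
    using continuous_bounded_on[OF smooth_continuous[OF assms(2)]] by metis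
  obtain MB where MB: "\<And>x. x \<in> {-l..l} \<Longrightarrow> \<bar>B x\<bar> \<le> MB" "0 \<le> MB"
    using continuous_bounded_on[OF smooth_continuous[OF assms(3)]] by metis
  show ?thesis
  proof (rule set_integrable_mult_bounded[OF mode_wD_integrable[OF assms(1)], where C = "MA * MB"])
    show "tensor A B \<in> borel_measurable borel"
      by (intro borel_measurable_continuous_onI continuous_on_tensor smooth_continuous assms)
    show "\<bar>tensor A B p\<bar> \<le> MA * MB" if "p \<in> plate l" for p
      unfolding tensor_def abs_mult using that MA MB by (intro mult_mono) (auto simp: plate_def)
  qed
qed

text \<open>Collecting coefficients leaves \<open>D 2 0 u\<close> against a, \<open>D 0 2 u\<close>
  against b, and the mixed term. The first natural condition says that b vanishes at both ends and
  allows the passage from \<open>D 0 2 u\<close> to \<open>D 0 1 u\<close>. There the mixed term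
  completes -b' to e, which vanishes at both ends by the second natural condition; this allows the
  passage to u. What remains is -m^2 a - e'.\<close>

lemma mode_inner:
  fixes h :: "nat \<Rightarrow> real \<Rightarrow> real"
  assumes h: "\<And>i y. i < 4 \<Longrightarrow> (h i has_real_derivative h (Suc i) y) (at y)" "smooth (h 0)"
    and bc: "\<And>y. y = l \<or> y = -l \<Longrightarrow> h 2 y = \<sigma> * m\<^sup>2 * h 0 y"
      "\<And>y. y = l \<or> y = -l \<Longrightarrow> h 3 y = (2 - \<sigma>) * m\<^sup>2 * h 1 y"
  defines "P \<equiv> tensor s (h 0)" and "Pxx \<equiv> tensor (\<lambda>x. - m\<^sup>2 * s x) (h 0)" and "Pyy \<equiv> tensor s (h 2)"
    and "Pxy \<equiv> tensor (\<lambda>x. m * c x) (h 1)"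
  shows "(LINT p:plate l|lborel. (D 2 0 u p + D 0 2 u p) * (Pxx p + Pyy p)
       + (1 - \<sigma>) * (2 * D 1 1 u p * Pxy p - D 2 0 u p * Pyy p - D 0 2 u p * Pxx p))
    = plate_pairing l u s (\<lambda>y. h 4 y - 2 * m\<^sup>2 * h 2 y + m ^ 4 * h 0 y)"
proof -
  have dh: "(h 0 has_real_derivative h 1 y) (at y)" "(h 1 has_real_derivative h 2 y) (at y)"
    "(h 2 has_real_derivative h 3 y) (at y)" "(h 3 has_real_derivative h 4 y) (at y)" for y
    using h(1)[of 0] h(1)[of 1] h(1)[of 2] h(1)[of 3] by (auto simp: eval_nat_numeral)
  have sm: "smooth (h 0)" "smooth (h 1)" "smooth (h 2)" "smooth (h 3)" "smooth (h 4)"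
    using h(2) smooth_derivative[OF h(2) dh(1)]
      smooth_derivative[OF smooth_derivative[OF h(2) dh(1)] dh(2)]
      smooth_derivative[OF smooth_derivative[OF smooth_derivative[OF h(2) dh(1)] dh(2)] dh(3)]
      smooth_derivative[OF smooth_derivative[OF smooth_derivative[OF smooth_derivative[OF h(2) dh(1)] dh(2)] dh(3)] dh(4)]
    by auto
  define a where "a = (\<lambda>y. (- m\<^sup>2) * h 0 y + \<sigma> * h 2 y)"
  define b where "b = (\<lambda>y. h 2 y + (- \<sigma> * m\<^sup>2) * h 0 y)"
  define b' where "b' = (\<lambda>y. h 3 y + (- \<sigma> * m\<^sup>2) * h 1 y)"
  define e where "e = (\<lambda>y. (- 1) * h 3 y + ((2 - \<sigma>) * m\<^sup>2) * h 1 y)"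
  define e' where "e' = (\<lambda>y. (- 1) * h 4 y + ((2 - \<sigma>) * m\<^sup>2) * h 2 y)"
  have sab: "smooth a" "smooth b" "smooth b'" "smooth e" "smooth e'"
    unfolding a_def b_def b'_def e_def e'_def by (intro smooth_add smooth_mult smooth_const sm)+
  have db: "(b has_real_derivative b' y) (at y)" "(e has_real_derivative e' y) (at y)" for y
    unfolding b_def b'_def e_def e'_def by (rule derivative_eq_intros dh refl | simp)+
  have ends: "b (-l) = 0" "b l = 0" "e (-l) = 0" "e l = 0"
    unfolding b_def e_def using bc by simp_all
  have e01: "- plate_pairing l (D 0 1 u) s b'
    + 2 * (1 - \<sigma>) * m\<^sup>2 * plate_pairing l (D 0 1 u) s (h 1)
    = plate_pairing l (D 0 1 u) s e"
  proof -
    have "plate_pairing l (D 0 1 u) s e =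
      (LINT p:plate l|lborel. (2 * (1 - \<sigma>) * m\<^sup>2) * (D 0 1 u p * tensor s (h 1) p) - D 0 1 u p * tensor s b' p)"
      unfolding tensor_def e_def b'_def
      by (intro arg_cong[where f = "\<lambda>F. set_lebesgue_integral lborel (plate l) F"] ext) (simp add: algebra_simps)
    also have "\<dots> = 2 * (1 - \<sigma>) * m\<^sup>2 * plate_pairing l (D 0 1 u) s (h 1) - plate_pairing l (D 0 1 u) s b'"
    proof -
      have i: "set_integrable lborel (plate l) (\<lambda>p. D 0 1 u p * tensor s b' p)"
        "set_integrable lborel (plate l) (\<lambda>p. D 0 1 u p * tensor s (h 1) p)"
        by (rule D_tens_int; simp add: smooth_modes sab sm[unfolded One_nat_def])+
      from i(2) have i2: "set_integrable lborel (plate l) (\<lambda>p. 2 * (1 - \<sigma>) * m\<^sup>2 * (D 0 1 u p * tensor s (h 1) p))"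
        by (intro set_integrable_mult_right)
      show ?thesis unfolding set_integral_diff(2)[OF i2 i(1)] by simp
    qed
    finally show ?thesis by simp
  qed
  have "(LINT p:plate l|lborel. (D 2 0 u p + D 0 2 u p) * (Pxx p + Pyy p)
       + (1 - \<sigma>) * (2 * D 1 1 u p * Pxy p - D 2 0 u p * Pyy p - D 0 2 u p * Pxx p))
    = (LINT p:plate l|lborel. D 2 0 u p * tensor s a p + D 0 2 u p * tensor s b p + 2 * (1 - \<sigma>) * m * (D 1 1 u p * tensor c (h 1) p))"
    unfolding P_def Pxx_def Pyy_def Pxy_def tensor_def a_def b_def
    by (intro arg_cong[where f = "\<lambda>F. set_lebesgue_integral lborel (plate l) F"] ext) (simp add: algebra_simps)
  also have "\<dots> = plate_pairing l (D 2 0 u) s a + plate_pairing l (D 0 2 u) s b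
    + 2 * (1 - \<sigma>) * m * plate_pairing l (D 1 1 u) c (h 1)"
  proof -
    have i: "set_integrable lborel (plate l) (\<lambda>p. D 2 0 u p * tensor s a p)"
      "set_integrable lborel (plate l) (\<lambda>p. D 0 2 u p * tensor s b p)"
      "set_integrable lborel (plate l) (\<lambda>p. D 1 1 u p * tensor c (h 1) p)"
      by (rule D_tens_int; simp add: smooth_modes sab sm[unfolded One_nat_def])+
    from i(3) have i3: "set_integrable lborel (plate l) (\<lambda>p. 2 * (1 - \<sigma>) * m * (D 1 1 u p * tensor c (h 1) p))"
      by (intro set_integrable_mult_right)
    show ?thesis
      unfolding set_integral_add(2)[OF set_integral_add(1)[OF i(1,2)] i3] set_integral_add(2)[OF i(1,2)]
      by simp
  qed
  also have "\<dots> = - m\<^sup>2 * plate_pairing l u s a - plate_pairing l (D 0 1 u) s b'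
    + 2 * (1 - \<sigma>) * m\<^sup>2 * plate_pairing l (D 0 1 u) s (h 1)"
    unfolding mode_D20[OF sab(1)] mode_dy(1)[OF sab(2) db(1) ends(1,2)] mode_D11[OF sm(2)]
    by (simp add: power2_eq_square)
  also have "- m\<^sup>2 * plate_pairing l u s a - plate_pairing l (D 0 1 u) s b'
    + 2 * (1 - \<sigma>) * m\<^sup>2 * plate_pairing l (D 0 1 u) s (h 1)
    = - m\<^sup>2 * plate_pairing l u s a + plate_pairing l (D 0 1 u) s e" using e01 by simp
  also have "\<dots> = - m\<^sup>2 * plate_pairing l u s a - plate_pairing l u s e'"
    unfolding mode_dy(2)[OF sab(4) db(2) ends(3,4)] by simp
  also have "\<dots> = (LINT p:plate l|lborel. (- m\<^sup>2) * (u p * tensor s a p) - u p * tensor s e' p)"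
  proof -
    have i: "set_integrable lborel (plate l) (\<lambda>p. u p * tensor s B p)" if "smooth B" for B
      by (intro set_integrable_plate_continuous[OF l] continuous_intros mode_continuous continuous_on_tensor smooth_continuous smooth_modes that)
    from i[OF sab(1)] have i2: "set_integrable lborel (plate l) (\<lambda>p. (- m\<^sup>2) * (u p * tensor s a p))"
      by (intro set_integrable_mult_right)
    show ?thesis unfolding set_integral_diff(2)[OF i2 i[OF sab(5)]] set_integral_mult_right ..
  qed
  also have "\<dots> = plate_pairing l u s (\<lambda>y. h 4 y - 2 * m\<^sup>2 * h 2 y + m ^ 4 * h 0 y)"
    unfolding tensor_def e'_def a_def
    by (intro arg_cong[where f = "\<lambda>F. set_lebesgue_integral lborel (plate l) F"] ext)
      (simp add: algebra_simps power2_eq_square power4_eq_xxxx)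
  finally show ?thesis .
qed

end

section \<open>Weak derivatives of tensor products\<close>

lemma test_fun_C_k: "\<theta> \<in> test_fun \<Omega> \<Longrightarrow> C_k k \<theta>"
  by (simp add: test_fun_def)

lemma test_fun_differentiable: "\<theta> \<in> test_fun \<Omega> \<Longrightarrow> \<theta> differentiable (at p)"
  using test_fun_C_k[of \<theta> \<Omega> "Suc 0"] unfolding C_k.simps by blast

lemma test_fun_continuous: "\<theta> \<in> test_fun \<Omega> \<Longrightarrow> continuous_on S \<theta>"
  using test_fun_C_k[of \<theta> \<Omega> 0] by (auto intro: continuous_on_subset)

lemma test_fun_zero: "\<theta> \<in> test_fun \<Omega> \<Longrightarrow> p \<notin> \<Omega> \<Longrightarrow> \<theta> p = 0"
  using closure_subset[of "{p. \<theta> p \<noteq> 0}"] by (auto simp: test_fun_def)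

lemma test_fun_pderiv:
  assumes "\<theta> \<in> test_fun \<Omega>" "v = (1, 0) \<or> v = (0, 1)"
  shows "pderiv_dir v \<theta> \<in> test_fun \<Omega>"
proof -
  let ?K = "closure {p. \<theta> p \<noteq> 0}"
  have K: "compact ?K" "?K \<subseteq> \<Omega>" using assms(1) by (auto simp: test_fun_def)
  have "pderiv_dir v \<theta> p = 0" if "p \<notin> ?K" for p
  proof -
    have "(\<theta> has_derivative (\<lambda>_. 0)) (at p)"
    proof (rule has_derivative_transform_within_open)
      show "((\<lambda>_. 0) has_derivative (\<lambda>_. 0)) (at p)" by simp
      show "open (- ?K)" "p \<in> - ?K" using that by auto
      show "0 = \<theta> q" if "q \<in> - ?K" for q
        using that closure_subset[of "{p. \<theta> p \<noteq> 0}"] by auto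
    qed
    from frechet_derivative_at[OF this] show ?thesis by (metis pderiv_dir_def)
  qed
  then have "{p. pderiv_dir v \<theta> p \<noteq> 0} \<subseteq> ?K" by blast
  then have sub: "closure {p. pderiv_dir v \<theta> p \<noteq> 0} \<subseteq> ?K" by (rule closure_minimal) simp
  then have "compact (closure {p. pderiv_dir v \<theta> p \<noteq> 0})"
    using K(1) by (metis closed_closure compact_Int_closed inf.absorb_iff2)
  moreover have "C_k k (pderiv_dir v \<theta>)" for k
    using test_fun_C_k[OF assms(1), of "Suc k"] assms(2) by auto
  ultimately show ?thesis using sub K(2) by (auto simp: test_fun_def)
qed

lemma slice_derivatives:
  fixes \<theta> :: "real \<times> real \<Rightarrow> real"
  assumes "\<And>p. \<theta> differentiable (at p)"
  shows "((\<lambda>x. \<theta> (x, y)) has_real_derivative pderiv_dir (1, 0) \<theta> (x, y)) (at x within X)"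
    and "((\<lambda>y. \<theta> (x, y)) has_real_derivative pderiv_dir (0, 1) \<theta> (x, y)) (at y within Y)"
proof -
  let ?D = "frechet_derivative \<theta> (at (x, y))"
  have D: "(\<theta> has_derivative ?D) (at (x, y))"
    using assms by (simp add: frechet_derivative_works)
  interpret D: bounded_linear ?D using D by (rule has_derivative_bounded_linear)
  have 1: "((\<lambda>x. (x, y)) has_derivative (\<lambda>h. (h, 0))) (at x within X)"
    by (auto intro!: derivative_eq_intros)
  have 2: "((\<lambda>y. (x, y)) has_derivative (\<lambda>h. (0, h))) (at y within Y)"
    by (auto intro!: derivative_eq_intros)
  have 3: "(\<lambda>h. ?D (h, 0)) = (*) (pderiv_dir (1, 0) \<theta> (x, y))"
  proof
    fix h :: real
    show "?D (h, 0) = pderiv_dir (1, 0) \<theta> (x, y) * h"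
      using D.scaleR[of h "(1, 0)"] by (simp add: pderiv_dir_def mult.commute)
  qed
  have 4: "(\<lambda>h. ?D (0, h)) = (*) (pderiv_dir (0, 1) \<theta> (x, y))"
  proof
    fix h :: real
    show "?D (0, h) = pderiv_dir (0, 1) \<theta> (x, y) * h"
      using D.scaleR[of h "(0, 1)"] by (simp add: pderiv_dir_def mult.commute)
  qed
  show "((\<lambda>x. \<theta> (x, y)) has_real_derivative pderiv_dir (1, 0) \<theta> (x, y)) (at x within X)"
    unfolding has_field_derivative_def 3[symmetric] by (rule has_derivative_compose[OF 1 D])
  show "((\<lambda>y. \<theta> (x, y)) has_real_derivative pderiv_dir (0, 1) \<theta> (x, y)) (at y within Y)"
    unfolding has_field_derivative_def 4[symmetric] by (rule has_derivative_compose[OF 2 D])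
qed

lemma box_Pair_real:
  fixes a b c d :: real
  shows "box (a, c) (b, d) = {a<..<b} \<times> {c<..<d}"
  by (auto simp: box_def Basis_prod_def)

lemma plate_box: "plate l = box (0, -l) (pi, l)"
  unfolding plate_def box_Pair_real ..

lemma integral_plate_iterated:
  assumes "0 < l" and F: "continuous_on (closure (plate l)) F"
  shows "(LINT p:plate l|lborel. F p) = integral {0..pi} (\<lambda>x. integral {-l..l} (\<lambda>y. F (x, y)))"
    and "(LINT p:plate l|lborel. F p) = integral {-l..l} (\<lambda>y. integral {0..pi} (\<lambda>x. F (x, y)) :: real)"
proof -
  have "set_integrable lborel (plate l) F"
    by (rule set_integrable_plate_continuous[OF assms])
  from set_borel_integral_eq_integral(2)[OF this]
  have e: "(LINT p:plate l|lborel. F p) = integral (cbox (0, -l) (pi, l)) F"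
    unfolding plate_box by (simp add: integral_open_interval)
  have c: "continuous_on (cbox (0, -l) (pi, l)) F" by (rule continuous_on_subset[OF F]) (simp add: closure_plate[OF assms(1)] cbox_Pair_eq)
  show 1: "(LINT p:plate l|lborel. F p) = integral {0..pi} (\<lambda>x. integral {-l..l} (\<lambda>y. F (x, y)))"
    unfolding e using integral_prod_continuous[OF c] by simp
  show "(LINT p:plate l|lborel. F p) = integral {-l..l} (\<lambda>y. integral {0..pi} (\<lambda>x. F (x, y)))"
    unfolding 1 using integral_swap_continuous[of 0 "-l" pi l "\<lambda>x y. F (x, y)"] c by simp
qed

text \<open>The sum of the two integrands is the exact derivative of the product in one variable.
  Integrated in that variable first, it gives 0, as the test function vanishes on the
  boundary.\<close>

lemma tensor_by_parts:
  assumes l: "0 < l" and \<theta>: "\<theta> \<in> test_fun (plate l)"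
    and A: "smooth A" "\<And>x. (A has_real_derivative A' x) (at x)" and B: "smooth B" "\<And>x. (B has_real_derivative B' x) (at x)"
  shows "(LINT p:plate l|lborel. tensor A B p * pderiv_dir (1, 0) \<theta> p) = - (LINT p:plate l|lborel. tensor A' B p * \<theta> p)"
    and "(LINT p:plate l|lborel. tensor A B p * pderiv_dir (0, 1) \<theta> p) = - (LINT p:plate l|lborel. tensor A B' p * \<theta> p)"
proof -
  note c = smooth_continuous[OF A(1)] smooth_continuous[OF B(1)]
    smooth_continuous[OF smooth_derivative[OF A]] smooth_continuous[OF smooth_derivative[OF B]]
    test_fun_continuous[OF \<theta>] test_fun_continuous[OF test_fun_pderiv[OF \<theta>]]
  have int: "set_integrable lborel (plate l) (\<lambda>p. tensor f g p * \<eta> p)"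
    if "continuous_on UNIV f" "continuous_on UNIV g" "continuous_on UNIV \<eta>" for f g \<eta>
    by (intro set_integrable_plate_continuous[OF l] continuous_on_mult continuous_on_tensor that continuous_on_subset[OF that(3)]) simp
  define F where "F = (\<lambda>p. tensor A B p * pderiv_dir (1, 0) \<theta> p + tensor A' B p * \<theta> p)"
  define G where "G = (\<lambda>p. tensor A B p * pderiv_dir (0, 1) \<theta> p + tensor A B' p * \<theta> p)"
  have cF: "continuous_on (closure (plate l)) F" unfolding F_def by (intro continuous_intros continuous_on_tensor c) simp
  have cG: "continuous_on (closure (plate l)) G" unfolding G_def by (intro continuous_intros continuous_on_tensor c) simp
  have dF: "((\<lambda>x. tensor A B (x, y) * \<theta> (x, y)) has_real_derivative F (x, y)) (at x within X)" for x y X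
    unfolding F_def tensor_def fst_conv snd_conv
    by (rule derivative_eq_intros has_field_derivative_at_within[OF A(2)]
        slice_derivatives(1)[OF test_fun_differentiable[OF \<theta>]] refl)+ (simp add: algebra_simps)
  have dG: "((\<lambda>y. tensor A B (x, y) * \<theta> (x, y)) has_real_derivative G (x, y)) (at y within X)" for x y X
    unfolding G_def tensor_def fst_conv snd_conv
    by (rule derivative_eq_intros has_field_derivative_at_within[OF B(2)]
        slice_derivatives(2)[OF test_fun_differentiable[OF \<theta>]] refl)+ (simp add: algebra_simps)
  have "integral {0..pi} (\<lambda>x. F (x, y)) = 0" for y
  proof -
    have "((\<lambda>x. F (x, y)) has_integral (tensor A B (pi, y) * \<theta> (pi, y) - tensor A B (0, y) * \<theta> (0, y))) {0..pi}"
      by (rule fundamental_theorem_of_calculus) (auto simp flip: has_real_derivative_iff_has_vector_derivative intro: dF)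
    moreover have "\<theta> (pi, y) = 0" "\<theta> (0, y) = 0"
      using test_fun_zero[OF \<theta>] by (auto simp: plate_def)
    ultimately show ?thesis by (simp add: integral_unique)
  qed
  then have "(LINT p:plate l|lborel. F p) = 0" unfolding integral_plate_iterated(2)[OF l cF] by simp
  then show "(LINT p:plate l|lborel. tensor A B p * pderiv_dir (1, 0) \<theta> p) = - (LINT p:plate l|lborel. tensor A' B p * \<theta> p)"
    unfolding F_def by (subst (asm) set_integral_add(2)[OF int int]) (auto intro!: c)
  have "integral {-l..l} (\<lambda>y. G (x, y)) = 0" for x
  proof -
    have "((\<lambda>y. G (x, y)) has_integral (tensor A B (x, l) * \<theta> (x, l) - tensor A B (x, -l) * \<theta> (x, -l))) {-l..l}"
      by (rule fundamental_theorem_of_calculus)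
        (use l in \<open>auto simp flip: has_real_derivative_iff_has_vector_derivative intro: dG\<close>)
    moreover have "\<theta> (x, l) = 0" "\<theta> (x, -l) = 0"
      using test_fun_zero[OF \<theta>] by (auto simp: plate_def)
    ultimately show ?thesis by (simp add: integral_unique)
  qed
  then have "(LINT p:plate l|lborel. G p) = 0" unfolding integral_plate_iterated(1)[OF l cG] by simp
  then show "(LINT p:plate l|lborel. tensor A B p * pderiv_dir (0, 1) \<theta> p) = - (LINT p:plate l|lborel. tensor A B' p * \<theta> p)"
    unfolding G_def by (subst (asm) set_integral_add(2)[OF int int]) (auto intro!: c)
qed

lemma continuous_imp_L2:
  fixes f :: "real \<times> real \<Rightarrow> real"
  assumes "0 < l" "continuous_on UNIV f"
  shows "f \<in> L2 (plate l)"
proof -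
  have "set_integrable lborel (plate l) f" "set_integrable lborel (plate l) (\<lambda>p. (f p)\<^sup>2)"
    by (intro set_integrable_plate_continuous[OF assms(1)] continuous_intros continuous_on_subset[OF assms(2)] subset_UNIV)+
  then show ?thesis
    unfolding L2_def set_integrable_def set_borel_measurable_def by auto
qed

text \<open>\<open>partial\<close> applies the y-derivatives to the test function first, so in the
  mixed case the outer x-derivative is moved off before the inner y-derivative.\<close>

lemma weak_partials_of_tensor:
  assumes l: "0 < l"
    and A: "smooth A" "\<And>x. (A has_real_derivative A' x) (at x)" "\<And>x. (A' has_real_derivative A'' x) (at x)"
    and B: "smooth B" "\<And>x. (B has_real_derivative B' x) (at x)" "\<And>x. (B' has_real_derivative B'' x) (at x)"
  shows "weak_partial (plate l) 0 0 (tensor A B) (tensor A B)"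
    "weak_partial (plate l) 1 0 (tensor A B) (tensor A' B)" "weak_partial (plate l) 0 1 (tensor A B) (tensor A B')"
    "weak_partial (plate l) 2 0 (tensor A B) (tensor A'' B)" "weak_partial (plate l) 1 1 (tensor A B) (tensor A' B')"
    "weak_partial (plate l) 0 2 (tensor A B) (tensor A B'')"
proof -
  have sA: "smooth A'" "smooth A''" using smooth_derivative[OF A(1,2)] smooth_derivative[OF smooth_derivative[OF A(1,2)] A(3)] by auto
  have sB: "smooth B'" "smooth B''" using smooth_derivative[OF B(1,2)] smooth_derivative[OF smooth_derivative[OF B(1,2)] B(3)] by auto
  have L: "tensor f g \<in> L2 (plate l)" if "smooth f" "smooth g" for f g
    by (intro continuous_imp_L2[OF l] continuous_on_tensor smooth_continuous that)
  have p: "pderiv_dir (1, 0) \<theta> \<in> test_fun (plate l)" "pderiv_dir (0, 1) \<theta> \<in> test_fun (plate l)"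
    if "\<theta> \<in> test_fun (plate l)" for \<theta> using test_fun_pderiv[OF that] by auto
  note s = A(1) sA B(1) sB
  have pp: "partial 0 0 \<theta> = \<theta>" "partial 1 0 \<theta> = pderiv_dir (1, 0) \<theta>" "partial 0 1 \<theta> = pderiv_dir (0, 1) \<theta>"
    "partial 2 0 \<theta> = pderiv_dir (1, 0) (pderiv_dir (1, 0) \<theta>)"
    "partial 1 1 \<theta> = pderiv_dir (1, 0) (pderiv_dir (0, 1) \<theta>)"
    "partial 0 2 \<theta> = pderiv_dir (0, 1) (pderiv_dir (0, 1) \<theta>)" for \<theta>
    by (simp_all add: partial_def eval_nat_numeral)
  have I: "weak_partial (plate l) i j (tensor A B) v"
    if "v \<in> L2 (plate l)" "\<And>\<theta>. \<theta> \<in> test_fun (plate l) \<Longrightarrow>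
      (LINT p:plate l|lborel. tensor A B p * partial i j \<theta> p) = (-1) ^ (i + j) * (LINT p:plate l|lborel. v p * \<theta> p)" for i j v
    using that unfolding weak_partial_def by blast
  show "weak_partial (plate l) 0 0 (tensor A B) (tensor A B)"
    by (rule I[OF L[OF s(1,4)]]) (simp add: pp)
  show "weak_partial (plate l) 1 0 (tensor A B) (tensor A' B)"
    by (rule I[OF L[OF s(2,4)]], unfold pp, subst tensor_by_parts(1)[OF l _ A(1,2) B(1,2)]) simp_all
  show "weak_partial (plate l) 0 1 (tensor A B) (tensor A B')"
    by (rule I[OF L[OF s(1,5)]], unfold pp, subst tensor_by_parts(2)[OF l _ A(1,2) B(1,2)]) simp_all
  show "weak_partial (plate l) 2 0 (tensor A B) (tensor A'' B)"
    by (rule I[OF L[OF s(3,4)]], unfold pp, subst tensor_by_parts(1)[OF l p(1) A(1,2) B(1,2)], assumption,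
        subst tensor_by_parts(1)[OF l _ s(2) A(3) B(1,2)]) simp_all
  show "weak_partial (plate l) 1 1 (tensor A B) (tensor A' B')"
    by (rule I[OF L[OF s(2,5)]], unfold pp, subst tensor_by_parts(1)[OF l p(2) A(1,2) B(1,2)], assumption,
        subst tensor_by_parts(2)[OF l _ s(2) A(3) B(1,2)]) simp_all
  show "weak_partial (plate l) 0 2 (tensor A B) (tensor A B'')"
    by (rule I[OF L[OF s(1,6)]], unfold pp, subst tensor_by_parts(2)[OF l p(2) A(1,2) B(1,2)], assumption,
        subst tensor_by_parts(2)[OF l _ A(1,2) s(5) B(3)]) simp_all
qed

section \<open>Uniqueness of weak derivatives on the plate\<close>

lemma smooth_supp_mono:
  assumes "smooth_supp a b f" "a' \<le> a" "b \<le> b'"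
  shows "smooth_supp a' b' f"
proof -
  obtain c d where "a < c" "d < b" "\<forall>x. x \<notin> {c..d} \<longrightarrow> f x = 0" "smooth f"
    using assms(1) unfolding smooth_supp_def by blast
  moreover from this have "a' < c" "d < b'" using assms(2,3) by auto
  ultimately show ?thesis unfolding smooth_supp_def by blast
qed

text \<open>Products of cutoffs approximate the indicator function of a box.\<close>

lemma fundamental_lemma_plate:
  assumes l: "0 < l" and v: "set_integrable lborel (plate l) v"
    and z: "\<And>\<theta>. \<theta> \<in> test_fun (plate l) \<Longrightarrow> (LINT p:plate l|lborel. v p * \<theta> p) = 0"
  shows "AE p in lborel. p \<in> plate l \<longrightarrow> v p = 0"
proof -
  define f where "f = (\<lambda>p. indicator (plate l) p *\<^sub>R v p)"
  have f: "integrable lborel f" using v unfolding set_integrable_def f_def .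
  have inner: "(LINT p:plate l|lborel. v p * indicator ({a<..<b} \<times> {c<..<d}) p) = 0"
    if "0 \<le> a" "b \<le> pi" "-l \<le> c" "d \<le> l" for a b c d
  proof -
    obtain \<eta> where \<eta>: "\<And>n. smooth_supp a b (\<eta> n)" "\<And>n x. \<bar>\<eta> n x\<bar> \<le> 1"
      "\<And>x. x \<in> {a<..<b} \<Longrightarrow> (\<lambda>n. \<eta> n x) \<longlonglongrightarrow> (1::real)" "\<And>n x. x \<notin> {a<..<b} \<Longrightarrow> \<eta> n x = 0"
      by (rule cutoff_exists[of a b]) blast
    obtain \<zeta> where \<zeta>: "\<And>n. smooth_supp c d (\<zeta> n)" "\<And>n x. \<bar>\<zeta> n x\<bar> \<le> 1"
      "\<And>x. x \<in> {c<..<d} \<Longrightarrow> (\<lambda>n. \<zeta> n x) \<longlonglongrightarrow> (1::real)" "\<And>n x. x \<notin> {c<..<d} \<Longrightarrow> \<zeta> n x = 0"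
      by (rule cutoff_exists[of c d]) blast
    have "(\<lambda>n. plate_pairing l v (\<eta> n) (\<zeta> n))
      \<longlonglongrightarrow> (LINT p:plate l|lborel. v p * indicator ({a<..<b} \<times> {c<..<d}) p)"
    proof (rule set_integral_bounded_convergence[OF v, where C = 1])
      show "tensor (\<eta> n) (\<zeta> n) \<in> borel_measurable borel" for n
        by (intro borel_measurable_continuous_onI continuous_on_tensor smooth_continuous smooth_supp_smooth[OF \<eta>(1)] smooth_supp_smooth[OF \<zeta>(1)])
      have "{a<..<b} \<times> {c<..<d} \<in> sets (borel :: (real \<times> real) measure)"
        by (intro borel_open open_Times) auto
      then show "indicator ({a<..<b} \<times> {c<..<d}) \<in> borel_measurable borel" by simp
      show "\<bar>tensor (\<eta> n) (\<zeta> n) p\<bar> \<le> 1" for n p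
        using mult_mono[OF \<eta>(2)[of n "fst p"] \<zeta>(2)[of n "snd p"]] by (simp add: tensor_def abs_mult)
      show "(\<lambda>n. tensor (\<eta> n) (\<zeta> n) p) \<longlonglongrightarrow> indicator ({a<..<b} \<times> {c<..<d}) p" for p
      proof (cases "p \<in> {a<..<b} \<times> {c<..<d}")
        case True
        then show ?thesis
          using tendsto_mult[OF \<eta>(3)[of "fst p"] \<zeta>(3)[of "snd p"]] by (auto simp: tensor_def)
      next
        case False
        then have "tensor (\<eta> n) (\<zeta> n) p = 0" for n
          using \<eta>(4)[of "fst p" n] \<zeta>(4)[of "snd p" n] by (cases p) (auto simp: tensor_def)
        then show ?thesis using False by simp
      qed
    qed
    moreover have "tensor (\<eta> n) (\<zeta> n) \<in> test_fun (plate l)" for n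
      unfolding plate_def by (rule tensor_test_fun[OF smooth_supp_mono[OF \<eta>(1) that(1,2)] smooth_supp_mono[OF \<zeta>(1) that(3,4)]])
    ultimately have "(\<lambda>n. 0) \<longlonglongrightarrow> (LINT p:plate l|lborel. v p * indicator ({a<..<b} \<times> {c<..<d}) p)"
      using z by simp
    then show ?thesis using LIMSEQ_unique tendsto_const by blast
  qed
  have box: "(LINT p:box a b|lborel. f p) = 0" for a b
  proof -
    obtain a1 a2 b1 b2 where ab: "a = (a1, a2)" "b = (b1, b2)" by (cases a, cases b)
    \<comment> \<open>An arbitrary box of the plane is cut down to the plate, outside of which f is
      0; the result may be empty.\<close>
    have "indicator (box a b) p *\<^sub>R f p = indicator (plate l) p *\<^sub>R
       (v p * indicator ({max a1 0<..<min b1 pi} \<times> {max a2 (-l)<..<min b2 l}) p)" for p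
      by (cases p) (auto simp: f_def indicator_def plate_def ab box_Pair_real)
    then show ?thesis
      using inner[of "max a1 0" "min b1 pi" "max a2 (-l)" "min b2 l"]
      unfolding set_lebesgue_integral_def by simp
  qed
  \<comment> \<open>The integral of f over a set is a signed measure that vanishes on boxes, an
    intersection-stable generator of the Borel sets. For complements the integral over the plane is
    needed; it reduces to the box that is the plate.\<close>
  have all: "(LINT p:S|lborel. f p) = 0" if "S \<in> sets lborel" for S
  proof -
    have fi: "set_integrable lborel S f" if "S \<in> sets lborel" for S
      unfolding set_integrable_def using that f by (rule integrable_mult_indicator)
    have UN: "(LINT p:UNIV|lborel. f p) = 0"
    proof -
      have e: "indicator (box (0, -l) (pi, l)) p *\<^sub>R f p = indicator UNIV p *\<^sub>R f p" for p
        unfolding f_def plate_box by (simp add: indicator_def)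
      show ?thesis using box[of "(0, -l)" "(pi, l)"] unfolding set_lebesgue_integral_def e .
    qed
    define G where "G = range (\<lambda>(a, b). box a b :: (real \<times> real) set)"
    have sets: "sets (borel :: (real \<times> real) measure) = sigma_sets UNIV G"
      by (simp add: borel_eq_box G_def)
    have Gm: "A \<in> G \<longleftrightarrow> (\<exists>p q. A = box p q)" for A
      unfolding G_def image_iff by simp
    have "Int_stable G"
    proof (rule Int_stableI)
      fix a b :: "(real \<times> real) set" assume "a \<in> G" "b \<in> G"
      then obtain p q r s where "a = box p q" "b = box r s"
        unfolding Gm by blast
      then have "a \<inter> b = box (max (fst p) (fst r), max (snd p) (snd r)) (min (fst q) (fst s), min (snd q) (snd s))"
        by (cases p; cases q; cases r; cases s) (simp add: box_Pair_real Times_Int_Times)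
      then show "a \<inter> b \<in> G"
        unfolding Gm by blast
    qed
    moreover have "G \<subseteq> Pow UNIV" by simp
    moreover have "S \<in> sigma_sets UNIV G" using that sets by simp
    ultimately show ?thesis
    proof (induction S rule: sigma_sets_induct_disjoint)
      case (basic A)
      then show ?case using box unfolding Gm by blast
    next
      case empty
      show ?case by (simp add: set_lebesgue_integral_def)
    next
      case (compl A)
      have a: "A \<in> sets borel" unfolding sets by (rule compl(1))
      then have A: "A \<in> sets lborel" "UNIV - A \<in> sets lborel"
        using sets.compl_sets[OF a] by simp_all
      have "(LINT p:A \<union> (UNIV - A)|lborel. f p) = (LINT p:A|lborel. f p) + (LINT p:UNIV - A|lborel. f p)"
        by (rule set_integral_Un[OF _ fi[OF A(1)] fi[OF A(2)]]) simp
      then show ?case using UN compl(2) by simp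
    next
      case (union A)
      have A: "A i \<in> sets lborel" for i
      proof -
        have "A i \<in> sets borel" unfolding sets using union(2) by blast
        then show ?thesis by simp
      qed
      have "(LINT p:(\<Union>i. A i)|lborel. f p) = (\<Sum>i. LINT p:A i|lborel. f p)"
      proof (rule lebesgue_integral_countable_add[OF A _ fi])
        show "A i \<inter> A j = {}" if "i \<noteq> j" for i j
          using union(1) that by (simp add: disjoint_family_on_def)
        show "(\<Union>i. A i) \<in> sets lborel" by (rule sets.countable_UN) (use A in blast)
      qed
      then show ?case using union(3) by simp
    qed
  qed
  have "AE p in lborel. f p = 0"
  proof (rule density_unique_real[OF f])
    show "integrable lborel (\<lambda>p :: real \<times> real. 0 :: real)" by simp
    show "(LINT p:S|lborel. f p) = (LINT p:S|lborel. 0)" if "S \<in> sets lborel" for S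
      unfolding all[OF that] by (simp add: set_lebesgue_integral_def)
  qed
  then show ?thesis
  proof (rule AE_mp, intro AE_I2 impI)
    fix p assume "f p = 0" "p \<in> plate l"
    then show "v p = 0" by (simp add: f_def)
  qed
qed

text \<open>\<open>wD\<close> is some weak derivative, nothing more. Uniqueness is what permits
  replacing it by the classical derivative when the argument is a smooth tensor product.\<close>

lemma weak_partial_unique_AE:
  assumes l: "0 < l" and v: "weak_partial (plate l) i j u v" and w: "weak_partial (plate l) i j u w"
  shows "AE p in lborel. p \<in> plate l \<longrightarrow> v p = w p"
proof -
  have vi: "set_integrable lborel (plate l) v" "set_integrable lborel (plate l) w"
    using v w set_integrable_plate_L2[OF l] unfolding weak_partial_def by blast+
  have "AE p in lborel. p \<in> plate l \<longrightarrow> v p - w p = 0"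
  proof (rule fundamental_lemma_plate[OF l set_integral_diff(1)[OF vi]])
    fix \<theta> assume \<theta>: "\<theta> \<in> test_fun (plate l)"
    have "compact (closure {p. \<theta> p \<noteq> 0})" using \<theta> by (simp add: test_fun_def)
    then have "bounded (\<theta> ` closure {p. \<theta> p \<noteq> 0})"
      by (intro compact_imp_bounded compact_continuous_image test_fun_continuous[OF \<theta>])
    then obtain C where C: "\<forall>y\<in>\<theta> ` closure {p. \<theta> p \<noteq> 0}. norm y \<le> C" unfolding bounded_iff by blast
    have b: "\<bar>\<theta> p\<bar> \<le> max C 0" for p
    proof (cases "\<theta> p = 0")
      case False
      then have "p \<in> closure {p. \<theta> p \<noteq> 0}" using closure_subset by fastforce
      then have "\<bar>\<theta> p\<bar> \<le> C" using C by auto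
      then show ?thesis by simp
    qed simp
    have m: "\<theta> \<in> borel_measurable borel"
      by (intro borel_measurable_continuous_onI test_fun_continuous[OF \<theta>])
    note i = set_integrable_mult_bounded[OF vi(1) m b] set_integrable_mult_bounded[OF vi(2) m b]
    have "(LINT p:plate l|lborel. u p * partial i j \<theta> p) = (-1) ^ (i + j) * (LINT p:plate l|lborel. v p * \<theta> p)"
      "(LINT p:plate l|lborel. u p * partial i j \<theta> p) = (-1) ^ (i + j) * (LINT p:plate l|lborel. w p * \<theta> p)"
      using v w \<theta> unfolding weak_partial_def by blast+
    then have "(LINT p:plate l|lborel. v p * \<theta> p) = (LINT p:plate l|lborel. w p * \<theta> p)" by simp
    then show "(LINT p:plate l|lborel. (v p - w p) * \<theta> p) = 0"
      unfolding left_diff_distrib set_integral_diff(2)[OF i] by simp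
  qed
  then show ?thesis by (rule AE_mp) (auto intro!: AE_I2)
qed

section \<open>The scalar product with a mode\<close>

lemma tensor_in_H2_star:
  assumes l: "0 < l" and A: "smooth A" "A 0 = 0" "A pi = 0" and B: "smooth B"
  shows "tensor A B \<in> H2_star l"
proof -
  obtain A' where A': "\<And>x. (A has_real_derivative A' x) (at x)" "smooth A'" by (rule smooth_deriv_ex[OF A(1)]) blast
  obtain A'' where A'': "\<And>x. (A' has_real_derivative A'' x) (at x)" by (rule smooth_deriv_ex[OF A'(2)]) blast
  obtain B' where B': "\<And>x. (B has_real_derivative B' x) (at x)" "smooth B'" by (rule smooth_deriv_ex[OF B(1)]) blast
  obtain B'' where B'': "\<And>x. (B' has_real_derivative B'' x) (at x)" by (rule smooth_deriv_ex[OF B'(2)]) blast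
  note w = weak_partials_of_tensor[OF l A(1) A'(1) A'' B(1) B'(1) B'']
  have c: "continuous_on S (tensor A B)" for S by (intro continuous_on_tensor smooth_continuous A B)
  have "\<exists>v. weak_partial (plate l) i j (tensor A B) v" if "i + j \<le> 2" for i j
  proof -
    have "(i = 0 \<and> j = 0) \<or> (i = 1 \<and> j = 0) \<or> (i = 0 \<and> j = 1) \<or> (i = 2 \<and> j = 0) \<or> (i = 1 \<and> j = 1) \<or> (i = 0 \<and> j = 2)"
      using that by presburger
    then show ?thesis using w by blast
  qed
  moreover have "tensor A B \<in> L2 (plate l)" by (rule continuous_imp_L2[OF l c])
  moreover have "tensor A B q = 0" if "q \<in> {0, pi} \<times> {-l<..<l}" for q
    using that A by (auto simp: tensor_def)
  ultimately show ?thesis unfolding H2_star_def H2_def using c by blast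
qed

lemma H2_star_inner_mode:
  fixes h :: "nat \<Rightarrow> real \<Rightarrow> real"
  assumes l: "0 < l" and u: "u \<in> H2_star l" and m: "sin (m * pi) = 0"
    and h: "\<And>i y. i < 4 \<Longrightarrow> (h i has_real_derivative h (Suc i) y) (at y)" "smooth (h 0)"
    and bc: "\<And>y. y = l \<or> y = -l \<Longrightarrow> h 2 y = \<sigma> * m\<^sup>2 * h 0 y"
      "\<And>y. y = l \<or> y = -l \<Longrightarrow> h 3 y = (2 - \<sigma>) * m\<^sup>2 * h 1 y"
  shows "H2_star_inner l \<sigma> u (tensor (\<lambda>x. sin (m * x)) (h 0))
    = plate_pairing l u (\<lambda>x. sin (m * x)) (\<lambda>y. h 4 y - 2 * m\<^sup>2 * h 2 y + m ^ 4 * h 0 y)"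
proof -
  define s c where "s = (\<lambda>x. sin (m * x))" and "c = (\<lambda>x. cos (m * x))"
  define D where "D = wD (plate l)"
  define P where "P = tensor s (h 0)"
  define Pxx Pyy Pxy where "Pxx = tensor (\<lambda>x. - m\<^sup>2 * s x) (h 0)" and "Pyy = tensor s (h 2)"
    and "Pxy = tensor (\<lambda>x. m * c x) (h 1)"
  have ss: "smooth s" unfolding s_def by (rule smooth_sin)
  have ds: "(s has_real_derivative m * c x) (at x)" "((\<lambda>x. m * c x) has_real_derivative - m\<^sup>2 * s x) (at x)" for x
    unfolding s_def c_def by (auto intro!: derivative_eq_intros simp: power2_eq_square)
  have dh: "(h 0 has_real_derivative h 1 y) (at y)" "(h 1 has_real_derivative h 2 y) (at y)" for y
    using h(1)[of 0] h(1)[of 1] by (auto simp: eval_nat_numeral)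
  have s0: "s 0 = 0" "s pi = 0" using m by (auto simp: s_def)
  have P: "P \<in> H2 (plate l)"
    using tensor_in_H2_star[OF l ss s0 h(2)] unfolding P_def H2_star_def by blast
  note w = weak_partials_of_tensor[OF l ss ds h(2) dh, folded Pxx_def Pyy_def Pxy_def P_def]
  have sm: "smooth (\<lambda>x. - m\<^sup>2 * s x)" "smooth (\<lambda>x. m * c x)" "smooth (h 1)" "smooth (h 2)"
    using smooth_derivative[OF ss ds(1)] smooth_derivative[OF smooth_derivative[OF ss ds(1)] ds(2)]
      smooth_derivative[OF h(2) dh(1)] smooth_derivative[OF smooth_derivative[OF h(2) dh(1)] dh(2)] by blast+
  have AE: "AE p in lborel. p \<in> plate l \<longrightarrow> D 2 0 P p = Pxx p"
    "AE p in lborel. p \<in> plate l \<longrightarrow> D 1 1 P p = Pxy p" "AE p in lborel. p \<in> plate l \<longrightarrow> D 0 2 P p = Pyy p"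
    unfolding D_def by (rule weak_partial_unique_AE[OF l weak_partial_wD[OF P] w(4)] weak_partial_unique_AE[OF l weak_partial_wD[OF P] w(5)]
      weak_partial_unique_AE[OF l weak_partial_wD[OF P] w(6)]; simp)+
  define I where "I = (\<lambda>p. indicator (plate l) p :: real)"
  have uH2: "u \<in> H2 (plate l)" using u unfolding H2_star_def by blast
  have md: "(\<lambda>p. I p * D i j v p) \<in> borel_measurable lborel" if "v \<in> H2 (plate l)" "i + j \<le> 2" for v i j
    using wD_integrable[OF l that] unfolding D_def I_def set_integrable_def
    by (auto dest: borel_measurable_integrable)
  have mP: "(\<lambda>p. I p * Q p) \<in> borel_measurable lborel" if "continuous_on UNIV Q" for Q
  proof -
    have "Q \<in> borel_measurable lborel" using borel_measurable_continuous_onI[OF that] by simp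
    moreover have "I \<in> borel_measurable lborel" unfolding I_def using plate_sets by simp
    ultimately show ?thesis by (rule borel_measurable_times[rotated])
  qed
  have cP: "continuous_on UNIV Pxx" "continuous_on UNIV Pyy" "continuous_on UNIV Pxy"
    unfolding Pxx_def Pyy_def Pxy_def by (intro continuous_on_tensor smooth_continuous ss h(2) sm)+
  have I: "I p * I p = I p" for p unfolding I_def by (simp add: indicator_def)
  define E where "E = (\<lambda>a20 a02 a11 b20 b02 b11 :: real. (a20 + a02) * (b20 + b02)
      + (1 - \<sigma>) * (2 * a11 * b11 - a20 * b02 - a02 * b20))"
  \<comment> \<open>\<open>wD\<close> is known to be measurable only when multiplied by the
    indicator of the plate. The indicator takes the values 0 and 1 and E is 0 at the origin, so it
    can be distributed over all arguments.\<close>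
  have EI: "I p *\<^sub>R E a20 a02 a11 b20 b02 b11 = E (I p * a20) (I p * a02) (I p * a11) (I p * b20) (I p * b02) (I p * b11)"
    for p a20 a02 a11 b20 b02 b11
    by (cases "p \<in> plate l") (simp_all add: I_def E_def)
  have mE: "(\<lambda>p. E (a20 p) (a02 p) (a11 p) (b20 p) (b02 p) (b11 p)) \<in> borel_measurable lborel"
    if [measurable]: "a20 \<in> borel_measurable lborel" "a02 \<in> borel_measurable lborel" "a11 \<in> borel_measurable lborel"
      "b20 \<in> borel_measurable lborel" "b02 \<in> borel_measurable lborel" "b11 \<in> borel_measurable lborel"
    for a20 a02 a11 b20 b02 b11
    unfolding E_def by measurable
  have "H2_star_inner l \<sigma> u P = (LINT p|lborel. I p *\<^sub>R E (D 2 0 u p) (D 0 2 u p) (D 1 1 u p) (D 2 0 P p) (D 0 2 P p) (D 1 1 P p))"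
    unfolding H2_star_inner_def Let_def D_def E_def I_def set_lebesgue_integral_def ..
  also have "\<dots> = (LINT p|lborel. I p *\<^sub>R E (D 2 0 u p) (D 0 2 u p) (D 1 1 u p) (Pxx p) (Pyy p) (Pxy p))"
  proof (rule integral_cong_AE)
    show "(\<lambda>p. I p *\<^sub>R E (D 2 0 u p) (D 0 2 u p) (D 1 1 u p) (D 2 0 P p) (D 0 2 P p) (D 1 1 P p)) \<in> borel_measurable lborel"
      unfolding EI by (intro mE md uH2 P) simp_all
    show "(\<lambda>p. I p *\<^sub>R E (D 2 0 u p) (D 0 2 u p) (D 1 1 u p) (Pxx p) (Pyy p) (Pxy p)) \<in> borel_measurable lborel"
      unfolding EI by (intro mE md uH2 mP cP) simp_all
    show "AE p in lborel. I p *\<^sub>R E (D 2 0 u p) (D 0 2 u p) (D 1 1 u p) (D 2 0 P p) (D 0 2 P p) (D 1 1 P p)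
      = I p *\<^sub>R E (D 2 0 u p) (D 0 2 u p) (D 1 1 u p) (Pxx p) (Pyy p) (Pxy p)"
      using AE by eventually_elim (auto simp: I_def indicator_def)
  qed
  also have "\<dots> = (LINT p:plate l|lborel. (D 2 0 u p + D 0 2 u p) * (Pxx p + Pyy p)
       + (1 - \<sigma>) * (2 * D 1 1 u p * Pxy p - D 2 0 u p * Pyy p - D 0 2 u p * Pxx p))"
    unfolding E_def I_def set_lebesgue_integral_def ..
  also have "\<dots> = plate_pairing l u s (\<lambda>y. h 4 y - 2 * m\<^sup>2 * h 2 y + m ^ 4 * h 0 y)"
    unfolding D_def Pxx_def Pyy_def Pxy_def s_def c_def
    by (rule mode_inner[OF l u m h bc])
  finally show ?thesis unfolding P_def s_def .
qed

section \<open>The Fourier series of the Green function\<close>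

lemma sine_orthogonality:
  assumes "1 \<le> n"
  shows "((\<lambda>x. sin (real m * x) * sin (real n * x)) has_integral (if m = n then pi / 2 else 0)) {0..pi}"
proof (cases "m = n")
  case True
  have "((\<lambda>x. sin (real n * x) * sin (real n * x)) has_integral
    (\<lambda>x. x / 2 - sin (2 * real n * x) / (4 * real n)) pi - (\<lambda>x. x / 2 - sin (2 * real n * x) / (4 * real n)) 0) {0..pi}"
  proof (rule fundamental_theorem_of_calculus)
    fix x
    have "((\<lambda>x. x / 2 - sin (2 * real n * x) / (4 * real n)) has_real_derivative
        1 / 2 - cos (2 * real n * x) * (2 * real n) / (4 * real n)) (at x within {0..pi})"
      using assms by (auto intro!: derivative_eq_intros)
    also have "1 / 2 - cos (2 * real n * x) * (2 * real n) / (4 * real n) = sin (real n * x) * sin (real n * x)"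
      using assms cos_double_sin[of "real n * x"] by (simp add: field_simps power2_eq_square)
    finally show "((\<lambda>x. x / 2 - sin (2 * real n * x) / (4 * real n)) has_vector_derivative
        sin (real n * x) * sin (real n * x)) (at x within {0..pi})"
      by (simp add: has_real_derivative_iff_has_vector_derivative)
  qed simp
  moreover have "sin (2 * real n * pi) = 0" using sin_npi[of "2 * n"] by simp
  ultimately show ?thesis using True by simp
next
  case False
  define p q where "p = real m - real n" "q = real m + real n"
  have pq: "p \<noteq> 0" "q \<noteq> 0" using False assms by (auto simp: p_q_def)
  have "((\<lambda>x. sin (real m * x) * sin (real n * x)) has_integral
    (\<lambda>x. sin (p * x) / (2 * p) - sin (q * x) / (2 * q)) pi - (\<lambda>x. sin (p * x) / (2 * p) - sin (q * x) / (2 * q)) 0) {0..pi}"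
  proof (rule fundamental_theorem_of_calculus)
    fix x
    have "((\<lambda>x. sin (p * x) / (2 * p) - sin (q * x) / (2 * q)) has_real_derivative
        cos (p * x) * p / (2 * p) - cos (q * x) * q / (2 * q)) (at x within {0..pi})"
      using pq by (auto intro!: derivative_eq_intros)
    also have "cos (p * x) * p / (2 * p) - cos (q * x) * q / (2 * q) = (cos (real m * x - real n * x) - cos (real m * x + real n * x)) / 2"
    proof -
      have "p * x = real m * x - real n * x" "q * x = real m * x + real n * x"
        by (simp_all add: p_q_def left_diff_distrib distrib_right)
      then show ?thesis using pq by (simp add: diff_divide_distrib)
    qed
    also have "\<dots> = sin (real m * x) * sin (real n * x)"
      by (simp add: cos_diff cos_add)
    finally show "((\<lambda>x. sin (p * x) / (2 * p) - sin (q * x) / (2 * q)) has_vector_derivative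
        sin (real m * x) * sin (real n * x)) (at x within {0..pi})"
      by (simp add: has_real_derivative_iff_has_vector_derivative)
  qed simp
  moreover have "sin (p * pi) = 0" "sin (q * pi) = 0"
    by (simp_all add: p_q_def left_diff_distrib distrib_right sin_diff sin_add)
  ultimately show ?thesis using False by simp
qed

text \<open>The series converges uniformly to some T with the same coefficients, so d = f - T is
  orthogonal to every sin (k x). As sin (k x) cos x is the mean of sin ((k + 1) x) and sin ((k - 1)
  x), the function d sin x is orthogonal to all powers of cos x, which is injective on [0, pi].
  Hence d sin x = 0, so d = 0 inside and, by continuity, at the ends.\<close>

lemma continuous_eq_sine_series:
  fixes f :: "real \<Rightarrow> real"
  assumes f: "continuous_on {0..pi} f" and M: "summable M" "\<And>m. \<bar>a m\<bar> \<le> M m"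
    and coeff: "\<And>n. 1 \<le> n \<Longrightarrow> integral {0..pi} (\<lambda>x. f x * sin (real n * x)) = pi / 2 * a n"
    and x: "x \<in> {0..pi}"
  shows "(\<lambda>m. a m * sin (real m * x)) sums f x"
proof -
  define T where "T = (\<lambda>x. \<Sum>m. a m * sin (real m * x))"
  have le: "norm (a m * sin (real m * x)) \<le> M m" for m x
    using mult_mono[OF M(2)[of m] abs_sin_le_one[of "real m * x"]] M(2)[of m] by (simp add: abs_mult)
  have summ: "summable (\<lambda>m. a m * sin (real m * x))" for x
    by (rule summable_comparison_test'[OF M(1), of 0]) (use le in auto)
  have ul: "uniform_limit {0..pi} (\<lambda>n x. \<Sum>m<n. a m * sin (real m * x)) T sequentially"
    unfolding T_def by (rule Weierstrass_m_test[OF le M(1)])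
  have cT: "continuous_on {0..pi} T"
    by (rule uniform_limit_theorem[OF _ ul]) (auto intro!: always_eventually continuous_intros)
  have T: "integral {0..pi} (\<lambda>x. T x * sin (real n * x)) = pi / 2 * a n" if n: "1 \<le> n" for n
  proof -
    have "uniform_limit {0..pi} (\<lambda>N x. (\<Sum>m<N. a m * sin (real m * x)) * sin (real n * x)) (\<lambda>x. T x * sin (real n * x)) sequentially"
    proof (rule uniform_limitI)
      fix e :: real assume "0 < e"
      from uniform_limitD[OF ul this]
      show "\<forall>\<^sub>F N in sequentially. \<forall>x\<in>{0..pi}. dist ((\<Sum>m<N. a m * sin (real m * x)) * sin (real n * x)) (T x * sin (real n * x)) < e"
      proof eventually_elim
        case (elim N)
        show ?case
        proof
          fix x assume "x \<in> {0..pi}"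
          then have "\<bar>(\<Sum>m<N. a m * sin (real m * x)) - T x\<bar> < e" using elim by (simp add: dist_real_def)
          moreover have "\<bar>(\<Sum>m<N. a m * sin (real m * x)) - T x\<bar> * \<bar>sin (real n * x)\<bar> \<le> \<bar>(\<Sum>m<N. a m * sin (real m * x)) - T x\<bar> * 1"
            by (intro mult_left_mono) auto
          ultimately show "dist ((\<Sum>m<N. a m * sin (real m * x)) * sin (real n * x)) (T x * sin (real n * x)) < e"
            by (simp add: dist_real_def abs_mult flip: left_diff_distrib)
        qed
      qed
    qed
    then obtain I J where IJ: "\<And>N. ((\<lambda>x. (\<Sum>m<N. a m * sin (real m * x)) * sin (real n * x)) has_integral I N) {0..pi}"
      "((\<lambda>x. T x * sin (real n * x)) has_integral J) {0..pi}" "I \<longlonglongrightarrow> J"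
      by (rule uniform_limit_integral) (auto intro!: continuous_intros)
    have IN: "I N = pi / 2 * a n" if "n < N" for N
    proof -
      have "((\<lambda>x. \<Sum>m<N. a m * (sin (real m * x) * sin (real n * x))) has_integral (\<Sum>m<N. a m * (if m = n then pi / 2 else 0))) {0..pi}"
        by (intro has_integral_sum has_integral_mult_right sine_orthogonality n) simp
      moreover have "(\<Sum>m<N. a m * (if m = n then pi / 2 else 0)) = pi / 2 * a n"
        using that by (simp add: if_distrib sum.delta cong: if_cong)
      ultimately have "((\<lambda>x. (\<Sum>m<N. a m * sin (real m * x)) * sin (real n * x)) has_integral (pi / 2 * a n)) {0..pi}"
        by (simp add: sum_distrib_right mult.assoc)
      then show ?thesis using IJ(1) has_integral_unique by blast
    qed
    have "\<forall>\<^sub>F N in sequentially. I N = pi / 2 * a n"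
      by (rule eventually_mono[OF eventually_gt_at_top[of n]], erule IN)
    then have "I \<longlonglongrightarrow> pi / 2 * a n" by (rule tendsto_eventually)
    then have "J = pi / 2 * a n" using IJ(3) LIMSEQ_unique by blast
    then show ?thesis using IJ(2) by (simp add: integral_unique)
  qed
  define d where "d = (\<lambda>x. f x - T x)"
  have cd: "continuous_on {0..pi} d" unfolding d_def by (intro continuous_intros f cT)
  have d0: "integral {0..pi} (\<lambda>x. d x * sin (real n * x)) = 0" for n
  proof (cases "n = 0")
    case False
    have "integral {0..pi} (\<lambda>x. f x * sin (real n * x) - T x * sin (real n * x)) = 0"
      using False by (subst integral_diff) (auto intro!: integrable_continuous_interval continuous_intros f cT simp: coeff T)
    then show ?thesis by (simp add: d_def left_diff_distrib)
  qed simp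
  have dc: "integral {0..pi} (\<lambda>x. d x * sin (real k * x) * cos x ^ n) = 0" for n k
  proof (induction n arbitrary: k)
    case 0
    then show ?case using d0 by simp
  next
    case (Suc n)
    show ?case
    proof (cases k)
      case (Suc j)
      have "d x * sin (real k * x) * cos x ^ Suc n =
        (1/2) * (d x * sin (real (k + 1) * x) * cos x ^ n) + (1/2) * (d x * sin (real j * x) * cos x ^ n)" for x
      proof -
        have "sin (real (k + 1) * x) + sin (real j * x) = 2 * (sin (real k * x) * cos x)"
          using sin_add[of "real k * x" x] sin_diff[of "real k * x" x] Suc by (simp add: algebra_simps)
        then have s: "sin (real k * x) * cos x = (sin (real (k + 1) * x) + sin (real j * x)) / 2" by simp
        have "d x * sin (real k * x) * cos x ^ Suc n = d x * (sin (real k * x) * cos x) * cos x ^ n" by simp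
        then show ?thesis unfolding s by (simp add: field_simps)
      qed
      then have "integral {0..pi} (\<lambda>x. d x * sin (real k * x) * cos x ^ Suc n) =
        integral {0..pi} (\<lambda>x. (1/2) * (d x * sin (real (k + 1) * x) * cos x ^ n) + (1/2) * (d x * sin (real j * x) * cos x ^ n))"
        by simp
      also have "\<dots> = (1/2) * integral {0..pi} (\<lambda>x. d x * sin (real (k + 1) * x) * cos x ^ n)
        + (1/2) * integral {0..pi} (\<lambda>x. d x * sin (real j * x) * cos x ^ n)"
        by (subst integral_add) (auto intro!: integrable_continuous_interval continuous_intros cd simp del: of_nat_add)
      also have "\<dots> = 0" unfolding Suc.IH by simp
      finally show ?thesis .
    qed simp
  qed
  have ds: "d y * sin y = 0" if "y \<in> {0..pi}" for y
  proof (rule moments_zero_imp_zero[where e = cos, OF _ _ _ _ that])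
    show "inj_on cos {0..pi}" by (auto intro!: inj_onI simp: cos_inj_pi)
    show "integral {0..pi} (\<lambda>x. d x * sin x * cos x ^ n) = 0" for n using dc[of 1 n] by simp
  qed (auto intro!: continuous_intros cd)
  have "d y = 0" if "y \<in> {0<..<pi}" for y
    using ds[of y] that sin_gt_zero[of y] by auto
  note d00 = this
  have "d x = 0"
  proof (rule continuous_constant_on_closure[of "{0<..<pi}" d 0])
    show "continuous_on (closure {0<..<pi}) d" using cd by simp
    show "d y = 0" if "y \<in> {0<..<pi}" for y by (rule d00[OF that])
    show "x \<in> closure {0<..<pi}" using x by simp
  qed
  then have "f x = T x" by (simp add: d_def)
  then show ?thesis using summable_sums[OF summ] by (simp add: T_def)
qed

text \<open>Let h be the profile for exp(k y). The reproducing identity and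
  \<open>H2_star_inner_mode\<close> say that the sine coefficient F of G, a continuous function of
  y, integrates against exp(k y) to sin (m rho) h(w). By \<open>green_inverts_operator\<close> the
  kernel integrates to h(w). So d = F - sin (m rho) K_m is orthogonal to exp(k y) for every k >
  m.\<close>

lemma green_fourier_coefficient:
  assumes l: "0 < l" and \<sigma>: "0 \<le> \<sigma>" "\<sigma> < 1" and G: "is_green_function l \<sigma> G"
    and p: "\<rho> \<in> {0..pi}" "w \<in> {-l..l}" and y: "y \<in> {-l..l}" and n: "1 \<le> n"
  shows "integral {0..pi} (\<lambda>x. G x y \<rho> w * sin (real n * x)) = sin (real n * \<rho>) * green0 (1 - \<sigma>) l (real n) w y"
proof -
  define m where "m = real n"
  have m: "0 < m" using n by (simp add: m_def)
  define u where "u = (\<lambda>(x, y). G x y \<rho> w)"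
  have uH: "u \<in> H2_star l" and rep: "\<And>\<phi>. \<phi> \<in> H2_star l \<Longrightarrow> H2_star_inner l \<sigma> u \<phi> = \<phi> (\<rho>, w)"
    using G p unfolding is_green_function_def u_def closure_plate[OF l] by auto
  have cu: "continuous_on (closure (plate l)) u" using uH by (simp add: H2_star_def)
  have smp: "sin (m * pi) = 0" unfolding m_def by (rule sin_npi)
  define F where "F = (\<lambda>y. integral {0..pi} (\<lambda>x. u (x, y) * sin (m * x)))"
  define d where "d = (\<lambda>y. F y - sin (m * \<rho>) * green0 (1 - \<sigma>) l m w y)"
  have "continuous_on ({-l..l} \<times> cbox 0 pi) (\<lambda>(y, x). u (x, y) * sin (m * x))"
  proof -
    have "continuous_on ({-l..l} \<times> cbox 0 pi) (\<lambda>q. u (snd q, fst q))"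
      by (rule continuous_on_compose2[OF cu]) (auto intro!: continuous_intros simp: closure_plate[OF l])
    then show ?thesis unfolding split_def by (intro continuous_intros)
  qed
  then have cF: "continuous_on {-l..l} F"
    unfolding F_def using integral_continuous_on_param[of "{-l..l}" 0 pi "\<lambda>y x. u (x, y) * sin (m * x)"] by simp
  have cg: "continuous_on {-l..l} (green0 (1 - \<sigma>) l m w)"
    using continuous_on_green0[of l "1 - \<sigma>" m "{-l..l}" "\<lambda>_. w" "\<lambda>y. y"] l \<sigma> m by simp
  have cd: "continuous_on {-l..l} d"
    unfolding d_def by (intro continuous_intros cF cg)
  have mom: "integral {-l..l} (\<lambda>y. d y * exp (k * y)) = 0" if k: "m < k" for k
  proof -
    obtain h :: "nat \<Rightarrow> real \<Rightarrow> real" where h: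
      "\<And>i y. i < 4 \<Longrightarrow> (h i has_real_derivative h (Suc i) y) (at y)" "smooth (h 0)"
      "\<And>y. y = l \<or> y = -l \<Longrightarrow> h 2 y = \<sigma> * m\<^sup>2 * h 0 y"
      "\<And>y. y = l \<or> y = -l \<Longrightarrow> h 3 y = (2 - \<sigma>) * m\<^sup>2 * h 1 y"
      "\<And>y. h 4 y - 2 * m\<^sup>2 * h 2 y + m ^ 4 * h 0 y = exp (k * y)"
      by (rule natural_bc_solvable[OF l \<sigma> m k]) blast
    have "tensor (\<lambda>x. sin (m * x)) (h 0) \<in> H2_star l"
      by (rule tensor_in_H2_star[OF l smooth_sin _ smp h(2)]) simp
    from rep[OF this] have "H2_star_inner l \<sigma> u (tensor (\<lambda>x. sin (m * x)) (h 0)) = sin (m * \<rho>) * h 0 w"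
      by (simp add: tensor_def)
    moreover have "H2_star_inner l \<sigma> u (tensor (\<lambda>x. sin (m * x)) (h 0))
      = plate_pairing l u (\<lambda>x. sin (m * x)) (\<lambda>y. exp (k * y))"
      unfolding h(5)[symmetric] by (rule H2_star_inner_mode[OF l uH smp h(1-4)])
    moreover have "\<dots> = integral {-l..l} (\<lambda>y. integral {0..pi} (\<lambda>x. u (x, y) * tensor (\<lambda>x. sin (m * x)) (\<lambda>y. exp (k * y)) (x, y)))"
      by (rule integral_plate_iterated(2)[OF l]) (intro continuous_intros cu continuous_on_tensor)
    moreover have "\<dots> = integral {-l..l} (\<lambda>y. F y * exp (k * y))"
      unfolding F_def tensor_def by (simp flip: mult.assoc)
    ultimately have 1: "integral {-l..l} (\<lambda>y. F y * exp (k * y)) = sin (m * \<rho>) * h 0 w" by simp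
    have "((\<lambda>y. green0 (1 - \<sigma>) l m w y * exp (k * y)) has_integral h 0 w) {-l..l}"
      using green_inverts_operator[OF l \<sigma> m p(2) h(1) h(3,4)] unfolding h(5) .
    then have 2: "integral {-l..l} (\<lambda>y. green0 (1 - \<sigma>) l m w y * exp (k * y)) = h 0 w"
      by (rule integral_unique)
    have "integral {-l..l} (\<lambda>y. d y * exp (k * y)) =
      integral {-l..l} (\<lambda>y. F y * exp (k * y) - sin (m * \<rho>) * (green0 (1 - \<sigma>) l m w y * exp (k * y)))"
      unfolding d_def by (simp add: left_diff_distrib mult.assoc)
    also have "\<dots> = 0"
      by (subst integral_diff) (auto intro!: integrable_continuous_interval continuous_intros cF cg simp: 1 2)
    finally show ?thesis .
  qed
  \<comment> \<open>The exponents used are k = m + 1 + j: the extra factor keeps them above m and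
    leaves the powers of exp y as moments.\<close>
  have "d y * exp ((m + 1) * y) = 0"
  proof (rule moments_zero_imp_zero[where e = exp, OF _ _ _ _ y])
    show "integral {-l..l} (\<lambda>y. d y * exp ((m + 1) * y) * exp y ^ j) = 0" for j
      using mom[of "m + 1 + real j"]
      by (simp add: distrib_right exp_add mult.assoc exp_of_nat_mult)
  qed (use l in \<open>auto intro!: continuous_intros cd inj_onI\<close>)
  then have "d y = 0" by simp
  then show ?thesis unfolding d_def F_def u_def m_def by simp
qed

section \<open>The series of G and of its x-derivative, and the signs\<close>

definition green_coeff :: "real \<Rightarrow> real \<Rightarrow> real \<Rightarrow> real \<Rightarrow> nat \<Rightarrow> real"
  where "green_coeff l \<sigma> y w m = 2 / pi * green0 (1 - \<sigma>) l (real m) w y"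

definition green_dx :: "real \<Rightarrow> real \<Rightarrow> real \<Rightarrow> real \<Rightarrow> real \<Rightarrow> real \<Rightarrow> real"
  where "green_dx l \<sigma> x y \<rho> w = (\<Sum>m. green_coeff l \<sigma> y w m * real m * sin (real m * \<rho>) * cos (real m * x))"

context
  fixes l \<sigma> :: real
  assumes l: "0 < l" and \<sigma>: "0 \<le> \<sigma>" "\<sigma> < 1"
begin

lemma green_coeff_bound:
  obtains C where "0 \<le> C" "\<And>y w m. y \<in> {-l..l} \<Longrightarrow> w \<in> {-l..l} \<Longrightarrow> \<bar>green_coeff l \<sigma> y w m\<bar> \<le> C / real m ^ 3"
proof -
  define M where "M = (1 / (2 * l) + 1) / (1 - \<sigma>)"
  have M: "0 \<le> M" using l \<sigma> by (simp add: M_def)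
  show thesis
  proof (rule that[of "2 / pi * M"])
    show "0 \<le> 2 / pi * M" using M by simp
    fix y w and m :: nat assume yw: "y \<in> {-l..l}" "w \<in> {-l..l}"
    show "\<bar>green_coeff l \<sigma> y w m\<bar> \<le> 2 / pi * M / real m ^ 3"
    proof (cases "m = 0")
      case True
      \<comment> \<open>Division by zero gives \<open>green0\<close> the value 0 at m = 0, so both
        sides are 0.\<close>
      then show ?thesis by (simp add: green_coeff_def green0_def)
    next
      case False
      have nn: "0 \<le> green0 (1 - \<sigma>) l (real m) w y"
        by (rule green0_nonneg) (use l \<sigma> False yw in auto)
      have "green0 (1 - \<sigma>) l (real m) w y \<le> M / real m ^ 3"
        unfolding M_def by (rule green0_bound[OF l \<sigma>]) (use False yw in auto)
      then have "2 / pi * green0 (1 - \<sigma>) l (real m) w y \<le> 2 / pi * (M / real m ^ 3)"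
        by (rule mult_left_mono) simp
      then show ?thesis using nn by (simp add: green_coeff_def)
    qed
  qed
qed

text \<open>One majorant of order m^-2 serves both the series of G and the differentiated one. It is
  independent of all four variables, which gives joint continuity of
  \<open>green_dx\<close>.\<close>

lemma green_dx_term_bound:
  obtains M :: "nat \<Rightarrow> real" where "summable M"
    "\<And>m y w. y \<in> {-l..l} \<Longrightarrow> w \<in> {-l..l} \<Longrightarrow> \<bar>green_coeff l \<sigma> y w m\<bar> \<le> M m"
    "\<And>m x y \<rho> w. y \<in> {-l..l} \<Longrightarrow> w \<in> {-l..l} \<Longrightarrow>
      \<bar>green_coeff l \<sigma> y w m * real m * sin (real m * \<rho>) * cos (real m * x)\<bar> \<le> M m"
proof -
  obtain C where C: "0 \<le> C" "\<And>y w m. y \<in> {-l..l} \<Longrightarrow> w \<in> {-l..l} \<Longrightarrow> \<bar>green_coeff l \<sigma> y w m\<bar> \<le> C / real m ^ 3"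
    by (rule green_coeff_bound) blast
  have cm: "\<bar>green_coeff l \<sigma> y w m\<bar> * real m \<le> C * inverse (real m ^ 2)" if "y \<in> {-l..l}" "w \<in> {-l..l}" for y w m
  proof (cases "m = 0")
    case False
    have "\<bar>green_coeff l \<sigma> y w m\<bar> * real m \<le> C / real m ^ 3 * real m"
      using C(2)[OF that] by (intro mult_right_mono) auto
    also have "\<dots> = C * inverse (real m ^ 2)"
      using False by (simp add: power2_eq_square power3_eq_cube field_simps)
    finally show ?thesis .
  qed (use C in simp)
  show thesis
  proof (rule that[of "\<lambda>m. C * inverse (real m ^ 2)"])
    show "summable (\<lambda>m. C * inverse (real m ^ 2))"
      by (intro summable_mult inverse_power_summable) simp
    fix m :: nat and x y \<rho> w :: real assume yw: "y \<in> {-l..l}" "w \<in> {-l..l}"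
    show "\<bar>green_coeff l \<sigma> y w m\<bar> \<le> C * inverse (real m ^ 2)"
    proof (cases "m = 0")
      case False
      then have "\<bar>green_coeff l \<sigma> y w m\<bar> * 1 \<le> \<bar>green_coeff l \<sigma> y w m\<bar> * real m"
        by (intro mult_left_mono) auto
      then show ?thesis using cm[OF yw, of m] by simp
    qed (use C in \<open>simp add: green_coeff_def green0_def\<close>)
    have "\<bar>sin (real m * \<rho>)\<bar> * \<bar>cos (real m * x)\<bar> \<le> 1 * 1"
      by (intro mult_mono) auto
    then have "\<bar>green_coeff l \<sigma> y w m\<bar> * real m * (\<bar>sin (real m * \<rho>)\<bar> * \<bar>cos (real m * x)\<bar>)
      \<le> \<bar>green_coeff l \<sigma> y w m\<bar> * real m * 1"
      by (intro mult_left_mono) auto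
    then show "\<bar>green_coeff l \<sigma> y w m * real m * sin (real m * \<rho>) * cos (real m * x)\<bar> \<le> C * inverse (real m ^ 2)"
      using cm[OF yw, of m] by (simp add: abs_mult mult.assoc)
  qed
qed

lemma green_dx_sums:
  assumes "y \<in> {-l..l}" "w \<in> {-l..l}"
  shows "(\<lambda>m. green_coeff l \<sigma> y w m * real m * sin (real m * \<rho>) * cos (real m * x)) sums green_dx l \<sigma> x y \<rho> w"
proof -
  obtain M where M: "summable M" "\<And>m x y \<rho> w. y \<in> {-l..l} \<Longrightarrow> w \<in> {-l..l} \<Longrightarrow>
      \<bar>green_coeff l \<sigma> y w m * real m * sin (real m * \<rho>) * cos (real m * x)\<bar> \<le> M m"
    by (rule green_dx_term_bound) blast
  have "summable (\<lambda>m. green_coeff l \<sigma> y w m * real m * sin (real m * \<rho>) * cos (real m * x))"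
    by (rule summable_comparison_test'[OF M(1), of 0]) (use M(2)[OF assms] in simp)
  then show ?thesis unfolding green_dx_def by (rule summable_sums)
qed

lemma green_series:
  assumes G: "is_green_function l \<sigma> G" and xy: "x \<in> {0..pi}" "y \<in> {-l..l}" and p: "\<rho> \<in> {0..pi}" "w \<in> {-l..l}"
  shows "(\<lambda>m. green_coeff l \<sigma> y w m * sin (real m * \<rho>) * sin (real m * x)) sums G x y \<rho> w"
proof -
  obtain M where M: "summable M" "\<And>m y w. y \<in> {-l..l} \<Longrightarrow> w \<in> {-l..l} \<Longrightarrow> \<bar>green_coeff l \<sigma> y w m\<bar> \<le> M m"
    by (rule green_dx_term_bound) blast
  have "(\<lambda>(x, y). G x y \<rho> w) \<in> H2_star l"
    using G p unfolding is_green_function_def closure_plate[OF l] by auto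
  then have "continuous_on (closure (plate l)) (\<lambda>(x, y). G x y \<rho> w)" by (simp add: H2_star_def)
  then have "continuous_on {0..pi} (\<lambda>x. (\<lambda>(x, y). G x y \<rho> w) (x, y))"
    by (rule continuous_on_compose2) (use xy in \<open>auto intro!: continuous_intros simp: closure_plate[OF l]\<close>)
  then have c: "continuous_on {0..pi} (\<lambda>x. G x y \<rho> w)" by simp
  show ?thesis
  proof (rule continuous_eq_sine_series[OF c M(1) _ _ xy(1)])
    show "\<bar>green_coeff l \<sigma> y w m * sin (real m * \<rho>)\<bar> \<le> M m" for m
    proof -
      have "\<bar>green_coeff l \<sigma> y w m\<bar> * \<bar>sin (real m * \<rho>)\<bar> \<le> \<bar>green_coeff l \<sigma> y w m\<bar> * 1"
        by (intro mult_left_mono) auto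
      then show ?thesis using M(2)[OF xy(2) p(2), of m] by (simp add: abs_mult)
    qed
    show "integral {0..pi} (\<lambda>x. G x y \<rho> w * sin (real n * x)) = pi / 2 * (green_coeff l \<sigma> y w n * sin (real n * \<rho>))"
      if "1 \<le> n" for n
      using green_fourier_coefficient[OF l \<sigma> G p xy(2) that] by (simp add: green_coeff_def)
  qed
qed

lemma green_dx_uniform_limit:
  "uniform_limit (closure (plate l) \<times> closure (plate l))
    (\<lambda>n ((x, y), (\<rho>, w)). \<Sum>m<n. green_coeff l \<sigma> y w m * real m * sin (real m * \<rho>) * cos (real m * x))
    (\<lambda>((x, y), (\<rho>, w)). green_dx l \<sigma> x y \<rho> w) sequentially"
proof -
  obtain M where M: "summable M" "\<And>m x y \<rho> w. y \<in> {-l..l} \<Longrightarrow> w \<in> {-l..l} \<Longrightarrow>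
      \<bar>green_coeff l \<sigma> y w m * real m * sin (real m * \<rho>) * cos (real m * x)\<bar> \<le> M m"
    by (rule green_dx_term_bound) blast
  have "uniform_limit (closure (plate l) \<times> closure (plate l))
    (\<lambda>n q. \<Sum>m<n. (\<lambda>m ((x, y), (\<rho>, w)). green_coeff l \<sigma> y w m * real m * sin (real m * \<rho>) * cos (real m * x)) m q)
    (\<lambda>q. \<Sum>m. (\<lambda>m ((x, y), (\<rho>, w)). green_coeff l \<sigma> y w m * real m * sin (real m * \<rho>) * cos (real m * x)) m q) sequentially"
    by (rule Weierstrass_m_test[OF _ M(1)]) (use M(2) in \<open>auto simp: closure_plate[OF l]\<close>)
  then show ?thesis by (simp add: green_dx_def split_def)
qed

lemma continuous_on_green_dx:
  "continuous_on (closure (plate l) \<times> closure (plate l)) (\<lambda>((x, y), (\<rho>, w)). green_dx l \<sigma> x y \<rho> w)"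
proof (rule uniform_limit_theorem[OF always_eventually green_dx_uniform_limit], rule allI)
  fix n
  let ?X = "closure (plate l) \<times> closure (plate l)"
  have g: "continuous_on ?X (\<lambda>q. green_coeff l \<sigma> (snd (fst q)) (snd (snd q)) m * real m)" for m
  proof (cases "m = 0")
    case False
    then show ?thesis
      unfolding green_coeff_def using l \<sigma> by (intro continuous_intros continuous_on_green0) auto
  qed simp
  have "continuous_on ?X (\<lambda>q. \<Sum>m<n. green_coeff l \<sigma> (snd (fst q)) (snd (snd q)) m * real m
      * sin (real m * fst (snd q)) * cos (real m * fst (fst q)))"
    by (intro continuous_on_sum continuous_on_mult[OF continuous_on_mult[OF g]] continuous_intros)
  then show "continuous_on ?X (\<lambda>((x, y), (\<rho>, w)). \<Sum>m<n. green_coeff l \<sigma> y w m * real m * sin (real m * \<rho>) * cos (real m * x))"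
    by (simp add: split_def)
qed simp

text \<open>The differentiated series converges uniformly, and the series itself converges at x = 0,
  where all its terms vanish. Differentiation is within [0, pi], hence one-sided at the
  ends.\<close>

lemma green_has_dx:
  assumes G: "is_green_function l \<sigma> G" and xy: "x \<in> {0..pi}" "y \<in> {-l..l}" and p: "\<rho> \<in> {0..pi}" "w \<in> {-l..l}"
  shows "((\<lambda>t. G t y \<rho> w) has_real_derivative green_dx l \<sigma> x y \<rho> w) (at x within {0..pi})"
proof -
  let ?f = "\<lambda>m x. green_coeff l \<sigma> y w m * sin (real m * \<rho>) * sin (real m * x)"
  let ?f' = "\<lambda>m x. green_coeff l \<sigma> y w m * real m * sin (real m * \<rho>) * cos (real m * x)"
  have ul: "uniform_limit {0..pi} (\<lambda>n x. \<Sum>m<n. ?f' m x) (\<lambda>x. green_dx l \<sigma> x y \<rho> w) sequentially"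
  proof (rule uniform_limitI)
    fix e :: real assume "0 < e"
    from uniform_limitD[OF green_dx_uniform_limit this]
    show "\<forall>\<^sub>F n in sequentially. \<forall>x\<in>{0..pi}. dist (\<Sum>m<n. ?f' m x) (green_dx l \<sigma> x y \<rho> w) < e"
    proof eventually_elim
      case (elim n)
      show ?case
      proof
        fix x assume "x \<in> {0..pi}"
        then have "((x, y), (\<rho>, w)) \<in> closure (plate l) \<times> closure (plate l)"
          using xy p by (simp add: closure_plate[OF l])
        with elim show "dist (\<Sum>m<n. ?f' m x) (green_dx l \<sigma> x y \<rho> w) < e" by fastforce
      qed
    qed
  qed
  have "\<exists>g. \<forall>x\<in>{0..pi}. (\<lambda>n. ?f n x) sums g x \<and> (g has_field_derivative green_dx l \<sigma> x y \<rho> w) (at x within {0..pi})"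
  proof (rule has_field_derivative_series[OF _ _ ul])
    show "(?f n has_real_derivative ?f' n x) (at x within {0..pi})" for n x
      by (auto intro!: derivative_eq_intros)
    show "0 \<in> {0..pi}" by simp
    show "summable (\<lambda>n. ?f n 0)" by simp
  qed simp
  then obtain g where g: "\<And>x. x \<in> {0..pi} \<Longrightarrow> (\<lambda>n. ?f n x) sums g x"
    "\<And>x. x \<in> {0..pi} \<Longrightarrow> (g has_field_derivative green_dx l \<sigma> x y \<rho> w) (at x within {0..pi})"
    by blast
  have "g t = G t y \<rho> w" if "t \<in> {0..pi}" for t
    using sums_unique2[OF g(1)[OF that] green_series[OF G that xy(2) p]] .
  then show ?thesis
    by (intro has_field_derivative_transform_within[OF g(2)[OF xy(1)] zero_less_one xy(1)]) auto
qed

text \<open>The factor k selects the modes that are multiples of k: k = 1 serves x = 0 and x = pi, k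
  = 2 serves x = pi/2. The weight is (2/pi) (k m)^2 K_(k m) / k, so that dividing it by m gives the
  coefficient in the series; it decreases by \<open>green0_scaled_antimono\<close>.\<close>

lemma green_dx_core_pos:
  assumes yw: "y \<in> {-l..l}" "w \<in> {-l..l}" and k: "1 \<le> k" and x: "0 < x" "x < pi"
    and s: "(\<lambda>m. green_coeff l \<sigma> y w (k * m) * real (k * m) * sin (real m * x)) sums s"
  shows "0 < s"
proof (rule sine_series_pos[OF _ _ _ x])
  let ?b = "\<lambda>m. 2 / pi * real (k * m) ^ 2 * green0 (1 - \<sigma>) l (real (k * m)) w y / real k"
  show "?b (Suc m) < ?b m" if "1 \<le> m" for m
  proof -
    have "real (k * Suc m) ^ 2 * green0 (1 - \<sigma>) l (real (k * Suc m)) w y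
      < real (k * m) ^ 2 * green0 (1 - \<sigma>) l (real (k * m)) w y"
      using k that yw by (intro green0_scaled_antimono[OF l \<sigma>]) auto
    then have "2 / pi * (real (k * Suc m) ^ 2 * green0 (1 - \<sigma>) l (real (k * Suc m)) w y)
      < 2 / pi * (real (k * m) ^ 2 * green0 (1 - \<sigma>) l (real (k * m)) w y)"
      by (intro mult_strict_left_mono) auto
    then have "2 / pi * (real (k * Suc m) ^ 2 * green0 (1 - \<sigma>) l (real (k * Suc m)) w y) / real k
      < 2 / pi * (real (k * m) ^ 2 * green0 (1 - \<sigma>) l (real (k * m)) w y) / real k"
      by (rule divide_strict_right_mono) (use k in simp)
    then show ?thesis by (simp only: mult.assoc)
  qed
  show "0 \<le> ?b m" if "1 \<le> m" for m
    using k that yw l \<sigma> by (intro divide_nonneg_nonneg mult_nonneg_nonneg green0_nonneg) auto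
  have "?b m / real m * sin (real m * x) = green_coeff l \<sigma> y w (k * m) * real (k * m) * sin (real m * x)" for m
    using k by (simp add: green_coeff_def power2_eq_square)
  then show "(\<lambda>m. ?b m / real m * sin (real m * x)) sums s" using s by simp
qed

text \<open>Trades the alternating sign produced by a cosine for a reflection of the
  variable.\<close>

lemma sin_reflect: "sin (real m * (pi - x)) = - ((-1) ^ m * sin (real m * x))"
  by (simp add: right_diff_distrib sin_diff cos_npi sin_npi)

lemma green_dx_0_pos:
  assumes yw: "y \<in> {-l..l}" "w \<in> {-l..l}" and \<rho>: "0 < \<rho>" "\<rho> < pi"
  shows "0 < green_dx l \<sigma> 0 y \<rho> w"
  by (rule green_dx_core_pos[OF yw _ \<rho>, of 1]) (use green_dx_sums[OF yw, of \<rho> 0] in simp_all)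

lemma green_dx_pi_neg:
  assumes yw: "y \<in> {-l..l}" "w \<in> {-l..l}" and \<rho>: "0 < \<rho>" "\<rho> < pi"
  shows "green_dx l \<sigma> pi y \<rho> w < 0"
proof -
  have "0 < - green_dx l \<sigma> pi y \<rho> w"
  proof (rule green_dx_core_pos[OF yw, of 1 "pi - \<rho>"])
    have "(\<lambda>m. - (green_coeff l \<sigma> y w m * real m * sin (real m * \<rho>) * cos (real m * pi))) sums - green_dx l \<sigma> pi y \<rho> w"
      by (rule sums_minus[OF green_dx_sums[OF yw]])
    then show "(\<lambda>m. green_coeff l \<sigma> y w (1 * m) * real (1 * m) * sin (real m * (pi - \<rho>))) sums - green_dx l \<sigma> pi y \<rho> w"
      unfolding sin_reflect by (simp add: cos_npi mult_ac)
  qed (use \<rho> in auto)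
  then show ?thesis by simp
qed

text \<open>cos (m pi / 2) is 0 for odd m and (-1)^j for m = 2 j, so the series runs over the even
  modes, with the variable doubled.\<close>

lemma green_dx_middle_sums:
  assumes yw: "y \<in> {-l..l}" "w \<in> {-l..l}"
  shows "(\<lambda>m. green_coeff l \<sigma> y w (2 * m) * real (2 * m) * ((-1) ^ m * sin (real m * (2 * \<rho>)))) sums green_dx l \<sigma> (pi / 2) y \<rho> w"
proof -
  let ?f = "\<lambda>m. green_coeff l \<sigma> y w m * real m * sin (real m * \<rho>) * cos (real m * (pi / 2))"
  have "?f m = 0" if "m \<notin> range (\<lambda>m. 2 * m)" for m
  proof -
    have "odd m" using that by (auto elim!: evenE)
    then obtain j where "m = 2 * j + 1" by (rule oddE)
    then have "real m * (pi / 2) = real j * pi + pi / 2" by (simp add: algebra_simps)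
    then have "cos (real m * (pi / 2)) = 0" by (simp only: cos_add sin_npi cos_pi_half)
    then show ?thesis by simp
  qed
  then have S: "(\<lambda>m. ?f (2 * m)) sums green_dx l \<sigma> (pi / 2) y \<rho> w"
    using green_dx_sums[OF yw, of \<rho> "pi / 2"] sums_mono_reindex[of "\<lambda>m. 2 * m" ?f] by (simp add: strict_mono_def)
  have E: "?f (2 * m) = green_coeff l \<sigma> y w (2 * m) * real (2 * m) * ((-1) ^ m * sin (real m * (2 * \<rho>)))" for m
    using cos_npi[of m] by (simp add: mult_ac)
  show ?thesis using S unfolding E .
qed

lemma green_dx_middle:
  assumes yw: "y \<in> {-l..l}" "w \<in> {-l..l}"
  shows "0 < \<rho> \<Longrightarrow> \<rho> < pi / 2 \<Longrightarrow> green_dx l \<sigma> (pi / 2) y \<rho> w < 0"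
    and "green_dx l \<sigma> (pi / 2) y (pi / 2) w = 0"
    and "pi / 2 < \<rho> \<Longrightarrow> \<rho> < pi \<Longrightarrow> 0 < green_dx l \<sigma> (pi / 2) y \<rho> w"
proof -
  assume \<rho>: "0 < \<rho>" "\<rho> < pi / 2"
  have "0 < - green_dx l \<sigma> (pi / 2) y \<rho> w"
  proof (rule green_dx_core_pos[OF yw, of 2 "pi - 2 * \<rho>"])
    show "(\<lambda>m. green_coeff l \<sigma> y w (2 * m) * real (2 * m) * sin (real m * (pi - 2 * \<rho>))) sums - green_dx l \<sigma> (pi / 2) y \<rho> w"
      unfolding sin_reflect using sums_minus[OF green_dx_middle_sums[OF yw, of \<rho>]] by simp
  qed (use \<rho> in auto)
  then show "green_dx l \<sigma> (pi / 2) y \<rho> w < 0" by simp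
next
  have "(\<lambda>m. 0) sums green_dx l \<sigma> (pi / 2) y (pi / 2) w"
    using green_dx_middle_sums[OF yw, of "pi / 2"] by (simp add: sin_npi)
  then show "green_dx l \<sigma> (pi / 2) y (pi / 2) w = 0"
    using sums_zero sums_unique2 by blast
next
  assume \<rho>: "pi / 2 < \<rho>" "\<rho> < pi"
  show "0 < green_dx l \<sigma> (pi / 2) y \<rho> w"
  \<comment> \<open>Here 2 rho lies beyond pi, so the alternating sign is absorbed by the shift to 2
    rho - pi in (0, pi). Unlike the reflection to pi - 2 rho used for small rho, it brings no minus
    sign.\<close>
  proof (rule green_dx_core_pos[OF yw, of 2 "2 * \<rho> - pi"])
    have "sin (real m * (2 * \<rho> - pi)) = (-1) ^ m * sin (real m * (2 * \<rho>))" for m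
      by (simp add: right_diff_distrib sin_diff cos_npi sin_npi)
    then show "(\<lambda>m. green_coeff l \<sigma> y w (2 * m) * real (2 * m) * sin (real m * (2 * \<rho> - pi))) sums green_dx l \<sigma> (pi / 2) y \<rho> w"
      using green_dx_middle_sums[OF yw, of \<rho>] by simp
  qed (use \<rho> in auto)
qed

end

theorem theorem2p2:
  fixes l \<sigma> :: real and G :: "real \<Rightarrow> real \<Rightarrow> real \<Rightarrow> real \<Rightarrow> real"
  assumes "l > 0" and "0 \<le> \<sigma>" and "\<sigma> < 1"
    and "is_green_function l \<sigma> G"
  shows
    "(\<exists>Gx :: real \<Rightarrow> real \<Rightarrow> real \<Rightarrow> real \<Rightarrow> real.
        (\<forall>(x, y) \<in> closure (plate l). \<forall>(\<rho>, w) \<in> closure (plate l).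
           ((\<lambda>t. G t y \<rho> w) has_real_derivative Gx x y \<rho> w) (at x within {0..pi})) \<and>
        continuous_on (closure (plate l) \<times> closure (plate l)) (\<lambda>((x, y), (\<rho>, w)). Gx x y \<rho> w) \<and>
        (\<forall>y \<in> {-l..l}. \<forall>w \<in> {-l..l}.
           (\<forall>\<rho> \<in> {0<..<pi}. Gx 0 y \<rho> w > 0 \<and> Gx pi y \<rho> w < 0) \<and>
           (\<forall>\<rho> \<in> {0<..<pi/2}. Gx (pi/2) y \<rho> w < 0) \<and>
           Gx (pi/2) y (pi/2) w = 0 \<and>
           (\<forall>\<rho> \<in> {pi/2<..<pi}. Gx (pi/2) y \<rho> w > 0))) \<and>
     (\<forall>(x, y) \<in> closure (plate l). \<forall>(\<rho>, w) \<in> closure (plate l). G x y \<rho> w = G \<rho> y x w) \<and>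
     (\<exists>G\<rho> :: real \<Rightarrow> real \<Rightarrow> real \<Rightarrow> real \<Rightarrow> real.
        (\<forall>(x, y) \<in> closure (plate l). \<forall>(\<rho>, w) \<in> closure (plate l).
           ((\<lambda>t. G x y t w) has_real_derivative G\<rho> x y \<rho> w) (at \<rho> within {0..pi})) \<and>
        continuous_on (closure (plate l) \<times> closure (plate l)) (\<lambda>((x, y), (\<rho>, w)). G\<rho> x y \<rho> w) \<and>
        (\<forall>y \<in> {-l..l}. \<forall>w \<in> {-l..l}.
           (\<forall>x \<in> {0<..<pi}. G\<rho> x y 0 w > 0 \<and> G\<rho> x y pi w < 0) \<and>
           (\<forall>x \<in> {0<..<pi/2}. G\<rho> x y (pi/2) w < 0) \<and>
           G\<rho> (pi/2) y (pi/2) w = 0 \<and>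
           (\<forall>x \<in> {pi/2<..<pi}. G\<rho> x y (pi/2) w > 0)))"
proof -
  note lG = assms(1-3)
  let ?X = "closure (plate l)"
  have X: "(x, y) \<in> ?X \<longleftrightarrow> x \<in> {0..pi} \<and> y \<in> {-l..l}" for x y
    by (simp add: closure_plate[OF assms(1)])
  \<comment> \<open>Both sides have the same series: its coefficients depend on y, w and m only, and
    the two sines are exchanged.\<close>
  have sym: "G x y \<rho> w = G \<rho> y x w" if "x \<in> {0..pi}" "\<rho> \<in> {0..pi}" "y \<in> {-l..l}" "w \<in> {-l..l}" for x y \<rho> w
    using sums_unique2[OF green_series[OF lG assms(4) that(1,3,2,4)]]
      green_series[OF lG assms(4) that(2,3,1,4)] by (simp add: mult_ac)
  have dx: "((\<lambda>t. G t y \<rho> w) has_real_derivative green_dx l \<sigma> x y \<rho> w) (at x within {0..pi})"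
    if "(x, y) \<in> ?X" "(\<rho>, w) \<in> ?X" for x y \<rho> w
    using that green_has_dx[OF lG assms(4)] unfolding X by blast
  \<comment> \<open>The symmetry exchanges x and rho but keeps y and w in place, so the derivative
    in rho is \<open>green_dx\<close> with its first and third arguments exchanged.\<close>
  have drho: "((\<lambda>t. G x y t w) has_real_derivative green_dx l \<sigma> \<rho> y x w) (at \<rho> within {0..pi})"
    if "(x, y) \<in> ?X" "(\<rho>, w) \<in> ?X" for x y \<rho> w
  proof (rule has_field_derivative_transform_within[OF dx zero_less_one])
    show "(\<rho>, y) \<in> ?X" "(x, w) \<in> ?X" "\<rho> \<in> {0..pi}" using that by (auto simp: X)
    show "G t y x w = G x y t w" if "t \<in> {0..pi}" for t
      using sym that \<open>(x, y) \<in> ?X\<close> \<open>(\<rho>, w) \<in> ?X\<close> unfolding X by blast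
  qed
  have cx: "continuous_on (?X \<times> ?X) (\<lambda>((x, y), (\<rho>, w)). green_dx l \<sigma> x y \<rho> w)"
    by (rule continuous_on_green_dx[OF lG])
  have "continuous_on (?X \<times> ?X) (\<lambda>q. (\<lambda>((x, y), (\<rho>, w)). green_dx l \<sigma> x y \<rho> w)
      ((fst (snd q), snd (fst q)), (fst (fst q), snd (snd q))))"
    by (rule continuous_on_compose2[OF cx])
      (auto intro!: continuous_intros simp: closure_plate[OF assms(1)])
  then have crho: "continuous_on (?X \<times> ?X) (\<lambda>((x, y), (\<rho>, w)). green_dx l \<sigma> \<rho> y x w)"
    by (simp add: split_def)
  note signs = green_dx_0_pos[OF lG] green_dx_pi_neg[OF lG] green_dx_middle[OF lG]
  show ?thesis
    by (rule conjI[OF exI[of _ "green_dx l \<sigma>"] conjI[OF _ exI[of _ "\<lambda>x y \<rho> w. green_dx l \<sigma> \<rho> y x w"]]])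
      (intro conjI ballI cx crho; auto simp: signs X intro: dx drho sym)+
qed

end
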